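(* The almost-Hermitian structure $(g,J,\omega)$ defined by $$g=(\xi-\eta)\Bigl(\frac{d\xi^2}{F(\xi)}-\frac{d\eta^2}{G(\eta)}\Bigr)+\frac{1}{\xi-\eta}\bigl(F(\xi)(dt+\eta\,dz)^2-G(\eta)(dt+\xi\,dz)^2\bigr),$$ $$Jd\xi=\frac{F(\xi)}{\xi-\eta}(dt+\eta\,dz),\quad Jdt=-\frac{\xi\,d\xi}{F(\xi)}-\frac{\eta\,d\eta}{G(\eta)},\quad Jd\eta=\frac{G(\eta)}{\eta-\xi}(dt+\xi\,dz),\quad Jdz=\frac{d\xi}{F(\xi)}+\frac{d\eta}{G(\eta)},$$ $$\omega=d\xi\wedge(dt+\eta\,dz)+d\eta\wedge(dt+\xi\,dz)$$ is an ortho-toric Kähler structure for any functions $F,G$ of one variable. Every ortho-toric Kähler surface is of this form, where $t,z$ are locally defined up to an additive constant.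
   Context: A Kähler surface $(M,g,J,\omega)$ is an oriented Riemannian $4$-manifold with a $g$-orthogonal complex structure $J$ inducing the given orientation and satisfying $\nabla J=0$; $\omega(\cdot,\cdot)=g(J\cdot,\cdot)$. $J$ acts on $1$-forms by $(J\alpha)(X)=-\alpha(JX)$. A Kähler surface is ortho-toric if it admits two independent (linearly independent at every point) hamiltonian Killing vector fields with Poisson-commuting momentum maps $\xi\eta$ and $\xi+\eta$ such that $d\xi$ and $d\eta$ are orthogonal; here a momentum map of a Killing field $K$ is a function $f$ with $K=J\,\mathrm{grad}_gf$. In the explicit form, $(\xi,\eta,t,z)$ are local coordinates and $F,G$ are smooth, on a domain where $g$ is positive definite. *)

theory Defs
  imports "HOL-Analysis.Analysis"
begin

section \<open>Smooth maps\<close>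

text \<open>
  For open sets of a Euclidean space, continuity of all directional derivatives
  up to order \<open>k\<close> is the usual notion of class \<open>C\<close> to the \<open>k\<close>.
\<close>

primrec Ck_on :: "nat \<Rightarrow> 'a::euclidean_space set \<Rightarrow> ('a \<Rightarrow> 'b::real_normed_vector) \<Rightarrow> bool" where
  "Ck_on 0 S f \<longleftrightarrow> continuous_on S f"
| "Ck_on (Suc k) S f \<longleftrightarrow> (\<forall>x\<in>S. f differentiable (at x)) \<and>
     (\<forall>v. Ck_on k S (\<lambda>x. frechet_derivative f (at x) v))"

definition smooth_on :: "'a::euclidean_space set \<Rightarrow> ('a \<Rightarrow> 'b::real_normed_vector) \<Rightarrow> bool" where
  "smooth_on S f \<longleftrightarrow> (\<forall>k. Ck_on k S f)"

text \<open>Directional derivative of \<open>f\<close> at \<open>x\<close> in the direction \<open>u\<close>.\<close>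

definition ddir :: "(real^4 \<Rightarrow> 'b::real_normed_vector) \<Rightarrow> real^4 \<Rightarrow> real^4 \<Rightarrow> 'b" where
  "ddir f x u = frechet_derivative f (at x) u"


section \<open>Smooth 4-manifolds\<close>

text \<open>
  A chart is a pair of its domain (a set of points) and its coordinate map; the values of the
  coordinate map outside the domain are irrelevant.
\<close>

type_synonym 'a chart = "'a set \<times> ('a \<Rightarrow> real^4)"

definition chart_inv :: "'a chart \<Rightarrow> real^4 \<Rightarrow> 'a" where
  "chart_inv c = inv_into (fst c) (snd c)"

definition chart_range :: "'a chart \<Rightarrow> (real^4) set" where
  "chart_range c = snd c ` fst c"

definition chart_on :: "'a topology \<Rightarrow> 'a chart \<Rightarrow> bool" where
  "chart_on M c \<longleftrightarrow> openin M (fst c) \<and> open (chart_range c) \<and>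
     homeomorphic_map (subtopology M (fst c)) (top_of_set (chart_range c)) (snd c)"

definition transition :: "'a chart \<Rightarrow> 'a chart \<Rightarrow> real^4 \<Rightarrow> real^4" where
  "transition c d = snd d \<circ> chart_inv c"

definition overlap :: "'a chart \<Rightarrow> 'a chart \<Rightarrow> (real^4) set" where
  "overlap c d = snd c ` (fst c \<inter> fst d)"

definition compatible :: "'a chart \<Rightarrow> 'a chart \<Rightarrow> bool" where
  "compatible c d \<longleftrightarrow> smooth_on (overlap c d) (transition c d) \<and>
     smooth_on (overlap d c) (transition d c)"

definition smooth_manifold :: "'a topology \<Rightarrow> 'a chart set \<Rightarrow> bool" where
  "smooth_manifold M A \<longleftrightarrow> Hausdorff_space M \<and> second_countable M \<and>
     (\<forall>c\<in>A. chart_on M c) \<and> (\<Union>c\<in>A. fst c) = topspace M \<and>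
     (\<forall>c\<in>A. \<forall>d\<in>A. compatible c d)"

text \<open>The charts of the maximal atlas determined by \<open>A\<close>.\<close>

definition smooth_chart :: "'a topology \<Rightarrow> 'a chart set \<Rightarrow> 'a chart \<Rightarrow> bool" where
  "smooth_chart M A c \<longleftrightarrow> chart_on M c \<and> (\<forall>d\<in>A. compatible c d)"

definition smooth_fun :: "'a chart set \<Rightarrow> ('a \<Rightarrow> real) \<Rightarrow> bool" where
  "smooth_fun A f \<longleftrightarrow> (\<forall>c\<in>A. smooth_on (chart_range c) (f \<circ> chart_inv c))"

text \<open>The differential of a function on the manifold, expressed in the chart \<open>c\<close>.\<close>

definition differential :: "'a chart \<Rightarrow> ('a \<Rightarrow> real) \<Rightarrow> real^4 \<Rightarrow> real^4 \<Rightarrow> real" where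
  "differential c f x v = ddir (f \<circ> chart_inv c) x v"


section \<open>Tensor fields\<close>

text \<open>
  A tensor field is given by its local expression in every chart of the atlas: the first argument
  is the chart, the second one the coordinates of the base point, and tangent vectors are
  identified with elements of the coordinate space by means of the chart. The local expressions
  are required to be smooth and to transform by the derivative of the coordinate change.
\<close>

type_synonym 'a vfield = "'a chart \<Rightarrow> real^4 \<Rightarrow> real^4"
type_synonym 'a endo = "'a chart \<Rightarrow> real^4 \<Rightarrow> real^4 \<Rightarrow> real^4"
type_synonym 'a bform = "'a chart \<Rightarrow> real^4 \<Rightarrow> real^4 \<Rightarrow> real^4 \<Rightarrow> real"

definition vector_field :: "'a chart set \<Rightarrow> 'a vfield \<Rightarrow> bool" where
  "vector_field A K \<longleftrightarrow> (\<forall>c\<in>A. smooth_on (chart_range c) (K c) \<and>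
     (\<forall>d\<in>A. \<forall>x\<in>overlap c d.
        K d (transition c d x) = ddir (transition c d) x (K c x)))"

definition endo_field :: "'a chart set \<Rightarrow> 'a endo \<Rightarrow> bool" where
  "endo_field A J \<longleftrightarrow> (\<forall>c\<in>A. (\<forall>x\<in>chart_range c. linear (J c x)) \<and>
     (\<forall>v. smooth_on (chart_range c) (\<lambda>x. J c x v)) \<and>
     (\<forall>d\<in>A. \<forall>x\<in>overlap c d. \<forall>v.
        J d (transition c d x) (ddir (transition c d) x v) = ddir (transition c d) x (J c x v)))"

definition bform_field :: "'a chart set \<Rightarrow> 'a bform \<Rightarrow> bool" where
  "bform_field A b \<longleftrightarrow> (\<forall>c\<in>A. (\<forall>x\<in>chart_range c. bilinear (b c x)) \<and>
     (\<forall>v w. smooth_on (chart_range c) (\<lambda>x. b c x v w)) \<and>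
     (\<forall>d\<in>A. \<forall>x\<in>overlap c d. \<forall>v w.
        b d (transition c d x) (ddir (transition c d) x v) (ddir (transition c d) x w) =
        b c x v w))"

definition positive_definite :: "'a chart set \<Rightarrow> 'a bform \<Rightarrow> bool" where
  "positive_definite A g \<longleftrightarrow> (\<forall>c\<in>A. \<forall>x\<in>chart_range c. \<forall>v. v \<noteq> 0 \<longrightarrow> g c x v v > 0)"

definition riemannian_metric :: "'a chart set \<Rightarrow> 'a bform \<Rightarrow> bool" where
  "riemannian_metric A g \<longleftrightarrow> bform_field A g \<and>
     (\<forall>c\<in>A. \<forall>x\<in>chart_range c. \<forall>v w. g c x v w = g c x w v) \<and> positive_definite A g"

text \<open>
  An orientation is a continuous choice of sign in each chart: \<open>+1\<close> where the coordinate frame is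
  positively oriented, \<open>-1\<close> where it is negatively oriented.
\<close>

definition orientation :: "'a chart set \<Rightarrow> ('a chart \<Rightarrow> real^4 \<Rightarrow> real) \<Rightarrow> bool" where
  "orientation A ori \<longleftrightarrow> (\<forall>c\<in>A. continuous_on (chart_range c) (ori c) \<and>
     ori c ` chart_range c \<subseteq> {1, -1} \<and>
     (\<forall>d\<in>A. \<forall>x\<in>overlap c d.
        ori c x = sgn (det (matrix (ddir (transition c d) x))) * ori d (transition c d x)))"


section \<open>Kaehler surfaces\<close>

text \<open>The action of \<open>J\<close> on 1-forms.\<close>

definition J_form :: "'a endo \<Rightarrow> 'a chart \<Rightarrow> real^4 \<Rightarrow> (real^4 \<Rightarrow> real) \<Rightarrow> real^4 \<Rightarrow> real" where
  "J_form J c x \<alpha> v = - \<alpha> (J c x v)"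

text \<open>
  \<open>J\<close> is a complex structure if near every point there are smooth coordinates
  \<open>(u1, v1, u2, v2)\<close> such that \<open>u1 + i v1\<close> and \<open>u2 + i v2\<close> are holomorphic, that is,
  \<open>J du1 = dv1\<close> and \<open>J du2 = dv2\<close> with the above sign convention.
\<close>

definition complex_structure :: "'a topology \<Rightarrow> 'a chart set \<Rightarrow> 'a endo \<Rightarrow> bool" where
  "complex_structure M A J \<longleftrightarrow> endo_field A J \<and>
     (\<forall>c\<in>A. \<forall>x\<in>chart_range c. \<forall>v. J c x (J c x v) = - v) \<and>
     (\<forall>p\<in>topspace M. \<exists>h. smooth_chart M A h \<and> p \<in> fst h \<and>
        (\<forall>c\<in>A. \<forall>x\<in>overlap c h.
           J_form J c x (differential c (\<lambda>q. snd h q $ 1) x) = differential c (\<lambda>q. snd h q $ 2) x \<and>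
           J_form J c x (differential c (\<lambda>q. snd h q $ 3) x) = differential c (\<lambda>q. snd h q $ 4) x))"

definition induces_orientation ::
  "'a chart set \<Rightarrow> 'a endo \<Rightarrow> ('a chart \<Rightarrow> real^4 \<Rightarrow> real) \<Rightarrow> bool" where
  "induces_orientation A J ori \<longleftrightarrow> (\<forall>c\<in>A. \<forall>x\<in>chart_range c. \<forall>u v.
     let D = det (vector [u, J c x u, v, J c x v] :: real^4^4)
     in D \<noteq> 0 \<longrightarrow> sgn D = ori c x)"

text \<open>
  The Christoffel symbol of the Levi-Civita connection in a chart, as a vector-valued
  bilinear form. The equation is the Koszul formula for constant (hence commuting) coordinate
  vector fields; it has a unique solution where \<open>g\<close> is nondegenerate.
\<close>

definition christoffel :: "'a bform \<Rightarrow> 'a chart \<Rightarrow> real^4 \<Rightarrow> real^4 \<Rightarrow> real^4 \<Rightarrow> real^4" where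
  "christoffel g c x u v = (THE y. \<forall>w. 2 * g c x y w =
     ddir (\<lambda>x. g c x v w) x u + ddir (\<lambda>x. g c x u w) x v - ddir (\<lambda>x. g c x u v) x w)"

text \<open>\<open>(\<nabla>\<^sub>u J) v\<close> for the Levi-Civita connection of \<open>g\<close>.\<close>

definition nabla_endo ::
  "'a bform \<Rightarrow> 'a endo \<Rightarrow> 'a chart \<Rightarrow> real^4 \<Rightarrow> real^4 \<Rightarrow> real^4 \<Rightarrow> real^4" where
  "nabla_endo g J c x u v =
     ddir (\<lambda>x. J c x v) x u + christoffel g c x u (J c x v) - J c x (christoffel g c x u v)"

definition kaehler_surface ::
  "'a topology \<Rightarrow> 'a chart set \<Rightarrow> ('a chart \<Rightarrow> real^4 \<Rightarrow> real) \<Rightarrow>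
   'a bform \<Rightarrow> 'a endo \<Rightarrow> 'a bform \<Rightarrow> bool" where
  "kaehler_surface M A ori g J \<omega> \<longleftrightarrow>
     smooth_manifold M A \<and> orientation A ori \<and> riemannian_metric A g \<and>
     complex_structure M A J \<and> induces_orientation A J ori \<and>
     (\<forall>c\<in>A. \<forall>x\<in>chart_range c.
        (\<forall>v w. g c x (J c x v) (J c x w) = g c x v w) \<and>
        (\<forall>u v. nabla_endo g J c x u v = 0) \<and>
        (\<forall>v w. \<omega> c x v w = g c x (J c x v) w))"


section \<open>Ortho-toric Kaehler surfaces\<close>

definition grad :: "'a bform \<Rightarrow> 'a chart \<Rightarrow> ('a \<Rightarrow> real) \<Rightarrow> real^4 \<Rightarrow> real^4" where
  "grad g c f x = (THE y. \<forall>v. g c x y v = differential c f x v)"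

text \<open>The local expression of \<open>L\<^sub>K g = 0\<close>.\<close>

definition killing_field :: "'a chart set \<Rightarrow> 'a bform \<Rightarrow> 'a vfield \<Rightarrow> bool" where
  "killing_field A g K \<longleftrightarrow> vector_field A K \<and>
     (\<forall>c\<in>A. \<forall>x\<in>chart_range c. \<forall>v w.
        ddir (\<lambda>x. g c x v w) x (K c x) +
        g c x (ddir (K c) x v) w + g c x v (ddir (K c) x w) = 0)"

definition momentum_map ::
  "'a chart set \<Rightarrow> 'a bform \<Rightarrow> 'a endo \<Rightarrow> 'a vfield \<Rightarrow> ('a \<Rightarrow> real) \<Rightarrow> bool" where
  "momentum_map A g J K f \<longleftrightarrow> smooth_fun A f \<and>
     (\<forall>c\<in>A. \<forall>x\<in>chart_range c. K c x = J c x (grad g c f x))"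

text \<open>
  \<open>J grad f\<close> is the hamiltonian vector field of \<open>f\<close> up to the sign convention, which does not
  affect the bracket.
\<close>

definition poisson_bracket ::
  "'a bform \<Rightarrow> 'a endo \<Rightarrow> 'a bform \<Rightarrow> 'a chart \<Rightarrow> ('a \<Rightarrow> real) \<Rightarrow> ('a \<Rightarrow> real) \<Rightarrow> real^4 \<Rightarrow> real" where
  "poisson_bracket g J \<omega> c f h x = \<omega> c x (J c x (grad g c f x)) (J c x (grad g c h x))"

definition independent_fields :: "'a chart set \<Rightarrow> 'a vfield \<Rightarrow> 'a vfield \<Rightarrow> bool" where
  "independent_fields A K L \<longleftrightarrow> (\<forall>c\<in>A. \<forall>x\<in>chart_range c. \<forall>a b.
     a *\<^sub>R K c x + b *\<^sub>R L c x = 0 \<longrightarrow> a = 0 \<and> b = 0)"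

definition ortho_toric_kaehler ::
  "'a topology \<Rightarrow> 'a chart set \<Rightarrow> ('a chart \<Rightarrow> real^4 \<Rightarrow> real) \<Rightarrow>
   'a bform \<Rightarrow> 'a endo \<Rightarrow> 'a bform \<Rightarrow> ('a \<Rightarrow> real) \<Rightarrow> ('a \<Rightarrow> real) \<Rightarrow> bool" where
  "ortho_toric_kaehler M A ori g J \<omega> \<xi> \<eta> \<longleftrightarrow>
     kaehler_surface M A ori g J \<omega> \<and> smooth_fun A \<xi> \<and> smooth_fun A \<eta> \<and>
     (\<exists>K L. killing_field A g K \<and> killing_field A g L \<and> independent_fields A K L \<and>
        momentum_map A g J K (\<lambda>p. \<xi> p * \<eta> p) \<and> momentum_map A g J L (\<lambda>p. \<xi> p + \<eta> p)) \<and>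
     (\<forall>c\<in>A. \<forall>x\<in>chart_range c.
        poisson_bracket g J \<omega> c (\<lambda>p. \<xi> p * \<eta> p) (\<lambda>p. \<xi> p + \<eta> p) x = 0 \<and>
        g c x (grad g c \<xi> x) (grad g c \<eta> x) = 0)"


section \<open>The explicit form\<close>

definition wedge :: "(real^4 \<Rightarrow> real) \<Rightarrow> (real^4 \<Rightarrow> real) \<Rightarrow> real^4 \<Rightarrow> real^4 \<Rightarrow> real" where
  "wedge \<alpha> \<beta> v w = \<alpha> v * \<beta> w - \<alpha> w * \<beta> v"

text \<open>
  On the open set \<open>W\<close>, \<open>(\<xi>, \<eta>, t, z)\<close> are coordinates belonging to the smooth structure,
  \<open>F\<close> and \<open>G\<close> are smooth on the (open) sets where they are evaluated, and the tensors are given by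
  the explicit formulas, in every chart of the atlas. The three inequations are automatic where
  \<open>g\<close> is positive definite; they rule out the convention \<open>a / 0 = 0\<close>.
\<close>

definition ortho_toric_form ::
  "'a topology \<Rightarrow> 'a chart set \<Rightarrow> 'a bform \<Rightarrow> 'a endo \<Rightarrow> 'a bform \<Rightarrow> 'a set \<Rightarrow>
   ('a \<Rightarrow> real) \<Rightarrow> ('a \<Rightarrow> real) \<Rightarrow> ('a \<Rightarrow> real) \<Rightarrow> ('a \<Rightarrow> real) \<Rightarrow>
   (real \<Rightarrow> real) \<Rightarrow> (real \<Rightarrow> real) \<Rightarrow> bool" where
  "ortho_toric_form M A g J \<omega> W \<xi> \<eta> t z F G \<longleftrightarrow>
     smooth_chart M A (W, \<lambda>p. vector [\<xi> p, \<eta> p, t p, z p]) \<and>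
     smooth_on (\<xi> ` W) F \<and> smooth_on (\<eta> ` W) G \<and>
     (\<forall>p\<in>W. \<xi> p \<noteq> \<eta> p \<and> F (\<xi> p) \<noteq> 0 \<and> G (\<eta> p) \<noteq> 0) \<and>
     (\<forall>c\<in>A. \<forall>p\<in>fst c \<inter> W.
        let x = snd c p;
            X = \<xi> p; Y = \<eta> p; FX = F (\<xi> p); GY = G (\<eta> p);
            d\<xi> = differential c \<xi> x; d\<eta> = differential c \<eta> x;
            dt = differential c t x; dz = differential c z x;
            \<theta> = (\<lambda>v. dt v + Y * dz v); \<phi> = (\<lambda>v. dt v + X * dz v)
        in (\<forall>v w. g c x v w =
              (X - Y) * (d\<xi> v * d\<xi> w / FX - d\<eta> v * d\<eta> w / GY) +
              1 / (X - Y) * (FX * (\<theta> v * \<theta> w) - GY * (\<phi> v * \<phi> w))) \<and>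
           (\<forall>v. J_form J c x d\<xi> v = FX / (X - Y) * \<theta> v) \<and>
           (\<forall>v. J_form J c x dt v = - (X * d\<xi> v / FX) - Y * d\<eta> v / GY) \<and>
           (\<forall>v. J_form J c x d\<eta> v = GY / (Y - X) * \<phi> v) \<and>
           (\<forall>v. J_form J c x dz v = d\<xi> v / FX + d\<eta> v / GY) \<and>
           (\<forall>v w. \<omega> c x v w = wedge d\<xi> \<theta> v w + wedge d\<eta> \<phi> v w))"

end

theory Submission
  imports Defs
begin

text \<open>
  In the explicit form \<open>J dz = d\<xi>/F(\<xi>) + d\<eta>/G(\<eta>)\<close> and \<open>J dt = - \<xi> d\<xi>/F(\<xi>) - \<eta> d\<eta>/G(\<eta>)\<close> are closed, because
  the coefficient of \<open>d\<xi>\<close> depends on \<open>\<xi>\<close> and that of \<open>d\<eta>\<close> on \<open>\<eta>\<close> only. Primitives of these forms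
  complete \<open>z\<close> and \<open>t\<close> to holomorphic coordinates (\<open>holomorphic_coordinates\<close>), so that \<open>J\<close> is integrable.
  Moreover \<open>\<omega> = d(\<xi> + \<eta>) \<and> dt + d(\<xi> \<eta>) \<and> dz\<close> is closed. An almost Hermitian structure with closed
  Kaehler form and vanishing Nijenhuis tensor has \<open>\<nabla>J = 0\<close> (\<open>nabla_endo_eq_0\<close>). The coefficients of \<open>g\<close>
  do not involve \<open>t\<close> and \<open>z\<close>, hence \<open>\<partial>/\<partial>z\<close> and \<open>\<partial>/\<partial>t\<close> are Killing fields (\<open>killing\<close>). Contracting them
  with \<open>\<omega>\<close> identifies them with \<open>J grad (\<xi> \<eta>)\<close> and \<open>J grad (\<xi> + \<eta>)\<close> (\<open>momentum\<close>).

  Conversely, let \<open>K = J grad (\<xi> \<eta>)\<close> and \<open>L = J grad (\<xi> + \<eta>)\<close> be the given Killing fields. As \<open>\<nabla>J = 0\<close>, they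
  are holomorphic: \<open>\<nabla>K\<close> is skew while \<open>J \<nabla>K\<close> is a Hessian and so symmetric (\<open>cov_holomorphic\<close>).
  Differentiating \<open>\<omega>(K, L) = 0\<close> gives \<open>[K, L] = 0\<close>, and then \<open>K\<close>, \<open>L\<close>, \<open>J K\<close>, \<open>J L\<close> is a frame of commuting
  fields (\<open>lie_frame\<close>). Its dual coframe consists of closed forms \<open>\<tau>z\<close>, \<open>\<tau>t\<close>, \<open>\<sigma>z\<close>, \<open>\<sigma>t\<close>, and the
  functions \<open>z\<close> and \<open>t\<close> are primitives of the first two. Put \<open>F = |d\<xi>|\<^sup>2 (\<xi> - \<eta>)\<close> and
  \<open>G = |d\<eta>|\<^sup>2 (\<eta> - \<xi>)\<close>. As \<open>d\<xi>\<close> and \<open>d\<eta>\<close> are orthogonal, \<open>\<sigma>z = J dz\<close> and \<open>\<sigma>t = J dt\<close> are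
  given by the above formulas, with \<open>F\<close> and \<open>G\<close> in place of \<open>F(\<xi>)\<close> and \<open>G(\<eta>)\<close>. That both are closed forces
  \<open>F\<close> to depend on \<open>\<xi>\<close> and \<open>G\<close> on \<open>\<eta>\<close> only (\<open>PQ_one_variable\<close>). The formulas for \<open>g\<close>, \<open>J\<close> and \<open>\<omega>\<close> then
  follow by expanding vectors in the orthogonal frame \<open>grad \<xi>\<close>, \<open>grad \<eta>\<close>, \<open>J grad \<xi>\<close>, \<open>J grad \<eta>\<close>
  (\<open>ortho_toric_formulas\<close>).

  For the uniqueness of \<open>t\<close> and \<open>z\<close>, the lengths of \<open>d\<xi>\<close> and \<open>d\<eta>\<close> determine \<open>F\<close> and \<open>G\<close>, after which \<open>J d\<xi>\<close>
  and \<open>J d\<eta>\<close> determine \<open>dt\<close> and \<open>dz\<close> (\<open>differentials_unique\<close>).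

  All computations take place in a single chart, where vector fields are functions with values in
  \<open>\<real>\<^sup>4\<close> and \<open>\<nabla>\<^sub>v X\<close> is the directional derivative of \<open>X\<close> plus a Christoffel term. The transformation laws carry
  the results from one chart to the others.
\<close>

section \<open>Calculus of smooth maps\<close>

lemma Ck_on_has_derivative:
  "Ck_on (Suc k) S f \<Longrightarrow> x \<in> S \<Longrightarrow> (f has_derivative frechet_derivative f (at x)) (at x)"
  by (simp add: frechet_derivative_works)

lemma Ck_on_SucD: "Ck_on (Suc k) S f \<Longrightarrow> Ck_on k S f"
proof (induction k arbitrary: f)
  case 0
  then have "\<And>x. x \<in> S \<Longrightarrow> continuous (at x) f"
    using differentiable_imp_continuous_within by auto
  then show ?case
    using continuous_at_imp_continuous_on by auto
next
  case (Suc k)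
  then show ?case by (metis Ck_on.simps(2))
qed

lemma Ck_on_subset: "Ck_on k S f \<Longrightarrow> T \<subseteq> S \<Longrightarrow> Ck_on k T f"
  by (induction k arbitrary: f) (auto intro: continuous_on_subset)

lemma Ck_on_cong:
  assumes "open S" "Ck_on k S f" "\<And>x. x \<in> S \<Longrightarrow> f x = g x"
  shows "Ck_on k S g"
  using assms(2,3)
proof (induction k arbitrary: f g)
  case 0
  then show ?case by (simp cong: continuous_on_cong)
next
  case (Suc k)
  have d: "(g has_derivative frechet_derivative f (at x)) (at x)" if "x \<in> S" for x
    using has_derivative_transform_within_open[OF Ck_on_has_derivative[OF Suc.prems(1) that] assms(1) that]
      Suc.prems(2) by auto
  have eq: "frechet_derivative f (at x) = frechet_derivative g (at x)" if "x \<in> S" for x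
    using frechet_derivative_at[OF d[OF that]] .
  show ?case
    unfolding Ck_on.simps
  proof safe
    show "g differentiable (at x)" if "x \<in> S" for x
      using d[OF that] unfolding differentiable_def by blast
    show "Ck_on k S (\<lambda>x. frechet_derivative g (at x) v)" for v
      by (rule Suc.IH[of "\<lambda>x. frechet_derivative f (at x) v"]) (use Suc.prems eq in auto)
  qed
qed

lemma Ck_on_SucI:
  assumes "open S" "\<And>x. x \<in> S \<Longrightarrow> (f has_derivative D x) (at x)"
    and "\<And>v. Ck_on k S (\<lambda>x. D x v)"
  shows "Ck_on (Suc k) S f"
  unfolding Ck_on.simps
proof safe
  show "f differentiable (at x)" if "x \<in> S" for x
    using assms(2)[OF that] unfolding differentiable_def by blast
  show "Ck_on k S (\<lambda>x. frechet_derivative f (at x) v)" for v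
    by (rule Ck_on_cong[OF assms(1) assms(3)[of v]]) (use assms(2) frechet_derivative_at in metis)
qed

lemma Ck_on_const: "open S \<Longrightarrow> Ck_on k S (\<lambda>x. c)"
  by (induction k arbitrary: c) (auto intro!: Ck_on_SucI derivative_eq_intros simp del: Ck_on.simps(2))

lemma Ck_on_add:
  assumes "open S" "Ck_on k S f" "Ck_on k S g"
  shows "Ck_on k S (\<lambda>x. f x + g x)"
  using assms(2,3)
proof (induction k arbitrary: f g)
  case 0
  then show ?case by (auto intro: continuous_intros)
next
  case (Suc k)
  show ?case
    by (rule Ck_on_SucI[OF assms(1) has_derivative_add[OF Ck_on_has_derivative[OF Suc.prems(1)]
          Ck_on_has_derivative[OF Suc.prems(2)]]]) (use Suc in auto)
qed

lemma Ck_on_sum: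
  assumes "open S" "\<And>i. i \<in> I \<Longrightarrow> Ck_on k S (f i)"
  shows "Ck_on k S (\<lambda>x. \<Sum>i\<in>I. f i x)"
  using assms(2)
  by (induction I rule: infinite_finite_induct) (auto intro: Ck_on_const Ck_on_add assms(1))

lemma Ck_on_bilinear:
  assumes "bounded_bilinear B" "open S" "Ck_on k S f" "Ck_on k S g"
  shows "Ck_on k S (\<lambda>x. B (f x) (g x))"
  using assms(3,4)
proof (induction k arbitrary: f g)
  case 0
  then show ?case
    using bounded_bilinear.continuous_on[OF assms(1)] by auto
next
  case (Suc k)
  have *: "Ck_on k S f" "Ck_on k S g"
    using Suc.prems by (auto intro: Ck_on_SucD simp del: Ck_on.simps)
  have "Ck_on k S (\<lambda>x. B (f x) (frechet_derivative g (at x) v) + B (frechet_derivative f (at x) v) (g x))" for v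
    using Suc.prems by (intro Ck_on_add Suc.IH assms(2) *) auto
  then show ?case
    by (intro Ck_on_SucI[OF assms(2) bounded_bilinear.FDERIV[OF assms(1)
            Ck_on_has_derivative[OF Suc.prems(1)] Ck_on_has_derivative[OF Suc.prems(2)]]])
qed

lemma Ck_on_bounded_linear:
  assumes "bounded_linear L" "open S" "Ck_on k S f"
  shows "Ck_on k S (\<lambda>x. L (f x))"
  using assms(3)
proof (induction k arbitrary: f)
  case 0
  then show ?case
    using bounded_linear.continuous_on[OF assms(1)] by auto
next
  case (Suc k)
  show ?case
    by (rule Ck_on_SucI[OF assms(2) bounded_linear.has_derivative[OF assms(1)
            Ck_on_has_derivative[OF Suc.prems(1)]]]) (use Suc in auto)
qed

text \<open>
  By the chain rule a directional derivative of \<open>f \<circ> g\<close> is a sum of products of components of the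
  derivative of \<open>g\<close> with partial derivatives of \<open>f\<close>, taken along \<open>g\<close>.
\<close>

lemma Ck_on_compose:
  fixes g :: "'a::euclidean_space \<Rightarrow> 'b::euclidean_space"
  assumes "open S" "Ck_on k T f" "Ck_on k S g" "g ` S \<subseteq> T"
  shows "Ck_on k S (\<lambda>x. f (g x))"
  using assms(2,3)
proof (induction k arbitrary: f)
  case 0
  then show ?case
    using continuous_on_compose2[of T f S g] assms(4) by auto
next
  case (Suc k)
  let ?D = "\<lambda>x v. \<Sum>b\<in>Basis. (frechet_derivative g (at x) v \<bullet> b) *\<^sub>R frechet_derivative f (at (g x)) b"
  have "((\<lambda>x. f (g x)) has_derivative ?D x) (at x)" if x: "x \<in> S" for x
  proof -
    have f: "(f has_derivative frechet_derivative f (at (g x))) (at (g x))"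
      using Ck_on_has_derivative[OF Suc.prems(1)] assms(4) x by blast
    have "frechet_derivative f (at (g x)) (frechet_derivative g (at x) v) = ?D x v" for v
      using linear_sum[OF has_derivative_linear[OF f], of "\<lambda>b. (frechet_derivative g (at x) v \<bullet> b) *\<^sub>R b" Basis]
      by (simp add: euclidean_representation linear_scale[OF has_derivative_linear[OF f]])
    then show ?thesis
      using has_derivative_compose[OF Ck_on_has_derivative[OF Suc.prems(2) x] f] by simp
  qed
  moreover have "Ck_on k S (\<lambda>x. ?D x v)" for v
  proof (rule Ck_on_sum[OF assms(1)])
    fix b :: 'b assume "b \<in> Basis"
    show "Ck_on k S (\<lambda>x. (frechet_derivative g (at x) v \<bullet> b) *\<^sub>R frechet_derivative f (at (g x)) b)"
    proof (rule Ck_on_bilinear[OF bounded_bilinear_scaleR assms(1)])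
      show "Ck_on k S (\<lambda>x. frechet_derivative g (at x) v \<bullet> b)"
        using Suc.prems(2) by (intro Ck_on_bounded_linear[OF bounded_linear_inner_left assms(1)]) simp
      show "Ck_on k S (\<lambda>x. frechet_derivative f (at (g x)) b)"
        using Suc.prems by (intro Suc.IH[of "\<lambda>y. frechet_derivative f (at y) b"] Ck_on_SucD[OF Suc.prems(2)]) simp
    qed
  qed
  ultimately show ?case
    by (rule Ck_on_SucI[OF assms(1)])
qed

text \<open>
  The derivative \<open>- 1/x\<^sup>2\<close> is a polynomial in \<open>1/x\<close>, so each differentiability order gives the next one.
\<close>

lemma Ck_on_inverse: "Ck_on k (- {0}) (inverse :: real \<Rightarrow> real)"
proof (induction k)
  case 0
  then show ?case by (auto intro!: continuous_intros)
next
  case (Suc k)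
  have o: "open (- {0::real})" by auto
  show ?case
  proof (rule Ck_on_SucI[OF o])
    show "(inverse has_derivative (\<lambda>v. - (inverse x * v * inverse x))) (at x)" if "x \<in> - {0}" for x :: real
      using that by (auto intro!: derivative_eq_intros)
    have *: "Ck_on k (- {0}) (\<lambda>x. (- v) * (inverse x * inverse x))" for v :: real
      by (intro Ck_on_bilinear[OF bounded_bilinear_mult o] Ck_on_const[OF o] Suc.IH)
    show "Ck_on k (- {0}) (\<lambda>x. - (inverse x * v * inverse x))" for v :: real
      using *[of v] by (simp add: ac_simps)
  qed
qed

lemma smooth_onD_has_derivative:
  "smooth_on S f \<Longrightarrow> x \<in> S \<Longrightarrow> (f has_derivative frechet_derivative f (at x)) (at x)"
  using Ck_on_has_derivative unfolding smooth_on_def by blast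

lemma smooth_on_has_derivative: "smooth_on S f \<Longrightarrow> x \<in> S \<Longrightarrow> (f has_derivative ddir f x) (at x)"
  using smooth_onD_has_derivative[of S f x] unfolding ddir_def .

lemma ddir_eqI: "(f has_derivative D) (at x) \<Longrightarrow> ddir f x = D"
  using frechet_derivative_at unfolding ddir_def by blast

text \<open>
  This form serves for functions known through their derivative, such as primitives of 1-forms.
\<close>

lemma smooth_onI:
  assumes "open S" "\<And>x. x \<in> S \<Longrightarrow> (f has_derivative D x) (at x)" "\<And>v. smooth_on S (\<lambda>x. D x v)"
  shows "smooth_on S f"
  unfolding smooth_on_def
proof
  fix k
  have "Ck_on (Suc k) S f"
    using Ck_on_SucI[OF assms(1,2)] assms(3) unfolding smooth_on_def by blast
  then show "Ck_on k S f" by (rule Ck_on_SucD)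
qed

lemma smooth_on_subset: "smooth_on S f \<Longrightarrow> T \<subseteq> S \<Longrightarrow> smooth_on T f"
  unfolding smooth_on_def using Ck_on_subset by blast

lemma smooth_on_cong:
  "open S \<Longrightarrow> smooth_on S f \<Longrightarrow> (\<And>x. x \<in> S \<Longrightarrow> f x = g x) \<Longrightarrow> smooth_on S g"
  unfolding smooth_on_def using Ck_on_cong by blast

lemma smooth_on_continuous_on: "smooth_on S f \<Longrightarrow> continuous_on S f"
  unfolding smooth_on_def using Ck_on.simps(1) by blast

lemma smooth_on_const: "open S \<Longrightarrow> smooth_on S (\<lambda>x. c)"
  by (simp add: smooth_on_def Ck_on_const)

lemma smooth_on_add:
  "open S \<Longrightarrow> smooth_on S f \<Longrightarrow> smooth_on S g \<Longrightarrow> smooth_on S (\<lambda>x. f x + g x)"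
  by (simp add: smooth_on_def Ck_on_add)

lemma smooth_on_sum:
  "open S \<Longrightarrow> (\<And>i. i \<in> I \<Longrightarrow> smooth_on S (f i)) \<Longrightarrow> smooth_on S (\<lambda>x. \<Sum>i\<in>I. f i x)"
  by (simp add: smooth_on_def Ck_on_sum)

lemma smooth_on_mult:
  fixes f g :: "'a::euclidean_space \<Rightarrow> real"
  shows "open S \<Longrightarrow> smooth_on S f \<Longrightarrow> smooth_on S g \<Longrightarrow> smooth_on S (\<lambda>x. f x * g x)"
  by (simp add: smooth_on_def Ck_on_bilinear[OF bounded_bilinear_mult])

lemma smooth_on_prod:
  fixes f :: "'i \<Rightarrow> 'a::euclidean_space \<Rightarrow> real"
  assumes "open S" "\<And>i. i \<in> I \<Longrightarrow> smooth_on S (f i)"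
  shows "smooth_on S (\<lambda>x. \<Prod>i\<in>I. f i x)"
  using assms(2)
  by (induction I rule: infinite_finite_induct) (auto intro: smooth_on_const smooth_on_mult assms(1))

lemma smooth_on_scaleR:
  fixes f :: "'a::euclidean_space \<Rightarrow> real"
  shows "open S \<Longrightarrow> smooth_on S f \<Longrightarrow> smooth_on S g \<Longrightarrow> smooth_on S (\<lambda>x. f x *\<^sub>R g x)"
  by (simp add: smooth_on_def Ck_on_bilinear[OF bounded_bilinear_scaleR])

lemma smooth_on_bounded_linear:
  "bounded_linear L \<Longrightarrow> open S \<Longrightarrow> smooth_on S f \<Longrightarrow> smooth_on S (\<lambda>x. L (f x))"
  by (simp add: smooth_on_def Ck_on_bounded_linear)

lemma smooth_on_minus: "open S \<Longrightarrow> smooth_on S f \<Longrightarrow> smooth_on S (\<lambda>x. - f x)"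
  by (rule smooth_on_bounded_linear[OF bounded_linear_minus[OF bounded_linear_ident]])

lemma smooth_on_diff:
  "open S \<Longrightarrow> smooth_on S f \<Longrightarrow> smooth_on S g \<Longrightarrow> smooth_on S (\<lambda>x. f x - g x)"
  using smooth_on_add[of S f "\<lambda>x. - g x"] smooth_on_minus[of S g] by simp

lemma smooth_on_compose:
  fixes g :: "'a::euclidean_space \<Rightarrow> 'b::euclidean_space"
  shows "open S \<Longrightarrow> smooth_on T f \<Longrightarrow> smooth_on S g \<Longrightarrow> g ` S \<subseteq> T \<Longrightarrow> smooth_on S (\<lambda>x. f (g x))"
  unfolding smooth_on_def by (rule allI, rule Ck_on_compose[of S _ T]) simp_all

lemma smooth_on_inverse:
  fixes f :: "'a::euclidean_space \<Rightarrow> real"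
  assumes "open S" "smooth_on S f" "\<And>x. x \<in> S \<Longrightarrow> f x \<noteq> 0"
  shows "smooth_on S (\<lambda>x. inverse (f x))"
proof -
  have 1: "smooth_on (- {0}) (inverse :: real \<Rightarrow> real)"
    unfolding smooth_on_def by (rule allI, rule Ck_on_inverse)
  have 2: "f ` S \<subseteq> - {0}" using assms(3) by auto
  show ?thesis
    by (rule smooth_on_compose[OF assms(1) 1 assms(2) 2])
qed

lemma smooth_on_divide:
  fixes f g :: "'a::euclidean_space \<Rightarrow> real"
  assumes "open S" "smooth_on S f" "smooth_on S g" "\<And>x. x \<in> S \<Longrightarrow> g x \<noteq> 0"
  shows "smooth_on S (\<lambda>x. f x / g x)"
  using smooth_on_mult[OF assms(1,2) smooth_on_inverse[OF assms(1,3,4)]] by (simp add: divide_inverse)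

lemma smooth_on_ident: "open S \<Longrightarrow> smooth_on S (\<lambda>x. x)"
  by (rule smooth_onI[OF _ has_derivative_ident]) (auto intro: smooth_on_const)

lemma smooth_on_nth: "open S \<Longrightarrow> smooth_on S f \<Longrightarrow> smooth_on S (\<lambda>x. f x $ i)"
  by (rule smooth_on_bounded_linear[OF bounded_linear_vec_nth])

lemma smooth_on_vec:
  fixes f :: "'a::euclidean_space \<Rightarrow> real^'n"
  assumes "open S" "\<And>i. smooth_on S (\<lambda>x. f x $ i)"
  shows "smooth_on S f"
proof -
  have *: "f = (\<lambda>x. \<Sum>i\<in>UNIV. (f x $ i) *\<^sub>R axis i 1)"
    using basis_expansion[of "f _"] by (simp add: fun_eq_iff scalar_mult_eq_scaleR)
  show ?thesis
    by (subst *) (intro smooth_on_sum smooth_on_scaleR smooth_on_const assms)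
qed

lemma smooth_on_ddir: "smooth_on S f \<Longrightarrow> smooth_on S (\<lambda>x. ddir f x v)"
  unfolding smooth_on_def ddir_def using Ck_on.simps(2) by blast

lemma smooth_on_linear_field:
  fixes T :: "'a::euclidean_space \<Rightarrow> real^'n \<Rightarrow> 'b::real_normed_vector"
  assumes "open S" "\<And>x. x \<in> S \<Longrightarrow> linear (T x)" "\<And>v. smooth_on S (\<lambda>x. T x v)" "smooth_on S X"
  shows "smooth_on S (\<lambda>x. T x (X x))"
proof (rule smooth_on_cong[OF assms(1)])
  show "smooth_on S (\<lambda>x. \<Sum>i\<in>UNIV. (X x $ i) *\<^sub>R T x (axis i 1))"
    by (intro smooth_on_sum smooth_on_scaleR smooth_on_nth assms)
  fix x assume "x \<in> S"
  have "X x = (\<Sum>i\<in>UNIV. (X x $ i) *\<^sub>R axis i 1)"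
    using basis_expansion[of "X x"] by (simp add: scalar_mult_eq_scaleR)
  then have "T x (X x) = T x (\<Sum>i\<in>UNIV. (X x $ i) *\<^sub>R axis i 1)" by simp
  then show "(\<Sum>i\<in>UNIV. (X x $ i) *\<^sub>R T x (axis i 1)) = T x (X x)"
    by (simp only: linear_sum[OF assms(2)[OF \<open>x \<in> S\<close>]] linear_scale[OF assms(2)[OF \<open>x \<in> S\<close>]])
qed

lemma linear_ddir: "smooth_on S f \<Longrightarrow> x \<in> S \<Longrightarrow> linear (ddir f x)"
  using smooth_on_has_derivative has_derivative_linear by blast

lemma smooth_on_det:
  fixes A :: "'a::euclidean_space \<Rightarrow> real^'n^'n"
  assumes "open S" "\<And>i j. smooth_on S (\<lambda>x. A x $ i $ j)"
  shows "smooth_on S (\<lambda>x. det (A x))"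
  unfolding det_def
  by (intro smooth_on_sum smooth_on_mult smooth_on_const smooth_on_prod assms)

text \<open>
  Both iterated derivatives are limits of the same second difference quotient of \<open>f\<close>; by the mean
  value theorem this quotient is a value of each of them at a point close to \<open>x\<close>.
\<close>

lemma second_difference:
  fixes f :: "real^4 \<Rightarrow> real"
  assumes "0 < h" "smooth_on S f"
    and "\<And>s r. 0 \<le> s \<Longrightarrow> s \<le> h \<Longrightarrow> 0 \<le> r \<Longrightarrow> r \<le> h \<Longrightarrow> x + s *\<^sub>R u + r *\<^sub>R v \<in> S"
  obtains s r where "0 \<le> s" "s \<le> h" "0 \<le> r" "r \<le> h"
    "f (x + h *\<^sub>R u + h *\<^sub>R v) - f (x + h *\<^sub>R u) - f (x + h *\<^sub>R v) + f x =
      h * h * ddir (\<lambda>y. ddir f y u) (x + s *\<^sub>R u + r *\<^sub>R v) v"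
proof -
  have lin: "ddir f y (a *\<^sub>R w) = a * ddir f y w" if "y \<in> S" for y a w
    using linear_scale[OF linear_ddir[OF assms(2) that]] by simp
  have su: "smooth_on S (\<lambda>y. ddir f y u)"
    by (rule smooth_on_ddir[OF assms(2)])
  have lin2: "ddir (\<lambda>y. ddir f y u) y (a *\<^sub>R w) = a * ddir (\<lambda>y. ddir f y u) y w" if "y \<in> S" for y a w
    using linear_scale[OF linear_ddir[OF su that]] by simp
  define g where "g = (\<lambda>s. f (x + s *\<^sub>R u + h *\<^sub>R v) - f (x + s *\<^sub>R u))"
  have xs: "x + s *\<^sub>R u \<in> S" if "0 \<le> s" "s \<le> h" for s
    using assms(3)[OF that, of 0] assms(1) by simp
  have g': "(g has_real_derivative ddir f (x + s *\<^sub>R u + h *\<^sub>R v) u - ddir f (x + s *\<^sub>R u) u) (at s)"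
    if "0 \<le> s" "s \<le> h" for s
  proof -
    have 1: "x + s *\<^sub>R u + h *\<^sub>R v \<in> S" using assms(3)[OF that, of h] assms(1) by simp
    have a: "((\<lambda>s. x + s *\<^sub>R u + h *\<^sub>R v) has_derivative (\<lambda>a. a *\<^sub>R u)) (at s)"
      by (auto intro!: derivative_eq_intros)
    have b: "((\<lambda>s. x + s *\<^sub>R u) has_derivative (\<lambda>a. a *\<^sub>R u)) (at s)"
      by (auto intro!: derivative_eq_intros)
    have "(g has_derivative (\<lambda>a. ddir f (x + s *\<^sub>R u + h *\<^sub>R v) (a *\<^sub>R u) - ddir f (x + s *\<^sub>R u) (a *\<^sub>R u))) (at s)"
      unfolding g_def
      by (intro has_derivative_diff has_derivative_compose[OF a smooth_on_has_derivative[OF assms(2) 1]]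
          has_derivative_compose[OF b smooth_on_has_derivative[OF assms(2) xs[OF that]]])
    then show ?thesis
      by (rule has_derivative_imp_has_field_derivative)
        (simp add: lin[OF 1] lin[OF xs[OF that]] left_diff_distrib right_diff_distrib mult.commute)
  qed
  obtain s where s: "0 < s" "s < h"
    "g h - g 0 = (h - 0) * (ddir f (x + s *\<^sub>R u + h *\<^sub>R v) u - ddir f (x + s *\<^sub>R u) u)"
    using MVT2[OF assms(1) g'] by blast
  define k where "k = (\<lambda>r. ddir f (x + s *\<^sub>R u + r *\<^sub>R v) u)"
  have k': "(k has_real_derivative ddir (\<lambda>y. ddir f y u) (x + s *\<^sub>R u + r *\<^sub>R v) v) (at r)"
    if "0 \<le> r" "r \<le> h" for r
  proof -
    have 1: "x + s *\<^sub>R u + r *\<^sub>R v \<in> S" using assms(3)[of s r] that s by simp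
    have a: "((\<lambda>r. x + s *\<^sub>R u + r *\<^sub>R v) has_derivative (\<lambda>a. a *\<^sub>R v)) (at r)"
      by (auto intro!: derivative_eq_intros)
    have "(k has_derivative (\<lambda>a. ddir (\<lambda>y. ddir f y u) (x + s *\<^sub>R u + r *\<^sub>R v) (a *\<^sub>R v))) (at r)"
      unfolding k_def by (rule has_derivative_compose[OF a smooth_on_has_derivative[OF su 1]])
    then show ?thesis
      by (rule has_derivative_imp_has_field_derivative) (simp add: lin2[OF 1])
  qed
  obtain r where r: "0 < r" "r < h"
    "k h - k 0 = (h - 0) * ddir (\<lambda>y. ddir f y u) (x + s *\<^sub>R u + r *\<^sub>R v) v"
    using MVT2[OF assms(1) k'] by blast
  have "g h - g 0 = h * h * ddir (\<lambda>y. ddir f y u) (x + s *\<^sub>R u + r *\<^sub>R v) v"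
    using s(3) r(3) by (simp add: k_def)
  then show ?thesis
    using that[of s r] s(1,2) r(1,2) by (simp add: g_def)
qed

lemma ddir_ddir_commute:
  fixes f :: "real^4 \<Rightarrow> real"
  assumes "open S" "smooth_on S f" "x \<in> S"
  shows "ddir (\<lambda>y. ddir f y u) x v = ddir (\<lambda>y. ddir f y v) x u"
proof (rule ccontr)
  let ?P = "\<lambda>y. ddir (\<lambda>y. ddir f y u) y v" and ?Q = "\<lambda>y. ddir (\<lambda>y. ddir f y v) y u"
  assume ne: "?P x \<noteq> ?Q x"
  define e where "e = \<bar>?P x - ?Q x\<bar> / 2"
  have e: "e > 0" using ne by (simp add: e_def)
  have "continuous_on S ?P" "continuous_on S ?Q"
    by (intro smooth_on_continuous_on smooth_on_ddir assms(2))+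
  then have "continuous (at x) ?P" "continuous (at x) ?Q"
    using continuous_on_eq_continuous_at assms by blast+
  then have "\<exists>d>0. \<forall>y. dist y x < d \<longrightarrow> dist (?P y) (?P x) < e"
      "\<exists>d>0. \<forall>y. dist y x < d \<longrightarrow> dist (?Q y) (?Q x) < e"
    unfolding continuous_at_eps_delta using e by (simp_all add: dist_real_def)
  then obtain d1 d2 where d: "d1 > 0" "\<And>y. dist y x < d1 \<Longrightarrow> dist (?P y) (?P x) < e"
      "d2 > 0" "\<And>y. dist y x < d2 \<Longrightarrow> dist (?Q y) (?Q x) < e"
    by (elim exE conjE) (rule that, assumption, simp, assumption, simp)
  obtain d3 where d3: "d3 > 0" "ball x d3 \<subseteq> S"
    using assms open_contains_ball by blast
  define m where "m = min d1 (min d2 d3)"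
  have m: "m > 0" using d d3 by (simp add: m_def)
  define h where "h = m / (2 * (norm u + norm v + 1))"
  have pos: "norm u + norm v + 1 > 0" by (simp add: add_nonneg_pos)
  have h: "h > 0" using m pos by (simp add: h_def)
  have near: "dist (x + s *\<^sub>R u + r *\<^sub>R v) x < m" if "0 \<le> s" "s \<le> h" "0 \<le> r" "r \<le> h" for s r
  proof -
    have "dist (x + s *\<^sub>R u + r *\<^sub>R v) x \<le> s * norm u + r * norm v"
      using that norm_triangle_ineq[of "s *\<^sub>R u" "r *\<^sub>R v"] by (simp add: dist_norm algebra_simps)
    also have "\<dots> \<le> h * norm u + h * norm v"
      using that by (intro add_mono mult_right_mono) auto
    also have "\<dots> \<le> h * (norm u + norm v + 1)" using h by (simp add: algebra_simps)
    also have "\<dots> = m / 2" using pos by (simp add: h_def field_simps)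
    finally show ?thesis using m by simp
  qed
  have S: "x + s *\<^sub>R u + r *\<^sub>R v \<in> S" if "0 \<le> s" "s \<le> h" "0 \<le> r" "r \<le> h" for s r
    using near[OF that] d3(2) by (auto simp: m_def dist_commute)
  have S': "x + s *\<^sub>R v + r *\<^sub>R u \<in> S" if "0 \<le> s" "s \<le> h" "0 \<le> r" "r \<le> h" for s r
    using S[OF that(3,4,1,2)] by (simp add: ac_simps)
  obtain s r where 1: "0 \<le> s" "s \<le> h" "0 \<le> r" "r \<le> h"
    "f (x + h *\<^sub>R u + h *\<^sub>R v) - f (x + h *\<^sub>R u) - f (x + h *\<^sub>R v) + f x = h * h * ?P (x + s *\<^sub>R u + r *\<^sub>R v)"
    by (rule second_difference[OF h assms(2) S])
  obtain s' r' where 2: "0 \<le> s'" "s' \<le> h" "0 \<le> r'" "r' \<le> h"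
    "f (x + h *\<^sub>R v + h *\<^sub>R u) - f (x + h *\<^sub>R v) - f (x + h *\<^sub>R u) + f x = h * h * ?Q (x + s' *\<^sub>R v + r' *\<^sub>R u)"
    by (rule second_difference[OF h assms(2) S'])
  have "f (x + h *\<^sub>R v + h *\<^sub>R u) = f (x + h *\<^sub>R u + h *\<^sub>R v)" by (simp add: ac_simps)
  then have "h * h * ?P (x + s *\<^sub>R u + r *\<^sub>R v) = h * h * ?Q (x + s' *\<^sub>R v + r' *\<^sub>R u)"
    using 1(5) 2(5) by linarith
  then have "?P (x + s *\<^sub>R u + r *\<^sub>R v) = ?Q (x + s' *\<^sub>R v + r' *\<^sub>R u)"
    using h by simp
  moreover have "dist (?P (x + s *\<^sub>R u + r *\<^sub>R v)) (?P x) < e"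
    using d(2) near[OF 1(1-4)] by (simp add: m_def)
  moreover have "dist (?Q (x + s' *\<^sub>R v + r' *\<^sub>R u)) (?Q x) < e"
    using d(4) near[OF 2(3,4,1,2)] by (simp add: m_def ac_simps)
  ultimately have "dist (?P x) (?Q x) < 2 * e"
    using dist_triangle_half_l[of "?P x" "?P (x + s *\<^sub>R u + r *\<^sub>R v)" "2 * e" "?Q x"]
    by (simp add: dist_commute)
  then show False
    by (simp add: e_def dist_real_def)
qed

abbreviation hess :: "(real^4 \<Rightarrow> real) \<Rightarrow> real^4 \<Rightarrow> real^4 \<Rightarrow> real^4 \<Rightarrow> real" where
  "hess f x u v \<equiv> ddir (\<lambda>y. ddir f y v) x u"

section \<open>The Poincare lemma and the inverse function theorem\<close>

lemma continuous_on_Blinfun: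
  fixes T :: "'a::topological_space \<Rightarrow> 'b::euclidean_space \<Rightarrow> 'c::real_normed_vector"
  assumes "\<And>x. x \<in> S \<Longrightarrow> linear (T x)" "\<And>v. continuous_on S (\<lambda>x. T x v)"
  shows "continuous_on S (\<lambda>x. Blinfun (T x))"
proof -
  have "blinfun_apply (Blinfun (T x)) v = T x v" if "x \<in> S" for x v
    using that by (simp add: assms(1) bounded_linear_Blinfun_apply linear_conv_bounded_linear[symmetric])
  then have "continuous_on S (\<lambda>x. blinfun_apply (Blinfun (T x)) v)" for v
    using continuous_on_eq[OF assms(2)[of v]] by simp
  then show ?thesis
    unfolding continuous_on_def by (blast intro: tendsto_componentwise1)
qed

text \<open>
  The primitive is \<open>f x = \<integral>\<^sub>0\<^sup>1 \<tau>(a + s (x - a)) (x - a) ds\<close> for some base point \<open>a\<close>. As the derivative of \<open>\<tau>\<close>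
  is symmetric, the derivative of the integrand in the direction \<open>v\<close> is the \<open>s\<close>-derivative of
  \<open>s \<tau>(a + s (x - a)) v\<close>, so that it integrates to \<open>\<tau> x v\<close>.
\<close>

lemma poincare_lemma:
  fixes \<tau> :: "real^4 \<Rightarrow> real^4 \<Rightarrow> real"
  assumes "open S" "convex S"
    and lin: "\<And>x. x \<in> S \<Longrightarrow> linear (\<tau> x)"
    and smooth: "\<And>v. smooth_on S (\<lambda>x. \<tau> x v)"
    and closed: "\<And>x u v. x \<in> S \<Longrightarrow> ddir (\<lambda>y. \<tau> y v) x u = ddir (\<lambda>y. \<tau> y u) x v"
  obtains f where "smooth_on S f" "\<And>x. x \<in> S \<Longrightarrow> ddir f x = \<tau> x"
proof (cases "S = {}")
  case True
  then show ?thesis using that[of "\<lambda>x. 0"] smooth_on_const by auto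
next
  case False
  then obtain a where a: "a \<in> S" by auto
  define p where "p = (\<lambda>x s. a + s *\<^sub>R (x - a))"
  have pS: "p x s \<in> S" if "x \<in> S" "s \<in> {0..1}" for x s
  proof -
    have "(1 - s) *\<^sub>R a + s *\<^sub>R x \<in> S"
      using convexD[OF assms(2) a that(1), of "1 - s" s] that(2) by auto
    then show ?thesis by (simp add: p_def algebra_simps)
  qed
  define T where "T = (\<lambda>i y. \<tau> y (axis i 1))"
  have T: "\<tau> y w = (\<Sum>i\<in>UNIV. w $ i * T i y)" if "y \<in> S" for y w
  proof -
    have "w = (\<Sum>i\<in>UNIV. (w $ i) *\<^sub>R axis i 1)"
      using basis_expansion[of w] by (simp add: scalar_mult_eq_scaleR)
    then have "\<tau> y w = \<tau> y (\<Sum>i\<in>UNIV. (w $ i) *\<^sub>R axis i 1)" by simp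
    then show ?thesis
      by (simp only: linear_sum[OF lin[OF that]] linear_scale[OF lin[OF that]] T_def real_scaleR_def)
  qed
  have sT: "smooth_on S (T i)" for i unfolding T_def by (rule smooth)
  have dT: "(T i has_derivative ddir (T i) y) (at y)" if "y \<in> S" for y i
    by (rule smooth_on_has_derivative[OF sT that])
  have d\<tau>: "ddir (\<lambda>y. \<tau> y w) y v = (\<Sum>i\<in>UNIV. w $ i * ddir (T i) y v)" if y: "y \<in> S" for y v w
  proof -
    have "((\<lambda>y. \<Sum>i\<in>UNIV. w $ i * T i y) has_derivative (\<lambda>v. \<Sum>i\<in>UNIV. w $ i * ddir (T i) y v)) (at y)"
      by (intro has_derivative_sum has_derivative_mult_right dT y)
    then have "((\<lambda>y. \<tau> y w) has_derivative (\<lambda>v. \<Sum>i\<in>UNIV. w $ i * ddir (T i) y v)) (at y)"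
      by (rule has_derivative_transform_within_open[OF _ assms(1) y]) (simp add: T)
    then show ?thesis by (simp add: ddir_eqI)
  qed
  define D where "D = (\<lambda>(x, s) v. \<Sum>i\<in>UNIV. (v $ i * T i (p x s) + (x - a) $ i * (s * ddir (T i) (p x s) v)))"
  have D: "((\<lambda>x. \<tau> (p x s) (x - a)) has_derivative D (x, s)) (at x)" if x: "x \<in> S" "s \<in> {0..1}" for x s
  proof -
    have p: "((\<lambda>x. p x s) has_derivative (\<lambda>v. s *\<^sub>R v)) (at x)"
      unfolding p_def by (auto intro!: derivative_eq_intros)
    have "((\<lambda>x. T i (p x s)) has_derivative (\<lambda>v. s * ddir (T i) (p x s) v)) (at x)" for i
      using has_derivative_compose[OF p dT[OF pS[OF x]]]
        linear_scale[OF linear_ddir[OF sT pS[OF x]]] by simp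
    moreover have "((\<lambda>x. (x - a) $ i) has_derivative (\<lambda>v. v $ i)) (at x)" for i
      by (auto intro!: derivative_eq_intros bounded_linear.has_derivative[OF bounded_linear_vec_nth])
    ultimately have "((\<lambda>x. (x - a) $ i * T i (p x s)) has_derivative
        (\<lambda>v. (x - a) $ i * (s * ddir (T i) (p x s) v) + v $ i * T i (p x s))) (at x)" for i
      by (rule has_derivative_mult[rotated])
    then have "((\<lambda>x. \<Sum>i\<in>UNIV. (x - a) $ i * T i (p x s)) has_derivative
        (\<lambda>v. \<Sum>i\<in>UNIV. (x - a) $ i * (s * ddir (T i) (p x s) v) + v $ i * T i (p x s))) (at x)"
      by (rule has_derivative_sum)
    then have "((\<lambda>x. \<tau> (p x s) (x - a)) has_derivative
        (\<lambda>v. \<Sum>i\<in>UNIV. (x - a) $ i * (s * ddir (T i) (p x s) v) + v $ i * T i (p x s))) (at x)"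
      by (rule has_derivative_transform_within_open[OF _ assms(1) x(1)]) (simp add: T[OF pS[OF _ x(2)]])
    then show ?thesis
      by (simp add: D_def add.commute)
  qed
  have linD: "linear (D (x, s))" if "x \<in> S" "s \<in> {0..1}" for x s
    using D[OF that] has_derivative_linear by blast
  have contp: "continuous_on (S \<times> {0..1}) (\<lambda>q. p (fst q) (snd q))"
    unfolding p_def by (intro continuous_intros)
  have contD: "continuous_on (S \<times> {0..1}) (\<lambda>q. D q v)" for v
  proof -
    have pS': "(\<lambda>q. p (fst q) (snd q)) ` (S \<times> {0..1}) \<subseteq> S" using pS by auto
    have "continuous_on (S \<times> {0..1}) (\<lambda>q. T i (p (fst q) (snd q)))"
      "continuous_on (S \<times> {0..1}) (\<lambda>q. ddir (T i) (p (fst q) (snd q)) v)" for i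
      by (rule continuous_on_compose2[OF smooth_on_continuous_on contp pS'], intro smooth_on_ddir sT)+
    then show ?thesis
      unfolding D_def split_def by (intro continuous_intros)
  qed
  define f where "f = (\<lambda>x. integral (cbox 0 1) (\<lambda>s. \<tau> (p x s) (x - a)))"
  have cont1: "continuous_on {0..1} (\<lambda>s. \<tau> (p x s) w)" if x: "x \<in> S" for x w
    by (rule continuous_on_compose2[OF smooth_on_continuous_on[OF smooth]])
      (use pS[OF x] in \<open>auto simp: p_def intro!: continuous_intros\<close>)
  have f: "(f has_derivative \<tau> x) (at x)" if x: "x \<in> S" for x
  proof -
    have *: "(f has_derivative blinfun_apply (integral (cbox 0 1) (\<lambda>s. Blinfun (D (x, s))))) (at x within S)"
      unfolding f_def
    proof (rule leibniz_rule[where fx = "\<lambda>x s. Blinfun (D (x, s))"])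
      fix y s assume "y \<in> S" "s \<in> cbox (0::real) 1"
      then have "blinfun_apply (Blinfun (D (y, s))) = D (y, s)"
        using linD by (simp add: bounded_linear_Blinfun_apply linear_conv_bounded_linear[symmetric])
      then show "((\<lambda>x. \<tau> (p x s) (x - a)) has_derivative blinfun_apply (Blinfun (D (y, s)))) (at y within S)"
        using D[of y s] \<open>y \<in> S\<close> \<open>s \<in> cbox 0 1\<close> has_derivative_at_withinI by auto
    next
      show "(\<lambda>s. \<tau> (p y s) (y - a)) integrable_on cbox 0 1" if "y \<in> S" for y
        using cont1[OF that] by (intro integrable_continuous) simp
      show "continuous_on (S \<times> cbox 0 1) (\<lambda>(x, s). Blinfun (D (x, s)))"
        using continuous_on_Blinfun[of "S \<times> {0..1}" D] linD contD by (auto simp: split_def)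
    qed (use x assms(2) in auto)
    have contB: "continuous_on {0..1} (\<lambda>s. Blinfun (D (x, s)))"
      by (rule continuous_on_Blinfun)
        (use linD x in \<open>auto intro!: continuous_on_compose2[OF contD] continuous_intros\<close>)
    have "blinfun_apply (integral (cbox 0 1) (\<lambda>s. Blinfun (D (x, s)))) v = \<tau> x v" for v
    proof -
      have "((\<lambda>s. s * \<tau> (p x s) v) has_vector_derivative D (x, s) v) (at s within {0..1})"
        if s: "s \<in> {0..1}" for s
      proof -
        have p: "((\<lambda>s. p x s) has_derivative (\<lambda>r. r *\<^sub>R (x - a))) (at s)"
          unfolding p_def by (auto intro!: derivative_eq_intros)
        have "((\<lambda>s. \<tau> (p x s) v) has_derivative (\<lambda>r. ddir (\<lambda>y. \<tau> y v) (p x s) (r *\<^sub>R (x - a)))) (at s)"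
          by (rule has_derivative_compose[OF p smooth_on_has_derivative[OF smooth pS[OF x s]]])
        then have "((\<lambda>s. s * \<tau> (p x s) v) has_derivative
            (\<lambda>r. s * ddir (\<lambda>y. \<tau> y v) (p x s) (r *\<^sub>R (x - a)) + r * \<tau> (p x s) v)) (at s)"
          by (intro has_derivative_mult has_derivative_ident)
        moreover have "s * ddir (\<lambda>y. \<tau> y v) (p x s) (r *\<^sub>R (x - a)) + r * \<tau> (p x s) v = r *\<^sub>R D (x, s) v" for r
        proof -
          define Q where "Q = (\<Sum>i\<in>UNIV. (x - a) $ i * ddir (T i) (p x s) v)"
          have "ddir (\<lambda>y. \<tau> y v) (p x s) (r *\<^sub>R (x - a)) = r * ddir (\<lambda>y. \<tau> y v) (p x s) (x - a)"
            using linear_scale[OF linear_ddir[OF smooth pS[OF x s]]] by simp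
          also have "ddir (\<lambda>y. \<tau> y v) (p x s) (x - a) = Q"
            by (simp only: closed[OF pS[OF x s], of v "x - a"] d\<tau>[OF pS[OF x s], of "x - a"] Q_def)
          finally have 1: "ddir (\<lambda>y. \<tau> y v) (p x s) (r *\<^sub>R (x - a)) = r * Q" .
          have 2: "D (x, s) v = \<tau> (p x s) v + s * Q"
            unfolding D_def prod.case T[OF pS[OF x s]] Q_def sum.distrib sum_distrib_left
            by (simp only: mult.left_commute)
          show ?thesis
            unfolding 1 2 by (simp add: algebra_simps)
        qed
        ultimately have "((\<lambda>s. s * \<tau> (p x s) v) has_vector_derivative D (x, s) v) (at s)"
          by (simp add: has_vector_derivative_def)
        then show ?thesis by (rule has_vector_derivative_at_within)
      qed
      then have "((\<lambda>s. D (x, s) v) has_integral (1 * \<tau> (p x 1) v - 0 * \<tau> (p x 0) v)) {0..1}"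
        by (intro fundamental_theorem_of_calculus) auto
      then have 1: "integral (cbox 0 1) (\<lambda>s. D (x, s) v) = \<tau> x v"
        by (simp add: integral_unique p_def)
      have "blinfun_apply (integral (cbox 0 1) (\<lambda>s. Blinfun (D (x, s)))) v =
          integral (cbox 0 1) (\<lambda>s. blinfun_apply (Blinfun (D (x, s))) v)"
        by (rule blinfun_apply_integral) (use integrable_continuous_interval[OF contB] in simp)
      also have "\<dots> = integral (cbox 0 1) (\<lambda>s. D (x, s) v)"
        by (rule integral_cong)
          (use linD x in \<open>simp add: bounded_linear_Blinfun_apply linear_conv_bounded_linear[symmetric]\<close>)
      finally show ?thesis using 1 by simp
    qed
    then have "blinfun_apply (integral (cbox 0 1) (\<lambda>s. Blinfun (D (x, s)))) = \<tau> x" by blast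
    then show ?thesis
      using * at_within_open[OF x assms(1)] by simp
  qed
  show ?thesis
  proof (rule that)
    show "smooth_on S f"
      by (rule smooth_onI[OF assms(1) f smooth])
    show "ddir f x = \<tau> x" if "x \<in> S" for x
      by (rule ddir_eqI[OF f[OF that]])
  qed
qed

text \<open>
  By Cramer's rule the entries of the inverse of the derivative of \<open>f\<close> are quotients of polynomials
  in the partial derivatives.
\<close>

lemma smooth_inverse_derivative:
  fixes f :: "real^'n \<Rightarrow> real^'n"
  assumes "open S" "smooth_on S f"
    and inj: "\<And>x w. x \<in> S \<Longrightarrow> frechet_derivative f (at x) w = 0 \<Longrightarrow> w = 0"
  obtains C where "smooth_on S C"
    "\<And>x w. x \<in> S \<Longrightarrow> frechet_derivative f (at x) w = v \<longleftrightarrow> w = C x"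
proof -
  define D where "D = (\<lambda>x. frechet_derivative f (at x))"
  have lin: "linear (D x)" if "x \<in> S" for x
    using has_derivative_linear[OF smooth_onD_has_derivative[OF assms(2) that]] by (simp add: D_def)
  have sm: "smooth_on S (\<lambda>x. D x v)" for v
    using assms(2) unfolding D_def smooth_on_def using Ck_on.simps(2) by blast
  have det: "det (matrix (D x)) \<noteq> 0" if "x \<in> S" for x
    using inj[OF that] linear_injective_0[OF lin[OF that]] det_nz_iff_inj[OF lin[OF that]]
    by (simp add: D_def)
  define C where "C = (\<lambda>x. (\<chi> k. det (\<chi> i j. if j = k then v $ i else matrix (D x) $ i $ j) /
     det (matrix (D x))) :: real^'n)"
  have C: "D x w = v \<longleftrightarrow> w = C x" if "x \<in> S" for w x
  proof -
    have "matrix (D x) *v w = D x w"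
      using lin[OF that] by (simp add: matrix_works)
    then show ?thesis unfolding C_def using cramer[OF det[OF that(1)], of w v] by auto
  qed
  have "smooth_on S C"
  proof (rule smooth_on_vec[OF assms(1)])
    fix k
    have e: "smooth_on S (\<lambda>x. matrix (D x) $ i $ j)" for i j
      unfolding matrix_def by simp (intro smooth_on_nth assms(1) sm)
    have "smooth_on S (\<lambda>x. if j = k then v $ i else matrix (D x) $ i $ j)" for i j
      using e smooth_on_const[OF assms(1)] by (cases "j = k") auto
    then show "smooth_on S (\<lambda>x. C x $ k)"
      unfolding C_def by simp (intro smooth_on_divide smooth_on_det assms(1) e det; simp)
  qed
  with that C show ?thesis
    unfolding D_def by blast
qed

text \<open>
  The derivative of the local inverse \<open>g\<close> is the inverse of the derivative of \<open>f\<close>, taken along \<open>g\<close>.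
  The former depends smoothly on the point, so that \<open>g\<close> is always one time more differentiable than
  already known, and hence smooth.
\<close>

lemma smooth_inverse_function:
  fixes f :: "real^'n \<Rightarrow> real^'n"
  assumes "open S" "smooth_on S f" "x0 \<in> S"
    and inj: "\<And>v. frechet_derivative f (at x0) v = 0 \<Longrightarrow> v = 0"
  obtains U V g where "open U" "U \<subseteq> S" "x0 \<in> U" "open V" "homeomorphism U V f g" "smooth_on V g"
proof -
  define D where "D = (\<lambda>x. frechet_derivative f (at x))"
  have df: "(f has_derivative D x) (at x)" if "x \<in> S" for x
    using smooth_onD_has_derivative[OF assms(2) that] by (simp add: D_def)
  have lin: "linear (D x)" if "x \<in> S" for x
    using has_derivative_linear[OF df[OF that]] .
  have sm: "smooth_on S (\<lambda>x. D x v)" for v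
    using assms(2) unfolding D_def smooth_on_def using Ck_on.simps(2) by blast
  have ap: "blinfun_apply (Blinfun (D x)) = D x" if "x \<in> S" for x
    using lin[OF that] by (simp add: bounded_linear_Blinfun_apply linear_conv_bounded_linear[symmetric])
  have "inj (D x0)"
    using inj linear_injective_0[OF lin[OF assms(3)]] by (simp add: D_def)
  then obtain h where h: "linear h" "h \<circ> D x0 = id"
    using linear_injective_left_inverse[OF lin[OF assms(3)]] by blast
  have inv: "Blinfun h o\<^sub>L Blinfun (D x0) = id_blinfun"
  proof (rule blinfun_eqI)
    fix v show "blinfun_apply (Blinfun h o\<^sub>L Blinfun (D x0)) v = blinfun_apply id_blinfun v"
      using h ap[OF assms(3)] pointfree_idE[OF h(2)]
      by (simp add: bounded_linear_Blinfun_apply linear_conv_bounded_linear[symmetric])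
  qed
  have df': "(f has_derivative blinfun_apply (Blinfun (D x))) (at x)" if "x \<in> S" for x
    using df[OF that] ap[OF that] by simp
  have cont: "continuous_on S (\<lambda>x. Blinfun (D x))"
    by (rule continuous_on_Blinfun) (use lin sm smooth_on_continuous_on in auto)
  obtain U V g g' where UV: "open U" "U \<subseteq> S" "x0 \<in> U" "open V" "homeomorphism U V f g"
    "\<And>y. y \<in> V \<Longrightarrow> (g has_derivative (g' y)) (at y)"
    "\<And>y. y \<in> V \<Longrightarrow> g' y = inv (blinfun_apply (Blinfun (D (g y))))"
    "\<And>y. y \<in> V \<Longrightarrow> bij (blinfun_apply (Blinfun (D (g y))))"
    using inverse_function_theorem[OF assms(1) df' cont assms(3) inv] by metis
  have gU: "g ` V = U"
    using UV(5) by (rule homeomorphism_image2)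
  have gV: "g y \<in> U" if "y \<in> V" for y
    using gU that by blast
  have gS: "g y \<in> S" if "y \<in> V" for y
    using gV[OF that] UV(2) by blast
  have bij: "bij (D x)" if xU: "x \<in> U" for x
  proof -
    obtain y where y: "y \<in> V" "x = g y" using xU gU by blast
    show ?thesis using UV(8)[OF y(1)] ap[OF gS[OF y(1)]] y(2) by simp
  qed
  have inj': "w = 0" if "x \<in> U" "frechet_derivative f (at x) w = 0" for x w
    using bij[OF that(1)] that(2) linear_injective_0[OF lin] that(1) UV(2)
    by (auto simp: bij_def D_def)
  have smU: "smooth_on U f"
    by (rule smooth_on_subset[OF assms(2) UV(2)])
  have "Ck_on k V g" for k
  proof (induction k)
    case 0
    then show ?case using UV(5) by (simp add: homeomorphism_def)
  next
    case (Suc k)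
    show ?case
    proof (rule Ck_on_SucI[OF UV(4) UV(6)])
      fix v
      obtain C where C: "smooth_on U C"
        "\<And>x w. x \<in> U \<Longrightarrow> frechet_derivative f (at x) w = v \<longleftrightarrow> w = C x"
        by (rule smooth_inverse_derivative[OF UV(1) smU, where v = v]) (use inj' that in blast)+
      have "Ck_on k V (\<lambda>y. C (g y))"
        by (rule Ck_on_compose[OF UV(4) _ Suc]) (use C(1) gU in \<open>auto simp: smooth_on_def\<close>)
      moreover have "C (g y) = g' y v" if "y \<in> V" for y
      proof -
        have "D (g y) (g' y v) = v"
          by (simp add: UV(7)[OF that] ap[OF gS[OF that]] surj_f_inv_f bij_is_surj[OF bij[OF gV[OF that]]])
        then show ?thesis using C(2)[OF gV[OF that]] by (simp add: D_def)
      qed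
      ultimately show "Ck_on k V (\<lambda>y. g' y v)"
        by (rule Ck_on_cong[OF UV(4)])
    qed
  qed
  then show ?thesis
    using that UV(1-5) unfolding smooth_on_def by blast
qed

section \<open>Coordinate changes and smooth charts\<close>

text \<open>
  Images and preimages of open sets characterize charts without the subspace topologies of the
  definition.
\<close>

lemma chart_onI:
  assumes W: "openin M W" and inj: "inj_on k W"
    and op: "\<And>T. openin M T \<Longrightarrow> T \<subseteq> W \<Longrightarrow> open (k ` T)"
    and co: "\<And>S. open S \<Longrightarrow> openin M {p \<in> W. k p \<in> S}"
  shows "chart_on M (W, k)"
proof -
  have sub: "W \<subseteq> topspace M" using W by (rule openin_subset)
  have top: "topspace (subtopology M W) = W" using sub by auto
  have top': "topspace M \<inter> W = W" using sub by auto
  have "homeomorphic_map (subtopology M W) (top_of_set (k ` W)) k"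
  proof (rule bijective_open_imp_homeomorphic_map)
    show "continuous_map (subtopology M W) (top_of_set (k ` W)) k"
      unfolding continuous_map_def top
    proof (intro conjI allI impI)
      fix S assume "openin (top_of_set (k ` W)) S"
      then obtain T where T: "open T" "S = k ` W \<inter> T" by (auto simp: openin_open)
      have "{x \<in> W. k x \<in> S} = {p \<in> W. k p \<in> T}" using T(2) by auto
      then show "openin (subtopology M W) {x \<in> W. k x \<in> S}"
        using co[OF T(1)] openin_open_subtopology[OF W] by auto
    qed auto
    show "open_map (subtopology M W) (top_of_set (k ` W)) k"
      unfolding open_map_def
      using op openin_open_subtopology[OF W] by (auto intro!: open_subset)
  qed (use inj in \<open>simp_all add: top'\<close>)
  then show ?thesis
    using W op[OF W] by (simp add: chart_on_def chart_range_def)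
qed

context
  fixes M :: "'a topology" and c :: "'a chart"
  assumes c: "chart_on M c"
begin

lemma openin_chart_domain: "openin M (fst c)"
  using c by (simp add: chart_on_def)

lemma open_chart_range: "open (chart_range c)"
  using c by (simp add: chart_on_def)

lemma topspace_chart_domain: "topspace (subtopology M (fst c)) = fst c"
  using openin_subset[OF openin_chart_domain] by auto

lemma chart_homeomorphic_map:
  "homeomorphic_map (subtopology M (fst c)) (top_of_set (chart_range c)) (snd c)"
  using c by (simp add: chart_on_def)

lemma inj_on_chart: "inj_on (snd c) (fst c)"
  using homeomorphic_imp_injective_map[OF chart_homeomorphic_map] topspace_chart_domain by simp

lemma chart_inv_chart [simp]: "p \<in> fst c \<Longrightarrow> chart_inv c (snd c p) = p"
  unfolding chart_inv_def by (rule inv_into_f_f[OF inj_on_chart])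

lemma open_chart_image:
  assumes "openin M T" "T \<subseteq> fst c"
  shows "open (snd c ` T)"
proof -
  have "openin (subtopology M (fst c)) T"
    using assms openin_open_subtopology[OF openin_chart_domain] by blast
  then have "openin (top_of_set (chart_range c)) (snd c ` T)"
    using homeomorphic_imp_open_map[OF chart_homeomorphic_map] by (simp add: open_map_def)
  then show ?thesis
    using open_chart_range openin_open_eq by blast
qed

lemma openin_chart_vimage:
  assumes "open S"
  shows "openin M {p \<in> fst c. snd c p \<in> S}"
proof -
  have "openin (top_of_set (chart_range c)) (chart_range c \<inter> S)"
    using assms by (rule openin_open_Int)
  then have "openin (subtopology M (fst c)) {p \<in> fst c. snd c p \<in> chart_range c \<inter> S}"
    using homeomorphic_imp_continuous_map[OF chart_homeomorphic_map]
    unfolding continuous_map_def topspace_chart_domain by blast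
  moreover have "{p \<in> fst c. snd c p \<in> chart_range c \<inter> S} = {p \<in> fst c. snd c p \<in> S}"
    by (auto simp: chart_range_def)
  ultimately show ?thesis
    using openin_open_subtopology[OF openin_chart_domain] by simp
qed

lemma transition_chart [simp]: "p \<in> fst c \<Longrightarrow> transition c d (snd c p) = snd d p"
  by (simp add: transition_def)

lemma overlap_memI: "p \<in> fst c \<Longrightarrow> p \<in> fst d \<Longrightarrow> snd c p \<in> overlap c d"
  by (simp add: overlap_def)

end

lemma chart_range_imp: "x \<in> chart_range c \<Longrightarrow> chart_inv c x \<in> fst c \<and> snd c (chart_inv c x) = x"
  unfolding chart_range_def chart_inv_def by (auto simp: inv_into_into f_inv_into_f)

lemma overlap_iff:
  assumes "chart_on M c"
  shows "x \<in> overlap c d \<longleftrightarrow> x \<in> chart_range c \<and> chart_inv c x \<in> fst d"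
proof
  assume "x \<in> overlap c d"
  then obtain p where "p \<in> fst c" "p \<in> fst d" "x = snd c p" by (auto simp: overlap_def)
  then show "x \<in> chart_range c \<and> chart_inv c x \<in> fst d"
    using assms by (auto simp: chart_range_def)
next
  assume "x \<in> chart_range c \<and> chart_inv c x \<in> fst d"
  then show "x \<in> overlap c d"
    using chart_range_imp[of x c] overlap_memI[OF assms] by metis
qed

lemma open_overlap:
  assumes "chart_on M c" "chart_on M d"
  shows "open (overlap c d)"
  unfolding overlap_def
  using open_chart_image[OF assms(1) openin_Int[OF openin_chart_domain[OF assms(1)]
        openin_chart_domain[OF assms(2)]]] by simp

text \<open>
  Besides two charts of the atlas, such a pair can consist of a chart of the atlas and one of the
  maximal atlas.
\<close>

locale chart_pair =
  fixes M :: "'a topology" and c d :: "'a chart"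
  assumes c: "chart_on M c" and d: "chart_on M d" and comp: "compatible c d"
begin

lemma open_overlaps: "open (overlap c d)" "open (overlap d c)"
  using open_overlap[OF c d] open_overlap[OF d c] .

lemma transition_mem: "x \<in> overlap c d \<Longrightarrow> transition c d x \<in> overlap d c"
  using c by (auto simp: overlap_def)

lemma transition_inverse: "x \<in> overlap c d \<Longrightarrow> transition d c (transition c d x) = x"
  using c d by (auto simp: overlap_def)

lemma chart_inv_transition: "x \<in> overlap c d \<Longrightarrow> chart_inv d (transition c d x) = chart_inv c x"
  using c d by (auto simp: overlap_def)

lemma transition_has_derivative:
  "x \<in> overlap c d \<Longrightarrow> (transition c d has_derivative ddir (transition c d) x) (at x)"
  using comp smooth_on_has_derivative unfolding compatible_def by blast

lemma inverse_transition_has_derivative: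
  "y \<in> overlap d c \<Longrightarrow> (transition d c has_derivative ddir (transition d c) y) (at y)"
  using comp smooth_on_has_derivative unfolding compatible_def by blast

lemma linear_transition: "x \<in> overlap c d \<Longrightarrow> linear (ddir (transition c d) x)"
  using transition_has_derivative has_derivative_linear by blast

lemma ddir_transition_inverse:
  assumes "x \<in> overlap c d"
  shows "ddir (transition d c) (transition c d x) (ddir (transition c d) x v) = v"
proof -
  have "((\<lambda>x. transition d c (transition c d x)) has_derivative
      (\<lambda>v. ddir (transition d c) (transition c d x) (ddir (transition c d) x v))) (at x)"
    by (rule has_derivative_compose[OF transition_has_derivative[OF assms]
          inverse_transition_has_derivative[OF transition_mem[OF assms]]])
  then have "((\<lambda>x. x) has_derivative
      (\<lambda>v. ddir (transition d c) (transition c d x) (ddir (transition c d) x v))) (at x)"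
    by (rule has_derivative_transform_within_open[OF _ open_overlaps(1) assms])
      (rule transition_inverse)
  then show ?thesis
    using has_derivative_unique[OF has_derivative_ident] by metis
qed

lemma inj_transition: "x \<in> overlap c d \<Longrightarrow> ddir (transition c d) x v = 0 \<Longrightarrow> v = 0"
  using ddir_transition_inverse[of x v]
    linear_0[OF has_derivative_linear[OF inverse_transition_has_derivative[OF transition_mem]]] by simp

lemma chart_fun_transition: "x \<in> overlap c d \<Longrightarrow> (f \<circ> chart_inv d) (transition c d x) = (f \<circ> chart_inv c) x"
  by (simp add: chart_inv_transition)

lemma has_derivative_change_chart:
  assumes "x \<in> overlap c d" "(f \<circ> chart_inv d has_derivative D) (at (transition c d x))"
  shows "(f \<circ> chart_inv c has_derivative (\<lambda>v. D (ddir (transition c d) x v))) (at x)"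
  by (rule has_derivative_transform_within_open[OF _ open_overlaps(1) assms(1) chart_fun_transition])
    (rule has_derivative_compose[OF transition_has_derivative[OF assms(1)] assms(2)])

lemma differential_change_chart:
  assumes "x \<in> overlap c d" "smooth_on S (f \<circ> chart_inv d)" "transition c d x \<in> S"
  shows "differential d f (transition c d x) (ddir (transition c d) x v) = differential c f x v"
  using ddir_eqI[OF has_derivative_change_chart[OF assms(1) smooth_on_has_derivative[OF assms(2,3)]]]
  by (simp add: differential_def)

end

lemma chart_pair_sym: "chart_pair M c d \<Longrightarrow> chart_pair M d c"
  by (auto simp: chart_pair_def compatible_def)

lemma atlas_smooth_chart: "smooth_manifold M A \<Longrightarrow> c \<in> A \<Longrightarrow> smooth_chart M A c"
  by (simp add: smooth_manifold_def smooth_chart_def compatible_def)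

text \<open>
  The coordinate changes of the new chart are those of \<open>c\<close>, composed with \<open>\<psi>\<close> or its inverse \<open>g\<close>.
\<close>

lemma smooth_chart_compose:
  assumes A: "\<And>d. d \<in> A \<Longrightarrow> chart_on M d" and cA: "smooth_chart M A c"
    and W: "openin M W" "W \<subseteq> fst c"
    and \<psi>: "homeomorphism (snd c ` W) V \<psi> g" "smooth_on (snd c ` W) \<psi>" and V: "open V" "smooth_on V g"
    and k: "\<And>q. q \<in> W \<Longrightarrow> k q = \<psi> (snd c q)"
  shows "smooth_chart M A (W, k)"
proof -
  have c: "chart_on M c" and comp: "\<And>d. d \<in> A \<Longrightarrow> compatible c d"
    using cA by (auto simp: smooth_chart_def)
  have Wc: "q \<in> fst c" if "q \<in> W" for q using that W(2) by blast
  have cW: "q \<in> W" if "q \<in> fst c" "snd c q \<in> snd c ` W" for q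
    using that inj_onD[OF inj_on_chart[OF c]] Wc by blast
  have gk: "g (k q) = snd c q" if "q \<in> W" for q
    using homeomorphism_apply1[OF \<psi>(1), of "snd c q"] that by (simp add: k)
  have kW: "k ` W = V"
  proof -
    have "k ` W = \<psi> ` snd c ` W" using k by (simp add: image_image)
    then show ?thesis using homeomorphism_image1[OF \<psi>(1)] by simp
  qed
  have oW: "open (snd c ` W)" by (rule open_chart_image[OF c W])
  have chW: "chart_on M (W, k)"
  proof (rule chart_onI[OF W(1)])
    show "inj_on k W"
    proof (rule inj_onI)
      fix q r assume "q \<in> W" "r \<in> W" "k q = k r"
      then have "snd c q = snd c r" using gk by metis
      then show "q = r" using \<open>q \<in> W\<close> \<open>r \<in> W\<close> Wc chart_inv_chart[OF c] by metis
    qed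
    show "open (k ` T)" if T: "openin M T" "T \<subseteq> W" for T
    proof -
      have o: "open (snd c ` T)"
        by (rule open_chart_image[OF c T(1)]) (use T(2) Wc in blast)
      have "k ` T = V \<inter> g -` (snd c ` T)"
      proof (intro set_eqI iffI)
        fix y assume "y \<in> k ` T"
        then show "y \<in> V \<inter> g -` (snd c ` T)" using T(2) kW gk by auto
      next
        fix y assume y: "y \<in> V \<inter> g -` (snd c ` T)"
        then obtain q where q: "q \<in> W" "y = k q" using kW by blast
        then obtain r where r: "r \<in> T" "snd c q = snd c r" using y gk by auto
        then have "q = r" using inj_onD[OF inj_on_chart[OF c]] q(1) T(2) Wc by blast
        then show "y \<in> k ` T" using q(2) r(1) by blast
      qed
      then show ?thesis
        using continuous_open_preimage[OF _ V(1) o, of g] smooth_on_continuous_on[OF V(2)] by simp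
    qed
    show "openin M {q \<in> W. k q \<in> T}" if T: "open T" for T
    proof -
      have o: "open (snd c ` W \<inter> \<psi> -` T)"
        using continuous_open_preimage[OF _ oW T] smooth_on_continuous_on[OF \<psi>(2)] by blast
      have e: "{q \<in> W. k q \<in> T} = {q \<in> fst c. snd c q \<in> snd c ` W \<inter> \<psi> -` T}"
        using Wc cW k by auto
      show ?thesis unfolding e by (rule openin_chart_vimage[OF c o])
    qed
  qed
  have "compatible (W, k) d" if dA: "d \<in> A" for d
  proof -
    have d: "chart_on M d" by (rule A[OF dA])
    have o: "open (overlap (W, k) d)" "open (overlap d (W, k))"
      using open_overlap[OF chW d] open_overlap[OF d chW] .
    have 1: "g y \<in> overlap c d \<and> transition c d (g y) = transition (W, k) d y \<and> y \<in> V"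
      if y: "y \<in> overlap (W, k) d" for y
    proof -
      obtain q where q: "q \<in> W" "q \<in> fst d" "y = k q" using y by (auto simp: overlap_def)
      then show ?thesis
        using transition_chart[OF chW, of q d] transition_chart[OF c, of q d] gk[OF q(1)] Wc[OF q(1)]
          overlap_memI[OF c Wc[OF q(1)] q(2)] kW by auto
    qed
    have 2: "x \<in> overlap d c \<and> transition d c x \<in> snd c ` W \<and> \<psi> (transition d c x) = transition d (W, k) x"
      if x: "x \<in> overlap d (W, k)" for x
    proof -
      obtain q where q: "q \<in> W" "q \<in> fst d" "x = snd d q" using x by (auto simp: overlap_def)
      then show ?thesis
        using transition_chart[OF d, of q "(W, k)"] transition_chart[OF d, of q c] k[OF q(1)]
          overlap_memI[OF d q(2) Wc[OF q(1)]] by simp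
    qed
    have "smooth_on (overlap (W, k) d) (\<lambda>y. transition c d (g y))"
      by (rule smooth_on_compose[OF o(1) _ smooth_on_subset[OF V(2)]])
        (use comp[OF dA] 1 in \<open>auto simp: compatible_def\<close>)
    then have "smooth_on (overlap (W, k) d) (transition (W, k) d)"
      by (rule smooth_on_cong[OF o(1)]) (use 1 in blast)
    moreover have "smooth_on (overlap d (W, k)) (\<lambda>x. \<psi> (transition d c x))"
      by (rule smooth_on_compose[OF o(2) \<psi>(2) smooth_on_subset[of "overlap d c"]])
        (use comp[OF dA] 2 in \<open>auto simp: compatible_def\<close>)
    then have "smooth_on (overlap d (W, k)) (transition d (W, k))"
      by (rule smooth_on_cong[OF o(2)]) (use 2 in blast)
    ultimately show ?thesis by (simp add: compatible_def)
  qed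
  then show ?thesis using chW by (simp add: smooth_chart_def)
qed

lemma smooth_chart_restrict:
  assumes A: "\<And>d. d \<in> A \<Longrightarrow> chart_on M d" and h: "smooth_chart M A (W, k)" and V: "openin M V" "V \<subseteq> W"
  shows "smooth_chart M A (V, k)"
proof -
  have o: "open (k ` V)"
    using open_chart_image[of M "(W, k)" V] h V by (simp add: smooth_chart_def)
  show ?thesis
    by (rule smooth_chart_compose[OF A h V(1), of "k ` V" "\<lambda>x. x" "\<lambda>x. x"])
      (use V(2) o in \<open>simp_all add: homeomorphism_def smooth_on_ident\<close>)
qed

lemma smooth_chart_translate:
  assumes A: "\<And>d. d \<in> A \<Longrightarrow> chart_on M d" and h: "smooth_chart M A (W, k)"
    and k': "\<And>q. q \<in> W \<Longrightarrow> k' q = k q + a"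
  shows "smooth_chart M A (W, k')"
proof -
  have ch: "chart_on M (W, k)" using h by (simp add: smooth_chart_def)
  have o: "open (k ` W)" using open_chart_range[OF ch] by (simp add: chart_range_def)
  have o': "open ((\<lambda>x. x + a) ` k ` W)"
    using open_translation[OF o, of a] by (simp add: add.commute)
  show ?thesis
    by (rule smooth_chart_compose[OF A h, of W "(\<lambda>x. x + a) ` k ` W" "\<lambda>x. x + a" "\<lambda>x. x - a"])
      (use openin_chart_domain[OF ch] o o' k' in \<open>auto simp: homeomorphism_def image_image intro!: continuous_intros smooth_on_add smooth_on_diff smooth_on_ident smooth_on_const\<close>)
qed

text \<open>
  By the inverse function theorem \<open>k\<close>, read in the chart \<open>c\<close>, is a diffeomorphism near the point.
\<close>

lemma smooth_chart_from_functions: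
  assumes M: "smooth_manifold M A" and cA: "c \<in> A" and p: "p \<in> fst c" "snd c p \<in> S"
    and S: "open S" "S \<subseteq> chart_range c" and sm: "smooth_on S (k \<circ> chart_inv c)"
    and inj: "\<And>v. ddir (k \<circ> chart_inv c) (snd c p) v = 0 \<Longrightarrow> v = 0"
  obtains W where "p \<in> W" "W \<subseteq> fst c" "snd c ` W \<subseteq> S" "smooth_chart M A (W, k)"
proof -
  have A: "\<And>d. d \<in> A \<Longrightarrow> chart_on M d" and c: "chart_on M c"
    using M cA by (auto simp: smooth_manifold_def)
  obtain U V g where UV: "open U" "U \<subseteq> S" "snd c p \<in> U" "open V"
    "homeomorphism U V (k \<circ> chart_inv c) g" "smooth_on V g"
    by (rule smooth_inverse_function[OF S(1) sm p(2)]) (use inj in \<open>auto simp: ddir_def\<close>)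
  define W where "W = {q \<in> fst c. snd c q \<in> U}"
  have W: "openin M W" "W \<subseteq> fst c"
    unfolding W_def by (rule openin_chart_vimage[OF c UV(1)]) blast
  have cW: "snd c ` W = U"
  proof
    show "U \<subseteq> snd c ` W"
    proof
      fix x assume "x \<in> U"
      then have "chart_inv c x \<in> W" "snd c (chart_inv c x) = x"
        using chart_range_imp[of x c] UV(2) S(2) by (auto simp: W_def)
      then show "x \<in> snd c ` W" by (metis imageI)
    qed
  qed (auto simp: W_def)
  have "smooth_chart M A (W, k)"
    by (rule smooth_chart_compose[OF A atlas_smooth_chart[OF M cA] W, of V "k \<circ> chart_inv c" g])
      (use UV W(2) c smooth_on_subset[OF sm UV(2)] in \<open>auto simp: cW\<close>)
  then show ?thesis
    using that[of W] W(2) UV(2,3) p(1) cW by (simp add: W_def)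
qed

section \<open>Linear algebra and product rules\<close>

lemma linear_eq_sum_axis:
  fixes f :: "real^'n \<Rightarrow> 'b::real_vector"
  assumes "linear f"
  shows "f w = (\<Sum>i\<in>UNIV. (w $ i) *\<^sub>R f (axis i 1))"
proof -
  have "w = (\<Sum>i\<in>UNIV. (w $ i) *\<^sub>R axis i 1)"
    using basis_expansion[of w] by (simp add: scalar_mult_eq_scaleR)
  then have "f w = f (\<Sum>i\<in>UNIV. (w $ i) *\<^sub>R axis i 1)" by simp
  then show ?thesis
    by (simp only: linear_sum[OF assms] linear_scale[OF assms])
qed

lemma ddir_cong:
  assumes "open S" "x \<in> S" "\<And>y. y \<in> S \<Longrightarrow> f y = h y"
  shows "ddir f x = ddir h x"
proof -
  have "(f has_derivative D) (at x) \<longleftrightarrow> (h has_derivative D) (at x)" for D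
    using has_derivative_transform_within_open[OF _ assms(1,2), of f D UNIV h]
      has_derivative_transform_within_open[OF _ assms(1,2), of h D UNIV f] assms(3) by auto
  then show ?thesis by (simp add: ddir_def frechet_derivative_def fun_eq_iff)
qed

lemma ddir_const [simp]: "ddir (\<lambda>x. k) x u = 0"
  by (simp add: ddir_def)

text \<open>
  Expanding \<open>X\<close> in the standard basis reduces this to the product rule for scalar multiples.
\<close>

lemma has_derivative_linear_field:
  fixes T :: "real^4 \<Rightarrow> real^4 \<Rightarrow> 'b::real_normed_vector"
  assumes S: "open S" and x: "x \<in> S" and lin: "\<And>y. y \<in> S \<Longrightarrow> linear (T y)"
    and sm: "\<And>v. smooth_on S (\<lambda>y. T y v)" and X: "(X has_derivative X') (at x)"
  shows "((\<lambda>y. T y (X y)) has_derivative (\<lambda>v. ddir (\<lambda>y. T y (X x)) x v + T x (X' v))) (at x)"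
proof -
  have D: "((\<lambda>y. T y (axis i 1)) has_derivative ddir (\<lambda>y. T y (axis i 1)) x) (at x)" for i
    by (rule smooth_on_has_derivative[OF sm x])
  have Xi: "((\<lambda>y. X y $ i) has_derivative (\<lambda>v. X' v $ i)) (at x)" for i
    by (rule bounded_linear.has_derivative[OF bounded_linear_vec_nth X])
  have e: "((\<lambda>y. T y (Z y)) has_derivative
      (\<lambda>v. \<Sum>i\<in>UNIV. Z x $ i *\<^sub>R ddir (\<lambda>y. T y (axis i 1)) x v + Z' v $ i *\<^sub>R T x (axis i 1))) (at x)"
    if "\<And>i. ((\<lambda>y. Z y $ i) has_derivative (\<lambda>v. Z' v $ i)) (at x)" for Z Z'
  proof (rule has_derivative_transform_within_open[OF _ S x])
    show "((\<lambda>y. \<Sum>i\<in>UNIV. Z y $ i *\<^sub>R T y (axis i 1)) has_derivative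
      (\<lambda>v. \<Sum>i\<in>UNIV. Z x $ i *\<^sub>R ddir (\<lambda>y. T y (axis i 1)) x v + Z' v $ i *\<^sub>R T x (axis i 1))) (at x)"
      by (intro has_derivative_sum has_derivative_scaleR D that)
    show "(\<Sum>i\<in>UNIV. Z y $ i *\<^sub>R T y (axis i 1)) = T y (Z y)" if "y \<in> S" for y
      using linear_eq_sum_axis[OF lin[OF that]] by metis
  qed
  have "ddir (\<lambda>y. T y (X x)) x = (\<lambda>v. \<Sum>i\<in>UNIV. X x $ i *\<^sub>R ddir (\<lambda>y. T y (axis i 1)) x v + (0::real^4) $ i *\<^sub>R T x (axis i 1))"
    by (rule ddir_eqI[OF e]) simp
  moreover have "T x (X' v) = (\<Sum>i\<in>UNIV. X' v $ i *\<^sub>R T x (axis i 1))" for v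
    by (rule linear_eq_sum_axis[OF lin[OF x]])
  ultimately show ?thesis
    using e[OF Xi] by (simp add: sum.distrib)
qed

lemma ddir_linear_field:
  fixes T :: "real^4 \<Rightarrow> real^4 \<Rightarrow> 'b::real_normed_vector"
  assumes "open S" "x \<in> S" "\<And>y. y \<in> S \<Longrightarrow> linear (T y)"
    and "\<And>v. smooth_on S (\<lambda>y. T y v)" "smooth_on S X"
  shows "ddir (\<lambda>y. T y (X y)) x v = ddir (\<lambda>y. T y (X x)) x v + T x (ddir X x v)"
  by (subst ddir_eqI[OF has_derivative_linear_field[OF assms(1,2) _ _ smooth_on_has_derivative[OF assms(5,2)]]])
    (use assms in auto)

lemma linear_ddir_field:
  fixes T :: "real^4 \<Rightarrow> real^4 \<Rightarrow> 'b::real_normed_vector"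
  assumes S: "open S" and x: "x \<in> S" and lin: "\<And>y. y \<in> S \<Longrightarrow> linear (T y)"
    and sm: "\<And>v. smooth_on S (\<lambda>y. T y v)"
  shows "linear (\<lambda>w. ddir (\<lambda>y. T y w) x v)"
proof -
  note D = smooth_on_has_derivative[OF sm x]
  show ?thesis
  proof (rule linearI)
    fix a b
    have "((\<lambda>y. T y (a + b)) has_derivative (\<lambda>v. ddir (\<lambda>y. T y a) x v + ddir (\<lambda>y. T y b) x v)) (at x)"
      by (rule has_derivative_transform_within_open[OF has_derivative_add[OF D[of a] D[of b]] S x])
        (simp add: linear_add[OF lin])
    then show "ddir (\<lambda>y. T y (a + b)) x v = ddir (\<lambda>y. T y a) x v + ddir (\<lambda>y. T y b) x v"
      by (simp add: ddir_eqI)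
  next
    fix r b
    have "((\<lambda>y. T y (r *\<^sub>R b)) has_derivative (\<lambda>v. r *\<^sub>R ddir (\<lambda>y. T y b) x v)) (at x)"
      by (rule has_derivative_transform_within_open[OF has_derivative_scaleR_right[OF D[of b]] S x])
        (simp add: linear_scale[OF lin])
    then show "ddir (\<lambda>y. T y (r *\<^sub>R b)) x v = r *\<^sub>R ddir (\<lambda>y. T y b) x v"
      by (simp add: ddir_eqI)
  qed
qed

lemma bilinear_left: "bilinear b \<Longrightarrow> linear (\<lambda>v. b v w)"
  by (simp add: bilinear_def)

lemma bilinear_right: "bilinear b \<Longrightarrow> linear (b v)"
  by (simp add: bilinear_def)

text \<open>
  The map \<open>y \<mapsto> b y\<close> is injective because \<open>b\<close> is positive definite, hence onto. This makes the definite
  descriptions of gradients and Christoffel symbols meaningful.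
\<close>

lemma positive_definite_representation:
  fixes b :: "real^'n \<Rightarrow> real^'n \<Rightarrow> real"
  assumes b: "bilinear b" and pos: "\<And>v. v \<noteq> 0 \<Longrightarrow> b v v > 0" and l: "linear l"
  shows "\<exists>!y. \<forall>w. b y w = l w"
proof (rule ex_ex1I)
  define T where "T = (\<lambda>y. (\<chi> i. b y (axis i 1)) :: real^'n)"
  have T: "linear T"
    by (rule linearI)
      (simp_all add: T_def vec_eq_iff bilinear_ladd[OF b] bilinear_lmul[OF b])
  have e: "b y w = (\<Sum>i\<in>UNIV. (w $ i) *\<^sub>R T y $ i)" for y w
    using linear_eq_sum_axis[OF bilinear_right[OF b, of y], of w] unfolding T_def by simp
  have "inj T"
    unfolding linear_injective_0[OF T]
  proof safe
    fix y assume "T y = 0"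
    then have "b y y = 0" using e[of y y] by simp
    then show "y = 0" using pos[of y] by auto
  qed
  then have "surj T" by (rule linear_inj_imp_surj[OF T])
  then obtain y where "T y = (\<chi> i. l (axis i 1))" by (metis surjD)
  then have "b y w = l w" for w
    using e[of y w] linear_eq_sum_axis[OF l, of w] by simp
  then show "\<exists>y. \<forall>w. b y w = l w" by blast
next
  fix y y' assume "\<forall>w. b y w = l w" "\<forall>w. b y' w = l w"
  then have "b (y - y') (y - y') = 0" by (simp add: bilinear_lsub[OF b])
  then show "y = y'" using pos[of "y - y'"] by auto
qed

section \<open>The Levi-Civita connection in a chart\<close>

locale riemannian_chart =
  fixes g :: "'a bform" and c :: "'a chart" and S :: "(real^4) set"
  assumes open_S: "open S"
    and g_bilinear: "x \<in> S \<Longrightarrow> bilinear (g c x)"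
    and g_smooth: "smooth_on S (\<lambda>x. g c x v w)"
    and g_sym: "x \<in> S \<Longrightarrow> g c x v w = g c x w v"
    and g_pos: "x \<in> S \<Longrightarrow> v \<noteq> 0 \<Longrightarrow> g c x v v > 0"
begin

lemmas g_linear = bilinear_left[OF g_bilinear] bilinear_right[OF g_bilinear]

lemmas g_simps = bilinear_ladd[OF g_bilinear] bilinear_radd[OF g_bilinear]
  bilinear_lsub[OF g_bilinear] bilinear_rsub[OF g_bilinear]
  bilinear_lmul[OF g_bilinear] bilinear_rmul[OF g_bilinear]
  bilinear_lneg[OF g_bilinear] bilinear_rneg[OF g_bilinear]
  bilinear_lzero[OF g_bilinear] bilinear_rzero[OF g_bilinear]

lemma g_cancel:
  assumes "x \<in> S" "\<And>w. g c x y w = g c x y' w"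
  shows "y = y'"
proof -
  have "g c x (y - y') (y - y') = 0" using assms by (simp add: g_simps)
  then show ?thesis using g_pos[OF assms(1), of "y - y'"] by auto
qed

abbreviation Dg :: "real^4 \<Rightarrow> real^4 \<Rightarrow> real^4 \<Rightarrow> real^4 \<Rightarrow> real" where
  "Dg x u v w \<equiv> ddir (\<lambda>x. g c x v w) x u"

lemma Dg_sym: "x \<in> S \<Longrightarrow> Dg x u v w = Dg x u w v"
  using ddir_cong[OF open_S, of x "\<lambda>x. g c x v w" "\<lambda>x. g c x w v"] g_sym by simp

lemma linear_Dg:
  assumes "x \<in> S"
  shows "linear (\<lambda>u. Dg x u v w)" "linear (\<lambda>v. Dg x u v w)" "linear (\<lambda>w. Dg x u v w)"
  using linear_ddir[OF g_smooth assms] linear_ddir_field[OF open_S assms g_linear(1) g_smooth]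
    linear_ddir_field[OF open_S assms g_linear(2) g_smooth] by simp_all

lemma christoffel:
  assumes x: "x \<in> S"
  shows "2 * g c x (christoffel g c x u v) w = Dg x u v w + Dg x v u w - Dg x w u v"
proof -
  have "linear (\<lambda>w. (Dg x u v w + Dg x v u w - Dg x w u v) / 2)"
    by (rule linearI) (simp_all add: linear_add[OF linear_Dg(3)[OF x]] linear_add[OF linear_Dg(1)[OF x]]
        linear_scale[OF linear_Dg(3)[OF x]] linear_scale[OF linear_Dg(1)[OF x]] field_simps)
  from positive_definite_representation[OF g_bilinear[OF x] g_pos[OF x] this]
  have "\<exists>!y. \<forall>w. 2 * g c x y w = Dg x u v w + Dg x v u w - Dg x w u v"
    by (simp add: field_simps)
  from theI'[OF this] show ?thesis unfolding christoffel_def by blast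
qed

lemma christoffel_sym: "x \<in> S \<Longrightarrow> christoffel g c x u v = christoffel g c x v u"
proof (rule g_cancel)
  fix w assume x: "x \<in> S"
  show "g c x (christoffel g c x u v) w = g c x (christoffel g c x v u) w"
    using christoffel[OF x, of u v w] christoffel[OF x, of v u w] Dg_sym[OF x, of u v w] by linarith
qed

lemma christoffel_metric:
  assumes "x \<in> S"
  shows "Dg x u v w = g c x (christoffel g c x u v) w + g c x v (christoffel g c x u w)"
  using christoffel[OF assms, of u v w] christoffel[OF assms, of u w v] Dg_sym[OF assms]
    g_sym[OF assms, of v "christoffel g c x u w"] by (simp add: algebra_simps)

lemma ddir_g:
  assumes x: "x \<in> S" and X: "smooth_on S X" and Y: "smooth_on S Y"
  shows "ddir (\<lambda>y. g c y (X y) (Y y)) x u =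
    Dg x u (X x) (Y x) + g c x (ddir X x u) (Y x) + g c x (X x) (ddir Y x u)"
proof -
  have sX: "smooth_on S (\<lambda>y. g c y (X y) v)" for v
    by (rule smooth_on_linear_field[OF open_S g_linear(1) g_smooth X])
  have 1: "ddir (\<lambda>y. g c y (X y) (Y y)) x u = ddir (\<lambda>y. g c y (X y) (Y x)) x u + g c x (X x) (ddir Y x u)"
    by (rule ddir_linear_field[OF open_S x g_linear(2) sX Y])
  show ?thesis
    unfolding 1 using ddir_linear_field[OF open_S x g_linear(1) g_smooth X, of "Y x" u] by simp
qed

lemma grad_eqI:
  assumes "x \<in> S" "\<And>v. g c x y v = differential c f x v"
  shows "grad g c f x = y"
  unfolding grad_def
proof (rule the_equality)
  show "\<forall>v. g c x y v = differential c f x v" using assms(2) by blast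
  show "y' = y" if "\<forall>v. g c x y' v = differential c f x v" for y'
    by (rule g_cancel[OF assms(1)]) (simp add: that assms(2))
qed

lemma grad:
  assumes x: "x \<in> S" and f: "smooth_on S (f \<circ> chart_inv c)"
  shows "g c x (grad g c f x) v = differential c f x v"
proof -
  have "linear (differential c f x)"
    using linear_ddir[OF f x] by (simp add: differential_def[abs_def])
  from theI'[OF positive_definite_representation[OF g_bilinear[OF x] g_pos[OF x] this]]
  show ?thesis unfolding grad_def by blast
qed

end

locale almost_hermitian_chart = riemannian_chart +
  fixes J :: "'a endo"
  assumes J_linear: "x \<in> S \<Longrightarrow> linear (J c x)"
    and J_smooth: "smooth_on S (\<lambda>x. J c x v)"
    and J_J: "x \<in> S \<Longrightarrow> J c x (J c x v) = - v"
    and J_orthogonal: "x \<in> S \<Longrightarrow> g c x (J c x v) (J c x w) = g c x v w"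
begin

lemmas J_simps = linear_add[OF J_linear] linear_diff[OF J_linear] linear_scale[OF J_linear]
  linear_neg[OF J_linear] linear_0[OF J_linear] J_J

abbreviation DJ :: "real^4 \<Rightarrow> real^4 \<Rightarrow> real^4 \<Rightarrow> real^4" where
  "DJ x u v \<equiv> ddir (\<lambda>x. J c x v) x u"

lemma J_skew: "x \<in> S \<Longrightarrow> g c x (J c x v) w = - g c x v (J c x w)"
  using J_orthogonal[of x v "J c x w"] by (simp add: J_simps g_simps)

lemma g_J_self [simp]: "x \<in> S \<Longrightarrow> g c x v (J c x v) = 0"
  using J_skew[of x v v] g_sym[of x v "J c x v"] by simp

lemma smooth_J: "smooth_on S X \<Longrightarrow> smooth_on S (\<lambda>y. J c y (X y))"
  by (rule smooth_on_linear_field[OF open_S J_linear J_smooth])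

lemma ddir_J: "x \<in> S \<Longrightarrow> smooth_on S X \<Longrightarrow> ddir (\<lambda>y. J c y (X y)) x u = DJ x u (X x) + J c x (ddir X x u)"
  by (rule ddir_linear_field[OF open_S _ J_linear J_smooth])

lemma linear_DJ:
  assumes "x \<in> S"
  shows "linear (\<lambda>u. DJ x u v)" "linear (DJ x u)"
  using linear_ddir[OF J_smooth assms] linear_ddir_field[OF open_S assms J_linear J_smooth] by simp_all

lemma DJ_J:
  assumes x: "x \<in> S"
  shows "DJ x u (J c x v) = - J c x (DJ x u v)"
proof -
  have "ddir (\<lambda>y. J c y (J c y v)) x u = ddir (\<lambda>y. - v) x u"
    using ddir_cong[OF open_S x, of "\<lambda>y. J c y (J c y v)" "\<lambda>y. - v"] J_J by simp
  then show ?thesis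
    using ddir_J[OF x J_smooth, of v u] by (simp add: eq_neg_iff_add_eq_0)
qed

text \<open>
  For constant (hence commuting) vector fields \<open>u\<close>, \<open>v\<close>, \<open>w\<close> the Koszul formula gives
  \<open>2 g((\<nabla>\<^sub>u J) v, w) = d\<omega>(u, v, w) - d\<omega>(u, J v, J w) + g(u, N(v, J w))\<close>, where \<open>\<omega> = g(J \<cdot>, \<cdot>)\<close> and
  \<open>N(u, v) = [J u, J v] - J [J u, v] - J [u, J v] - [u, v]\<close> is the Nijenhuis tensor of \<open>J\<close>.
\<close>

lemma nabla_endo_eq_0:
  assumes x: "x \<in> S"
    and domega: "\<And>u v w. ddir (\<lambda>y. g c y (J c y v) w) x u + ddir (\<lambda>y. g c y (J c y w) u) x v +
        ddir (\<lambda>y. g c y (J c y u) v) x w = 0"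
    and nijenhuis: "\<And>u v. DJ x (J c x u) v - DJ x (J c x v) u - J c x (DJ x u v) + J c x (DJ x v u) = 0"
  shows "nabla_endo g J c x u v = 0"
proof -
  let ?J = "J c x" and ?b = "g c x"
  define \<Omega> where "\<Omega> = (\<lambda>u v w. ddir (\<lambda>y. g c y (J c y v) w) x u)"
  have \<Omega>: "\<Omega> u v w = Dg x u (?J v) w + ?b (DJ x u v) w" for u v w
    unfolding \<Omega>_def using ddir_g[OF x J_smooth smooth_on_const[OF open_S]] by (simp add: g_simps x)
  have \<Omega>_skew: "\<Omega> u v w = - \<Omega> u w v" for u v w
  proof -
    have sk: "g c y (J c y v) w = - g c y (J c y w) v" if "y \<in> S" for y
      using J_skew[OF that] g_sym[OF that] by metis
    have "((\<lambda>y. - g c y (J c y w) v) has_derivative (\<lambda>u. - \<Omega> u w v)) (at x)"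
      unfolding \<Omega>_def
      by (intro has_derivative_minus smooth_on_has_derivative[OF smooth_on_linear_field[OF open_S g_linear(1) g_smooth J_smooth] x])
    then have "ddir (\<lambda>y. - g c y (J c y w) v) x u = - \<Omega> u w v"
      by (simp add: ddir_eqI)
    then show ?thesis
      unfolding \<Omega>_def using ddir_cong[OF open_S x sk] by simp
  qed
  note lin = g_simps[OF x] J_simps[OF x]
    linear_neg[OF linear_Dg(1)[OF x]] linear_neg[OF linear_Dg(2)[OF x]] linear_neg[OF linear_Dg(3)[OF x]]
    linear_neg[OF linear_DJ(1)[OF x]] linear_neg[OF linear_DJ(2)[OF x]]
  show ?thesis
  proof (rule g_cancel[OF x])
    fix w
    \<comment> \<open>\<open>d\<omega>(u, v, w)\<close> and \<open>d\<omega>(u, J v, J w)\<close> in terms of the derivatives of \<open>g\<close> and \<open>J\<close>\<close>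
    have 1: "Dg x u (?J v) w + ?b (DJ x u v) w + (Dg x v (?J w) u + ?b (DJ x v w) u)
        - (Dg x w (?J v) u + ?b (DJ x w v) u) = 0"
      using domega[of v w u] \<Omega>_skew[of w u v] \<Omega>[of u v w] \<Omega>[of v w u] \<Omega>[of w v u]
      unfolding \<Omega>_def by linarith
    have "\<Omega> u (?J v) (?J w) = - Dg x u v (?J w) - ?b (DJ x u v) w"
      using \<Omega>[of u "?J v" "?J w"] J_orthogonal[OF x] by (simp add: lin DJ_J[OF x])
    moreover have "\<Omega> (?J v) (?J w) u = - Dg x (?J v) w u + ?b (DJ x (?J v) (?J w)) u"
      using \<Omega>[of "?J v" "?J w" u] by (simp add: lin)
    moreover have "\<Omega> (?J w) u (?J v) = Dg x (?J w) v u - ?b (DJ x (?J w) (?J v)) u"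
      using \<Omega>_skew[of "?J w" u "?J v"] \<Omega>[of "?J w" "?J v" u] by (simp add: lin)
    ultimately have 2: "- Dg x u v (?J w) - ?b (DJ x u v) w - Dg x (?J v) w u + ?b (DJ x (?J v) (?J w)) u
        + Dg x (?J w) v u - ?b (DJ x (?J w) (?J v)) u = 0"
      using domega[of "?J v" "?J w" u] unfolding \<Omega>_def by linarith
    have "DJ x (?J v) (?J w) + DJ x w v - DJ x v w - DJ x (?J w) (?J v) = 0"
      using nijenhuis[of v "?J w"] DJ_J[OF x, of w v] DJ_J[OF x, of v "?J w"] by (simp add: lin algebra_simps)
    then have "?b (DJ x (?J v) (?J w) + DJ x w v - DJ x v w - DJ x (?J w) (?J v)) u = 0"
      by (simp add: lin)
    then have 3: "?b (DJ x (?J v) (?J w)) u + ?b (DJ x w v) u - ?b (DJ x v w) u - ?b (DJ x (?J w) (?J v)) u = 0"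
      by (simp only: g_simps[OF x])
    have "?b (nabla_endo g J c x u v) w =
        ?b (DJ x u v) w + ?b (christoffel g c x u (?J v)) w + ?b (christoffel g c x u v) (?J w)"
      using J_skew[OF x, of "christoffel g c x u v" w] by (simp add: nabla_endo_def g_simps[OF x])
    moreover note christoffel[OF x, of u "?J v" w] christoffel[OF x, of u v "?J w"]
      Dg_sym[OF x, of u "?J v" w] Dg_sym[OF x, of w u "?J v"] Dg_sym[OF x, of "?J w" u v]
      Dg_sym[OF x, of u v "?J w"]
    ultimately have "?b (nabla_endo g J c x u v) w = 0"
      using 1 2 3 by linarith
    then show "?b (nabla_endo g J c x u v) w = ?b 0 w" by (simp add: g_simps[OF x])
  qed
qed

end

section \<open>Coordinate functions and the pointwise formulas\<close>

lemma vector_4 [simp]: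
  fixes a b c d :: "'a::zero"
  shows "(vector [a, b, c, d] :: 'a^4) $ 1 = a" "(vector [a, b, c, d] :: 'a^4) $ 2 = b"
    "(vector [a, b, c, d] :: 'a^4) $ 3 = c" "(vector [a, b, c, d] :: 'a^4) $ 4 = d"
  by (simp_all add: vector_def)

lemma smooth_on_vector_4:
  assumes "open S" "smooth_on S a" "smooth_on S b" "smooth_on S c" "smooth_on S d"
  shows "smooth_on S (\<lambda>x. vector [a x, b x, c x, d x] :: real^4)"
proof (rule smooth_on_vec[OF assms(1)])
  show "smooth_on S (\<lambda>x. (vector [a x, b x, c x, d x] :: real^4) $ i)" for i
    using exhaust_4[of i] assms by auto
qed

lemma has_derivative_vector_4:
  assumes "(a has_derivative a') F" "(b has_derivative b') F" "(c has_derivative c') F" "(d has_derivative d') F"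
  shows "((\<lambda>x. vector [a x, b x, c x, d x] :: real^4) has_derivative (\<lambda>v. vector [a' v, b' v, c' v, d' v])) F"
proof -
  have e: "vector [a, b, c, d] = a *\<^sub>R axis 1 1 + b *\<^sub>R axis 2 1 + c *\<^sub>R axis 3 1 + d *\<^sub>R (axis 4 1 :: real^4)"
    for a b c d :: real
    by (simp add: vec_eq_iff forall_4 axis_def)
  show ?thesis
    unfolding e by (intro has_derivative_add has_derivative_scaleR_left assms)
qed

lemma det_4:
  fixes A :: "real^4^4"
  shows "det A =
    A$1$1 * (A$2$2 * (A$3$3 * A$4$4 - A$3$4 * A$4$3) - A$2$3 * (A$3$2 * A$4$4 - A$3$4 * A$4$2) + A$2$4 * (A$3$2 * A$4$3 - A$3$3 * A$4$2))
  - A$1$2 * (A$2$1 * (A$3$3 * A$4$4 - A$3$4 * A$4$3) - A$2$3 * (A$3$1 * A$4$4 - A$3$4 * A$4$1) + A$2$4 * (A$3$1 * A$4$3 - A$3$3 * A$4$1))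
  + A$1$3 * (A$2$1 * (A$3$2 * A$4$4 - A$3$4 * A$4$2) - A$2$2 * (A$3$1 * A$4$4 - A$3$4 * A$4$1) + A$2$4 * (A$3$1 * A$4$2 - A$3$2 * A$4$1))
  - A$1$4 * (A$2$1 * (A$3$2 * A$4$3 - A$3$3 * A$4$2) - A$2$2 * (A$3$1 * A$4$3 - A$3$3 * A$4$1) + A$2$3 * (A$3$1 * A$4$2 - A$3$2 * A$4$1))"
proof -
  have f: "finite {2::4, 3, 4}" "1 \<notin> {2::4, 3, 4}" "finite {3::4, 4}" "2 \<notin> {3::4, 4}" "finite {4::4}" "3 \<notin> {4::4}"
    by auto
  show ?thesis
    unfolding det_def UNIV_4
    unfolding sum_over_permutations_insert[OF f(1,2)] sum_over_permutations_insert[OF f(3,4)] sum_over_permutations_insert[OF f(5,6)]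
    unfolding permutes_sing
    by (simp add: sign_swap_id permutation_swap_id permutation_compose sign_compose sign_id swap_id_eq algebra_simps)
qed

text \<open>
  The explicit formulas at one point: \<open>b\<close>, \<open>j\<close>, \<open>om\<close> are the metric, the complex structure and the
  Kaehler form on the tangent space, and \<open>dX\<close>, \<open>dY\<close>, \<open>dt\<close>, \<open>dz\<close> are the coordinate differentials.
\<close>

definition ortho_toric_at ::
  "(real^4 \<Rightarrow> real^4 \<Rightarrow> real) \<Rightarrow> (real^4 \<Rightarrow> real^4) \<Rightarrow> (real^4 \<Rightarrow> real^4 \<Rightarrow> real) \<Rightarrow>
   real \<Rightarrow> real \<Rightarrow> real \<Rightarrow> real \<Rightarrow>
   (real^4 \<Rightarrow> real) \<Rightarrow> (real^4 \<Rightarrow> real) \<Rightarrow> (real^4 \<Rightarrow> real) \<Rightarrow> (real^4 \<Rightarrow> real) \<Rightarrow> bool" where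
  "ortho_toric_at b j om X Y P Q dX dY dt dz \<longleftrightarrow>
     (\<forall>v w. b v w = (X - Y) * (dX v * dX w / P - dY v * dY w / Q) +
        1 / (X - Y) * (P * ((dt v + Y * dz v) * (dt w + Y * dz w)) - Q * ((dt v + X * dz v) * (dt w + X * dz w)))) \<and>
     (\<forall>v. - dX (j v) = P / (X - Y) * (dt v + Y * dz v)) \<and>
     (\<forall>v. - dt (j v) = - (X * dX v / P) - Y * dY v / Q) \<and>
     (\<forall>v. - dY (j v) = Q / (Y - X) * (dt v + X * dz v)) \<and>
     (\<forall>v. - dz (j v) = dX v / P + dY v / Q) \<and>
     (\<forall>v w. om v w = (dX v * (dt w + Y * dz w) - dX w * (dt v + Y * dz v)) +
        (dY v * (dt w + X * dz w) - dY w * (dt v + X * dz v)))"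

lemma ortho_toric_form_iff:
  "ortho_toric_form M A g J \<omega> W \<xi> \<eta> t z F G \<longleftrightarrow>
     smooth_chart M A (W, \<lambda>p. vector [\<xi> p, \<eta> p, t p, z p]) \<and>
     smooth_on (\<xi> ` W) F \<and> smooth_on (\<eta> ` W) G \<and>
     (\<forall>p\<in>W. \<xi> p \<noteq> \<eta> p \<and> F (\<xi> p) \<noteq> 0 \<and> G (\<eta> p) \<noteq> 0) \<and>
     (\<forall>c\<in>A. \<forall>p\<in>fst c \<inter> W.
        ortho_toric_at (g c (snd c p)) (J c (snd c p)) (\<omega> c (snd c p)) (\<xi> p) (\<eta> p) (F (\<xi> p)) (G (\<eta> p))
          (differential c \<xi> (snd c p)) (differential c \<eta> (snd c p))
          (differential c t (snd c p)) (differential c z (snd c p)))"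
  unfolding ortho_toric_form_def ortho_toric_at_def Let_def J_form_def wedge_def by (rule refl)

text \<open>
  Both terms are symmetric in \<open>u\<close> and \<open>v\<close>, so that \<open>m dX\<close> is closed.
\<close>

lemma ddir_mult_differential:
  fixes m X :: "real^4 \<Rightarrow> real"
  assumes S: "open S" "x \<in> S" and X: "smooth_on S X" and m: "(m has_derivative (\<lambda>u. k * ddir X x u)) (at x)"
  shows "((\<lambda>y. m y * ddir X y v) has_derivative (\<lambda>u. m x * hess X x u v + k * ddir X x u * ddir X x v)) (at x)"
  by (rule has_derivative_mult[OF m smooth_on_has_derivative[OF smooth_on_ddir[OF X] S(2)]])

text \<open>
  Differentiating \<open>\<alpha>(J v) = - \<beta>(v)\<close> and \<open>\<beta>(J v) = \<alpha>(v)\<close> expresses the values of \<open>\<alpha>\<close> and \<open>\<beta>\<close> on the Nijenhuis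
  tensor by the derivatives of \<open>\<alpha>\<close> and \<open>\<beta>\<close>, which cancel as these are symmetric.
\<close>

lemma (in almost_hermitian_chart) closed_pair_nijenhuis:
  fixes \<alpha> \<beta> :: "real^4 \<Rightarrow> real^4 \<Rightarrow> real"
  assumes x: "x \<in> S"
    and \<alpha>: "\<And>y. y \<in> S \<Longrightarrow> linear (\<alpha> y)" "\<And>v. smooth_on S (\<lambda>y. \<alpha> y v)"
    and \<beta>: "\<And>y. y \<in> S \<Longrightarrow> linear (\<beta> y)" "\<And>v. smooth_on S (\<lambda>y. \<beta> y v)"
    and J\<alpha>: "\<And>y v. y \<in> S \<Longrightarrow> - \<alpha> y (J c y v) = \<beta> y v"
    and closed: "\<And>u v. ddir (\<lambda>y. \<alpha> y v) x u = ddir (\<lambda>y. \<alpha> y u) x v"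
      "\<And>u v. ddir (\<lambda>y. \<beta> y v) x u = ddir (\<lambda>y. \<beta> y u) x v"
  shows "\<alpha> x (DJ x (J c x u) v - DJ x (J c x v) u - J c x (DJ x u v) + J c x (DJ x v u)) = 0"
    "\<beta> x (DJ x (J c x u) v - DJ x (J c x v) u - J c x (DJ x u v) + J c x (DJ x v u)) = 0"
proof -
  note l = linear_add[OF \<alpha>(1)[OF x]] linear_diff[OF \<alpha>(1)[OF x]] linear_add[OF \<beta>(1)[OF x]] linear_diff[OF \<beta>(1)[OF x]]
    linear_neg[OF \<alpha>(1)[OF x]]
  have J\<beta>: "\<beta> y (J c y v) = \<alpha> y v" if "y \<in> S" for y v
    using J\<alpha>[OF that, of "J c y v"] linear_neg[OF \<alpha>(1)[OF that]] by (simp add: J_J that)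
  have a: "ddir (\<lambda>y. \<alpha> y (J c x v)) x u + \<alpha> x (DJ x u v) = - ddir (\<lambda>y. \<beta> y v) x u" for u v
  proof -
    have "((\<lambda>y. - \<beta> y v) has_derivative (\<lambda>u. - ddir (\<lambda>y. \<beta> y v) x u)) (at x)"
      by (intro has_derivative_minus smooth_on_has_derivative[OF \<beta>(2) x])
    moreover have "ddir (\<lambda>y. \<alpha> y (J c y v)) x = ddir (\<lambda>y. - \<beta> y v) x"
      by (rule ddir_cong[OF open_S x]) (simp add: J\<alpha>[symmetric])
    ultimately show ?thesis
      using ddir_linear_field[OF open_S x \<alpha> J_smooth, of v u] by (simp add: ddir_eqI)
  qed
  have b: "ddir (\<lambda>y. \<beta> y (J c x v)) x u + \<beta> x (DJ x u v) = ddir (\<lambda>y. \<alpha> y v) x u" for u v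
  proof -
    have "ddir (\<lambda>y. \<beta> y (J c y v)) x = ddir (\<lambda>y. \<alpha> y v) x"
      by (rule ddir_cong[OF open_S x]) (simp add: J\<beta>)
    then show ?thesis
      using ddir_linear_field[OF open_S x \<beta> J_smooth, of v u] by simp
  qed
  have J\<alpha>': "\<alpha> x (J c x v) = - \<beta> x v" for v using J\<alpha>[OF x, of v] by linarith
  show "\<alpha> x (DJ x (J c x u) v - DJ x (J c x v) u - J c x (DJ x u v) + J c x (DJ x v u)) = 0"
    unfolding l J\<alpha>'
    using a[of v "J c x u"] a[of u "J c x v"] b[of v u] b[of u v] closed(1)[of "J c x v" "J c x u"]
      closed(1)[of v u] closed(2)[of v "J c x u"] closed(2)[of u "J c x v"]
    by linarith
  show "\<beta> x (DJ x (J c x u) v - DJ x (J c x v) u - J c x (DJ x u v) + J c x (DJ x v u)) = 0"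
    unfolding l J\<beta>[OF x]
    using b[of v "J c x u"] b[of u "J c x v"] a[of v u] a[of u v] closed(2)[of "J c x v" "J c x u"]
      closed(2)[of v u] closed(1)[of v "J c x u"] closed(1)[of u "J c x v"]
    by linarith
qed

section \<open>The explicit form in a chart\<close>

text \<open>
  \<open>P\<close> and \<open>Q\<close> are \<open>F(\<xi>)\<close> and \<open>G(\<eta>)\<close> in the chart; all that is used of this is that their
  differentials are multiples of \<open>d\<xi>\<close> and \<open>d\<eta>\<close>.
\<close>

locale ortho_toric_chart =
  fixes g :: "'a bform" and c :: "'a chart" and S :: "(real^4) set" and J :: "'a endo" and \<omega> :: "'a bform"
    and X Y t z P Q :: "real^4 \<Rightarrow> real"
  assumes open_S': "open S"
    and sX: "smooth_on S X" and sY: "smooth_on S Y" and st: "smooth_on S t" and sz: "smooth_on S z"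
    and sP: "smooth_on S P" and sQ: "smooth_on S Q"
    and dP: "x \<in> S \<Longrightarrow> \<exists>p. ddir P x = (\<lambda>v. p * ddir X x v)" and dQ: "x \<in> S \<Longrightarrow> \<exists>q. ddir Q x = (\<lambda>v. q * ddir Y x v)"
    and XY: "x \<in> S \<Longrightarrow> X x \<noteq> Y x" and P0: "x \<in> S \<Longrightarrow> P x \<noteq> 0" and Q0: "x \<in> S \<Longrightarrow> Q x \<noteq> 0"
    and separating: "x \<in> S \<Longrightarrow> ddir X x v = 0 \<Longrightarrow> ddir Y x v = 0 \<Longrightarrow> ddir t x v = 0 \<Longrightarrow> ddir z x v = 0 \<Longrightarrow> v = 0"
    and form: "x \<in> S \<Longrightarrow> ortho_toric_at (g c x) (J c x) (\<omega> c x) (X x) (Y x) (P x) (Q x)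
      (ddir X x) (ddir Y x) (ddir t x) (ddir z x)"
    and pos: "x \<in> S \<Longrightarrow> v \<noteq> 0 \<Longrightarrow> g c x v v > 0"
begin

abbreviation dX where "dX \<equiv> ddir X"
abbreviation dY where "dY \<equiv> ddir Y"
abbreviation dt where "dt \<equiv> ddir t"
abbreviation dz where "dz \<equiv> ddir z"
abbreviation \<theta> where "\<theta> x v \<equiv> dt x v + Y x * dz x v"
abbreviation \<phi> where "\<phi> x v \<equiv> dt x v + X x * dz x v"

lemmas lin = linear_ddir[OF sX] linear_ddir[OF sY] linear_ddir[OF st] linear_ddir[OF sz]

lemmas lin_simps = lin[THEN linear_add] lin[THEN linear_diff] lin[THEN linear_scale] lin[THEN linear_neg] lin[THEN linear_0]

lemma form_g:
  "x \<in> S \<Longrightarrow> g c x v w = (X x - Y x) * (dX x v * dX x w / P x - dY x v * dY x w / Q x) +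
     1 / (X x - Y x) * (P x * (\<theta> x v * \<theta> x w) -
       Q x * (\<phi> x v * \<phi> x w))"
  using form unfolding ortho_toric_at_def by blast

lemma form_J:
  assumes "x \<in> S"
  shows "dX x (J c x v) = - (P x / (X x - Y x) * \<theta> x v)"
    "dY x (J c x v) = Q x / (X x - Y x) * \<phi> x v"
    "dt x (J c x v) = X x * dX x v / P x + Y x * dY x v / Q x"
    "dz x (J c x v) = - (dX x v / P x + dY x v / Q x)"
proof -
  have 1: "- dX x (J c x v) = P x / (X x - Y x) * \<theta> x v"
    "- dt x (J c x v) = - (X x * dX x v / P x) - Y x * dY x v / Q x"
    "- dY x (J c x v) = Q x / (Y x - X x) * \<phi> x v"
    "- dz x (J c x v) = dX x v / P x + dY x v / Q x"
    using form[OF assms] unfolding ortho_toric_at_def by blast+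
  have 2: "Q x / (Y x - X x) = - (Q x / (X x - Y x))"
    by (metis minus_diff_eq minus_divide_right)
  show "dX x (J c x v) = - (P x / (X x - Y x) * \<theta> x v)"
    "dt x (J c x v) = X x * dX x v / P x + Y x * dY x v / Q x"
    "dz x (J c x v) = - (dX x v / P x + dY x v / Q x)"
    using 1 by linarith+
  show "dY x (J c x v) = Q x / (X x - Y x) * \<phi> x v"
    using 1(3) unfolding 2 by simp
qed

lemma form_J_\<theta>:
  assumes "x \<in> S"
  shows "dt x (J c x v) + Y x * dz x (J c x v) = (X x - Y x) / P x * dX x v"
    "dt x (J c x v) + X x * dz x (J c x v) = - ((X x - Y x) / Q x * dY x v)"
  unfolding form_J[OF assms] using P0[OF assms] Q0[OF assms] by (simp_all add: field_simps)

lemma form_\<omega>: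
  "x \<in> S \<Longrightarrow> \<omega> c x v w = (dX x v * \<theta> x w - dX x w * \<theta> x v) +
     (dY x v * \<phi> x w - dY x w * \<phi> x v)"
  using form unfolding ortho_toric_at_def by blast

lemma vector_eqI:
  assumes "x \<in> S" "dX x v = dX x w" "dY x v = dY x w" "dt x v = dt x w" "dz x v = dz x w"
  shows "v = w"
  using separating[OF assms(1), of "v - w"] assms by (simp add: lin_simps)

text \<open>
  Constant linear combinations of the coordinate fields. They are smooth as the derivative of the
  coordinate map has a smooth inverse.
\<close>

lemma coordinate_field:
  "\<exists>E. smooth_on S E \<and> (\<forall>x\<in>S. dX x (E x) = a \<and> dY x (E x) = b \<and> dt x (E x) = k \<and> dz x (E x) = l)"
proof -
  have D: "((\<lambda>x. vector [X x, Y x, t x, z x] :: real^4) has_derivative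
      (\<lambda>v. vector [dX x v, dY x v, dt x v, dz x v])) (at x)" if "x \<in> S" for x
    by (intro has_derivative_vector_4 smooth_on_has_derivative[OF _ that] sX sY st sz)
  note D' = frechet_derivative_at[OF D, symmetric]
  obtain E where E: "smooth_on S E"
    "\<And>x w. x \<in> S \<Longrightarrow> frechet_derivative (\<lambda>x. vector [X x, Y x, t x, z x] :: real^4) (at x) w = vector [a, b, k, l] \<longleftrightarrow> w = E x"
  proof (rule smooth_inverse_derivative[where v = "vector [a, b, k, l]" and S = S and f = "\<lambda>x. vector [X x, Y x, t x, z x] :: real^4"])
    show "smooth_on S (\<lambda>x. vector [X x, Y x, t x, z x] :: real^4)"
      by (intro smooth_on_vector_4 open_S' sX sY st sz)
    show "w = 0" if "x \<in> S" "frechet_derivative (\<lambda>x. vector [X x, Y x, t x, z x] :: real^4) (at x) w = 0" for x w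
      using that separating[OF that(1), of w] by (simp add: D' vec_eq_iff forall_4)
  qed (use open_S' in blast)+
  show ?thesis
  proof (intro exI[of _ E] conjI ballI E(1))
    fix x assume x: "x \<in> S"
    show "dX x (E x) = a" "dY x (E x) = b" "dt x (E x) = k" "dz x (E x) = l"
      using E(2)[OF x, of "E x"] by (simp_all add: D'[OF x] vec_eq_iff forall_4)
  qed
qed

lemma J_smooth': "smooth_on S (\<lambda>x. J c x v)"
proof -
  obtain E1 where 1: "smooth_on S E1" "\<And>x. x \<in> S \<Longrightarrow> dX x (E1 x) = 1 \<and> dY x (E1 x) = 0 \<and> dt x (E1 x) = 0 \<and> dz x (E1 x) = 0"
    using coordinate_field[of 1 0 0 0] by blast
  obtain E2 where 2: "smooth_on S E2" "\<And>x. x \<in> S \<Longrightarrow> dX x (E2 x) = 0 \<and> dY x (E2 x) = 1 \<and> dt x (E2 x) = 0 \<and> dz x (E2 x) = 0"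
    using coordinate_field[of 0 1 0 0] by blast
  obtain E3 where 3: "smooth_on S E3" "\<And>x. x \<in> S \<Longrightarrow> dX x (E3 x) = 0 \<and> dY x (E3 x) = 0 \<and> dt x (E3 x) = 1 \<and> dz x (E3 x) = 0"
    using coordinate_field[of 0 0 1 0] by blast
  obtain E4 where 4: "smooth_on S E4" "\<And>x. x \<in> S \<Longrightarrow> dX x (E4 x) = 0 \<and> dY x (E4 x) = 0 \<and> dt x (E4 x) = 0 \<and> dz x (E4 x) = 1"
    using coordinate_field[of 0 0 0 1] by blast
  show ?thesis
  proof (rule smooth_on_cong[OF open_S'])
    let ?R = "\<lambda>x. (- (P x / (X x - Y x) * \<theta> x v)) *\<^sub>R E1 x +
      (Q x / (X x - Y x) * \<phi> x v) *\<^sub>R E2 x +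
      (X x * dX x v / P x + Y x * dY x v / Q x) *\<^sub>R E3 x +
      (- (dX x v / P x + dY x v / Q x)) *\<^sub>R E4 x"
    show "smooth_on S ?R"
      by (intro smooth_on_add smooth_on_scaleR smooth_on_mult smooth_on_minus smooth_on_divide smooth_on_diff
          smooth_on_ddir open_S' sX sY st sz sP sQ 1 2 3 4) (simp_all add: XY P0 Q0)
    fix x assume x: "x \<in> S"
    show "?R x = J c x v"
      by (rule vector_eqI[OF x]) (simp_all add: x lin_simps form_J 1 2 3 4)
  qed
qed

lemma g_smooth': "smooth_on S (\<lambda>x. g c x v w)"
proof (rule smooth_on_cong[OF open_S'])
  let ?R = "\<lambda>x. (X x - Y x) * (dX x v * dX x w / P x - dY x v * dY x w / Q x) +
     1 / (X x - Y x) * (P x * (\<theta> x v * \<theta> x w) -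
       Q x * (\<phi> x v * \<phi> x w))"
  show "smooth_on S ?R"
    by (intro smooth_on_add smooth_on_mult smooth_on_divide smooth_on_diff smooth_on_const
          smooth_on_ddir open_S' sX sY st sz sP sQ) (simp_all add: XY P0 Q0)
  show "?R x = g c x v w" if "x \<in> S" for x
    by (rule form_g[OF that, symmetric])
qed

sublocale almost_hermitian_chart g c S J
proof (intro almost_hermitian_chart.intro riemannian_chart.intro almost_hermitian_chart_axioms.intro)
  show "open S" by (rule open_S')
  show "smooth_on S (\<lambda>x. g c x v w)" for v w by (rule g_smooth')
  show "smooth_on S (\<lambda>x. J c x v)" for v by (rule J_smooth')
  fix x assume x: "x \<in> S"
  show "g c x v v > 0" if "v \<noteq> 0" for v by (rule pos[OF x that])
  show sym: "g c x v w = g c x w v" for v w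
    unfolding form_g[OF x] by (simp only: mult.commute)
  have "linear (\<lambda>v. g c x v w)" for w
    by (rule linearI) (simp_all add: form_g[OF x] lin_simps x algebra_simps add_divide_distrib diff_divide_distrib)
  then show "bilinear (g c x)"
    unfolding bilinear_def using sym by (metis (no_types, lifting) ext)
  show "linear (J c x)"
    by (rule linearI; rule vector_eqI[OF x])
      (simp_all add: form_J[OF x] lin_simps x algebra_simps add_divide_distrib)
  note nz = XY[OF x] P0[OF x] Q0[OF x]
  have D0: "X x - Y x \<noteq> 0" using XY[OF x] by simp
  show "J c x (J c x v) = - v" for v
  proof (rule vector_eqI[OF x])
    have a: "dX x (J c x v) / P x = - (\<theta> x v / (X x - Y x))"
      "dY x (J c x v) / Q x = \<phi> x v / (X x - Y x)"
      unfolding form_J[OF x] using nz by simp_all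
    show "dt x (J c x (J c x v)) = dt x (- v)"
      unfolding form_J(3)[OF x, of "J c x v"] times_divide_eq_right[symmetric] a
      using D0 by (simp add: lin_simps x divide_simps) (simp add: algebra_simps)
    show "dz x (J c x (J c x v)) = dz x (- v)"
      unfolding form_J(4)[OF x, of "J c x v"] a
      using D0 by (simp add: lin_simps x divide_simps) (simp add: algebra_simps)
    show "dX x (J c x (J c x v)) = dX x (- v)" "dY x (J c x (J c x v)) = dY x (- v)"
      unfolding form_J(1,2)[OF x, of "J c x v"] form_J_\<theta>[OF x] using nz D0 by (simp_all add: lin_simps x)
  qed
  show "g c x (J c x v) (J c x w) = g c x v w" for v w
    unfolding form_g[OF x] form_J_\<theta>[OF x] form_J(1,2)[OF x]
    using nz D0 by (simp add: divide_simps) (simp add: algebra_simps)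
qed

lemma \<omega>_eq: "x \<in> S \<Longrightarrow> \<omega> c x v w = g c x (J c x v) w"
  unfolding form_g form_J_\<theta> form_J(1,2) form_\<omega>
  using XY P0 Q0 by (simp add: divide_simps) (simp add: algebra_simps)

lemma hessian_sym:
  assumes "x \<in> S"
  shows "hess X x u v = hess X x v u"
    "hess Y x u v = hess Y x v u"
    "hess t x u v = hess t x v u"
    "hess z x u v = hess z x v u"
  using ddir_ddir_commute[OF open_S' _ assms] sX sY st sz by blast+

lemmas d1 = smooth_on_has_derivative[OF sX] smooth_on_has_derivative[OF sY]
  smooth_on_has_derivative[OF st] smooth_on_has_derivative[OF sz]
  smooth_on_has_derivative[OF sP] smooth_on_has_derivative[OF sQ]

lemmas d2 = smooth_on_has_derivative[OF smooth_on_ddir[OF sX]] smooth_on_has_derivative[OF smooth_on_ddir[OF sY]]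
  smooth_on_has_derivative[OF smooth_on_ddir[OF st]] smooth_on_has_derivative[OF smooth_on_ddir[OF sz]]

text \<open>
  The derivatives of \<open>dX\<close>, \<open>dY\<close>, \<open>dt\<close>, \<open>dz\<close> are symmetric and cancel. The terms which come from the
  coefficients are \<open>- dX \<and> dY \<and> dz\<close> and \<open>- dY \<and> dX \<and> dz\<close>, with sum zero.
\<close>

lemma domega:
  assumes x: "x \<in> S"
  shows "ddir (\<lambda>y. g c y (J c y v) w) x u + ddir (\<lambda>y. g c y (J c y w) u) x v +
    ddir (\<lambda>y. g c y (J c y u) v) x w = 0"
proof -
  have D: "ddir (\<lambda>y. g c y (J c y v) w) x u =
      hess X x u v * \<theta> x w
      + dX x v * (hess t x u w + (Y x * hess z x u w + dY x u * dz x w))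
      - (hess X x u w * \<theta> x v
      + dX x w * (hess t x u v + (Y x * hess z x u v + dY x u * dz x v)))
      + (hess Y x u v * \<phi> x w
      + dY x v * (hess t x u w + (X x * hess z x u w + dX x u * dz x w))
      - (hess Y x u w * \<phi> x v
      + dY x w * (hess t x u v + (X x * hess z x u v + dX x u * dz x v))))"
    (is "_ = ?R u v w") for u v w
  proof -
    have "((\<lambda>y. (dX y v * \<theta> y w - dX y w * \<theta> y v) +
      (dY y v * \<phi> y w - dY y w * \<phi> y v))
      has_derivative (\<lambda>u. ?R u v w)) (at x)"
      by (rule derivative_eq_intros d1[OF x] d2[OF x] refl)+ (simp add: fun_eq_iff algebra_simps)
    moreover have "ddir (\<lambda>y. g c y (J c y v) w) x = ddir (\<lambda>y. (dX y v * \<theta> y w - dX y w * \<theta> y v) +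
      (dY y v * \<phi> y w - dY y w * \<phi> y v)) x"
      by (rule ddir_cong[OF open_S' x]) (simp only: \<omega>_eq[symmetric] form_\<omega>)
    ultimately show ?thesis by (simp add: ddir_eqI)
  qed
  show ?thesis
    unfolding D hessian_sym[OF x, of v u] hessian_sym[OF x, of w u] hessian_sym[OF x, of w v]
    by (simp add: algebra_simps)
qed

text \<open>The forms \<open>J dz\<close> and \<open>J dt\<close>, which are closed as well.\<close>

definition \<sigma>z :: "real^4 \<Rightarrow> real^4 \<Rightarrow> real" where
  "\<sigma>z y v = 1 / P y * dX y v + 1 / Q y * dY y v"

definition \<sigma>t :: "real^4 \<Rightarrow> real^4 \<Rightarrow> real" where
  "\<sigma>t y v = - X y / P y * dX y v + - Y y / Q y * dY y v"

lemma J_dz: "x \<in> S \<Longrightarrow> - dz x (J c x v) = \<sigma>z x v"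
  by (simp add: form_J \<sigma>z_def)

lemma J_dt: "x \<in> S \<Longrightarrow> - dt x (J c x v) = \<sigma>t x v"
  by (simp add: form_J \<sigma>t_def)

lemma linear_\<sigma>: "x \<in> S \<Longrightarrow> linear (\<sigma>z x)" "x \<in> S \<Longrightarrow> linear (\<sigma>t x)"
  by (rule linearI; simp add: \<sigma>z_def \<sigma>t_def lin_simps algebra_simps add_divide_distrib)+

lemma smooth_\<sigma>: "smooth_on S (\<lambda>y. \<sigma>z y v)" "smooth_on S (\<lambda>y. \<sigma>t y v)"
  unfolding \<sigma>z_def \<sigma>t_def
  by (intro smooth_on_add smooth_on_mult smooth_on_minus smooth_on_divide smooth_on_const smooth_on_ddir
      open_S' sX sY sP sQ P0 Q0; assumption)+

lemma closed_\<sigma>: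
  assumes x: "x \<in> S"
  shows "ddir (\<lambda>y. \<sigma>z y v) x u = ddir (\<lambda>y. \<sigma>z y u) x v" "ddir (\<lambda>y. \<sigma>t y v) x u = ddir (\<lambda>y. \<sigma>t y u) x v"
proof -
  obtain p q where "ddir P x = (\<lambda>u. p * dX x u)" "ddir Q x = (\<lambda>u. q * dY x u)"
    using dP[OF x] dQ[OF x] by blast
  then have dP': "(P has_derivative (\<lambda>u. p * dX x u)) (at x)" "(Q has_derivative (\<lambda>u. q * dY x u)) (at x)"
    using d1(5,6)[OF x] by simp_all
  have m: "((\<lambda>y. 1 / P y) has_derivative (\<lambda>u. (- p / (P x * P x)) * dX x u)) (at x)"
    "((\<lambda>y. 1 / Q y) has_derivative (\<lambda>u. (- q / (Q x * Q x)) * dY x u)) (at x)"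
    "((\<lambda>y. - X y / P y) has_derivative (\<lambda>u. (- (P x - X x * p) / (P x * P x)) * dX x u)) (at x)"
    "((\<lambda>y. - Y y / Q y) has_derivative (\<lambda>u. (- (Q x - Y x * q) / (Q x * Q x)) * dY x u)) (at x)"
    using P0[OF x] Q0[OF x]
    by (auto intro!: derivative_eq_intros dP' d1(1,2)[OF x] simp: fun_eq_iff field_simps)
  note dm = ddir_mult_differential[OF open_S' x]
  show "ddir (\<lambda>y. \<sigma>z y v) x u = ddir (\<lambda>y. \<sigma>z y u) x v"
    unfolding \<sigma>z_def ddir_eqI[OF has_derivative_add[OF dm[OF sX m(1)] dm[OF sY m(2)]]] hessian_sym[OF x, of v u]
    by (simp add: ac_simps)
  show "ddir (\<lambda>y. \<sigma>t y v) x u = ddir (\<lambda>y. \<sigma>t y u) x v"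
    unfolding \<sigma>t_def ddir_eqI[OF has_derivative_add[OF dm[OF sX m(3)] dm[OF sY m(4)]]] hessian_sym[OF x, of v u]
    by (simp add: ac_simps)
qed

text \<open>
  In terms of \<open>dX\<close> and \<open>dY\<close> the two forms have the determinant \<open>(X - Y) / (P Q)\<close>.
\<close>

lemma \<sigma>_separating:
  assumes "x \<in> S" "\<sigma>z x v = 0" "\<sigma>t x v = 0"
  shows "dX x v = 0" "dY x v = 0"
proof -
  have "dX x v / P x + dY x v / Q x = 0" "X x * (dX x v / P x) + Y x * (dY x v / Q x) = 0"
    using assms by (simp_all add: \<sigma>z_def \<sigma>t_def)
  then have "(X x - Y x) * (dX x v / P x) = 0" "(X x - Y x) * (dY x v / Q x) = 0"
    by algebra+
  then show "dX x v = 0" "dY x v = 0"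
    using XY[OF assms(1)] P0[OF assms(1)] Q0[OF assms(1)] by simp_all
qed

text \<open>
  The closed forms \<open>dz\<close>, \<open>J dz\<close>, \<open>dt\<close>, \<open>J dt\<close> separate vectors.
\<close>

lemma nijenhuis:
  assumes x: "x \<in> S"
  shows "DJ x (J c x u) v - DJ x (J c x v) u - J c x (DJ x u v) + J c x (DJ x v u) = 0" (is "?N = 0")
proof -
  note Nz = closed_pair_nijenhuis[of x "ddir z" \<sigma>z,
      OF x lin(4) smooth_on_ddir[OF sz] linear_\<sigma>(1) smooth_\<sigma>(1) J_dz hessian_sym(4)[OF x] closed_\<sigma>(1)[OF x], of v u]
  note Nt = closed_pair_nijenhuis[of x "ddir t" \<sigma>t,
      OF x lin(3) smooth_on_ddir[OF st] linear_\<sigma>(2) smooth_\<sigma>(2) J_dt hessian_sym(3)[OF x] closed_\<sigma>(2)[OF x], of v u]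
  show ?thesis
    using separating[OF x \<sigma>_separating[OF x Nz(2) Nt(2)] Nt(1) Nz(1)] .
qed

lemma nabla_J: "x \<in> S \<Longrightarrow> nabla_endo g J c x u v = 0"
  using nabla_endo_eq_0[OF _ domega nijenhuis] by blast

text \<open>
  A field along which \<open>\<xi>\<close> and \<open>\<eta>\<close> are constant, and \<open>t\<close> and \<open>z\<close> have constant derivatives, preserves
  the coordinate differentials and the coefficients of \<open>g\<close>.
\<close>

lemma killing:
  assumes sE: "smooth_on S E"
    and E: "\<forall>x\<in>S. dX x (E x) = 0 \<and> dY x (E x) = 0 \<and> dt x (E x) = k \<and> dz x (E x) = l"
    and x: "x \<in> S"
  shows "Dg x (E x) v w + g c x (ddir E x v) w + g c x v (ddir E x w) = 0"
proof -
  have h: "ddir f x (ddir E x v) = - hess f x (E x) v"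
    if f: "smooth_on S f" "\<And>y. y \<in> S \<Longrightarrow> ddir f y (E y) = m" for f :: "real^4 \<Rightarrow> real" and v m
  proof -
    have "ddir (\<lambda>y. ddir f y (E y)) x v = ddir (\<lambda>y. m) x v"
      using ddir_cong[OF open_S' x, of "\<lambda>y. ddir f y (E y)" "\<lambda>y. m"] f(2) by simp
    moreover have "ddir (\<lambda>y. ddir f y (E y)) x v = ddir (\<lambda>y. ddir f y (E x)) x v + ddir f x (ddir E x v)"
      by (rule ddir_linear_field[OF open_S' x linear_ddir[OF f(1)] smooth_on_ddir[OF f(1)] sE])
    ultimately show ?thesis
      using ddir_ddir_commute[OF open_S' f(1) x, of v "E x"] by simp
  qed
  have hX: "dX x (ddir E x v) = - hess X x (E x) v" for v by (rule h[OF sX]) (use E in blast)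
  have hY: "dY x (ddir E x v) = - hess Y x (E x) v" for v by (rule h[OF sY]) (use E in blast)
  have ht: "dt x (ddir E x v) = - hess t x (E x) v" for v by (rule h[OF st]) (use E in blast)
  have hz: "dz x (ddir E x v) = - hess z x (E x) v" for v by (rule h[OF sz]) (use E in blast)
  define a1 a2 a3 a4 where a_def: "a1 = (\<lambda>y. (X y - Y y) / P y)" "a2 = (\<lambda>y. (X y - Y y) / Q y)"
    "a3 = (\<lambda>y. P y / (X y - Y y))" "a4 = (\<lambda>y. Q y / (X y - Y y))"
  have sa: "smooth_on S a1" "smooth_on S a2" "smooth_on S a3" "smooth_on S a4"
    unfolding a_def
    by (intro smooth_on_divide smooth_on_diff open_S' sX sY sP sQ; simp add: XY P0 Q0)+
  have XY': "X x - Y x \<noteq> 0" using XY[OF x] by simp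
  have E0: "dX x (E x) = 0" "dY x (E x) = 0" "ddir P x (E x) = 0" "ddir Q x (E x) = 0"
    using E x dP[OF x] dQ[OF x] by auto
  have "ddir (\<lambda>y. m y / n y) x (E x) = 0"
    if "(m has_derivative m') (at x)" "(n has_derivative n') (at x)" "n x \<noteq> 0" "m' (E x) = 0" "n' (E x) = 0"
    for m n :: "real^4 \<Rightarrow> real" and m' n'
    unfolding ddir_eqI[OF has_derivative_divide'[OF that(1-3)]] using that(4,5) by simp
  note quot = this
  note dXY = has_derivative_diff[OF d1(1)[OF x] d1(2)[OF x]]
  have a0: "ddir a1 x (E x) = 0" "ddir a2 x (E x) = 0" "ddir a3 x (E x) = 0" "ddir a4 x (E x) = 0"
    unfolding a_def
    using quot[OF dXY d1(5)[OF x]] quot[OF dXY d1(6)[OF x]] quot[OF d1(5)[OF x] dXY] quot[OF d1(6)[OF x] dXY] XY[OF x]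
    by (simp_all add: E0 P0 Q0 x)
  note da = smooth_on_has_derivative[OF sa(1) x] smooth_on_has_derivative[OF sa(2) x]
    smooth_on_has_derivative[OF sa(3) x] smooth_on_has_derivative[OF sa(4) x]
  have ga: "g c y v w = a1 y * (dX y v * dX y w) - a2 y * (dY y v * dY y w) +
     (a3 y * (\<theta> y v * \<theta> y w) -
      a4 y * (\<phi> y v * \<phi> y w))" if "y \<in> S" for y v w
    unfolding form_g[OF that] a_def by (simp add: algebra_simps diff_divide_distrib)
  let ?e = "E x"
  have "ddir (\<lambda>y. g c y v w) x = ddir (\<lambda>y. a1 y * (dX y v * dX y w) - a2 y * (dY y v * dY y w) +
     (a3 y * (\<theta> y v * \<theta> y w) -
      a4 y * (\<phi> y v * \<phi> y w))) x"
    by (rule ddir_cong[OF open_S' x ga])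
  also have "\<dots> = (\<lambda>u. ddir a1 x u * (dX x v * dX x w)
      + a1 x * (hess X x u v * dX x w + dX x v * hess X x u w)
      - (ddir a2 x u * (dY x v * dY x w)
      + a2 x * (hess Y x u v * dY x w + dY x v * hess Y x u w))
      + (ddir a3 x u * (\<theta> x v * \<theta> x w)
      + a3 x * ((hess t x u v + (dY x u * dz x v + Y x * hess z x u v)) * \<theta> x w
        + \<theta> x v * (hess t x u w + (dY x u * dz x w + Y x * hess z x u w)))
      - (ddir a4 x u * (\<phi> x v * \<phi> x w)
      + a4 x * ((hess t x u v + (dX x u * dz x v + X x * hess z x u v)) * \<phi> x w
        + \<phi> x v * (hess t x u w + (dX x u * dz x w + X x * hess z x u w))))))"
    by (rule ddir_eqI) ((rule derivative_eq_intros d1[OF x] d2[OF x] da refl)+, simp add: fun_eq_iff algebra_simps)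
  finally show ?thesis
    unfolding ga[OF x] hX hY ht hz by (simp add: a0 E0 algebra_simps)
qed

text \<open>
  \<open>- J E\<close> is dual to \<open>- \<omega>(E, \<cdot>) = k d(X + Y) + l d(X Y)\<close>.
\<close>

lemma momentum:
  assumes x: "x \<in> S" and E: "dX x E = 0" "dY x E = 0" "dt x E = k" "dz x E = l"
  shows "g c x (- J c x E) v = k * (dX x v + dY x v) + l * (X x * dY x v + Y x * dX x v)"
proof -
  have "g c x (- J c x E) v = - \<omega> c x E v"
    using \<omega>_eq[OF x, of E v] by (simp add: g_simps[OF x])
  then show ?thesis
    using form_\<omega>[OF x, of E v] E by (simp add: algebra_simps)
qed

end

section \<open>The explicit form is an ortho-toric Kaehler structure\<close>

lemma ddir_vector_4:
  assumes "smooth_on S a" "smooth_on S b" "smooth_on S k" "smooth_on S l" "x \<in> S"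
  shows "ddir (\<lambda>x. vector [a x, b x, k x, l x] :: real^4) x v = vector [ddir a x v, ddir b x v, ddir k x v, ddir l x v]"
  by (subst ddir_eqI[OF has_derivative_vector_4[OF smooth_on_has_derivative smooth_on_has_derivative
          smooth_on_has_derivative smooth_on_has_derivative]]) (use assms in auto)

lemma differential_eq: "differential c f x = ddir (f \<circ> chart_inv c) x"
  by (simp add: differential_def[abs_def])

lemma smooth_manifold_pair:
  assumes "smooth_manifold M A" "c \<in> A" "d \<in> A"
  shows "chart_pair M c d"
  using assms by (auto simp: smooth_manifold_def chart_pair_def)

lemma smooth_chart_pair:
  assumes "smooth_manifold M A" "c \<in> A" "smooth_chart M A h"
  shows "chart_pair M c h"
  using assms by (auto simp: smooth_manifold_def smooth_chart_def chart_pair_def compatible_def)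

lemma differential_mult:
  assumes "smooth_on S (f \<circ> chart_inv c)" "smooth_on S (h \<circ> chart_inv c)" "x \<in> S"
  shows "differential c (\<lambda>p. f p * h p) x v = (f \<circ> chart_inv c) x * differential c h x v + (h \<circ> chart_inv c) x * differential c f x v"
  using ddir_eqI[OF has_derivative_mult[OF smooth_on_has_derivative[OF assms(1,3)] smooth_on_has_derivative[OF assms(2,3)]]]
  by (simp add: differential_eq comp_def)

lemma differential_add:
  assumes "smooth_on S (f \<circ> chart_inv c)" "smooth_on S (h \<circ> chart_inv c)" "x \<in> S"
  shows "differential c (\<lambda>p. f p + h p) x v = differential c f x v + differential c h x v"
  using ddir_eqI[OF has_derivative_add[OF smooth_on_has_derivative[OF assms(1,3)] smooth_on_has_derivative[OF assms(2,3)]]]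
  by (simp add: differential_eq comp_def)

text \<open>
  The functions are the components of the coordinate change, which has an invertible derivative.
\<close>

lemma coordinate_functions:
  assumes M: "smooth_manifold M A" and cA: "c \<in> A"
    and h: "smooth_chart M A (W, \<lambda>p. vector [a p, b p, k p, l p])"
  defines "S \<equiv> overlap c (W, \<lambda>p. vector [a p, b p, k p, l p])"
  shows "open S"
    "smooth_on S (a \<circ> chart_inv c)" "smooth_on S (b \<circ> chart_inv c)"
    "smooth_on S (k \<circ> chart_inv c)" "smooth_on S (l \<circ> chart_inv c)"
    "\<And>x v. \<lbrakk>x \<in> S; differential c a x v = 0; differential c b x v = 0; differential c k x v = 0; differential c l x v = 0\<rbrakk> \<Longrightarrow> v = 0"
proof -
  let ?h = "(W, \<lambda>p. vector [a p, b p, k p, l p]) :: 'a chart"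
  interpret chart_pair M c ?h by (rule smooth_chart_pair[OF M cA h])
  show o: "open S" unfolding S_def by (rule open_overlaps)
  have tr: "transition c ?h = (\<lambda>x. vector [(a \<circ> chart_inv c) x, (b \<circ> chart_inv c) x, (k \<circ> chart_inv c) x, (l \<circ> chart_inv c) x])"
    by (auto simp: transition_def)
  have s: "smooth_on S (transition c ?h)"
    using comp by (simp add: compatible_def S_def)
  show s1: "smooth_on S (a \<circ> chart_inv c)" and s2: "smooth_on S (b \<circ> chart_inv c)"
    and s3: "smooth_on S (k \<circ> chart_inv c)" and s4: "smooth_on S (l \<circ> chart_inv c)"
    using smooth_on_nth[OF o s, of 1] smooth_on_nth[OF o s, of 2] smooth_on_nth[OF o s, of 3] smooth_on_nth[OF o s, of 4]
    unfolding tr by (simp_all add: comp_def)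
  fix x v
  assume x: "x \<in> S" and "differential c a x v = 0" "differential c b x v = 0" "differential c k x v = 0" "differential c l x v = 0"
  then have "ddir (transition c ?h) x v = 0"
    unfolding tr ddir_vector_4[OF s1 s2 s3 s4 x] by (simp add: differential_eq vec_eq_iff forall_4)
  then show "v = 0"
    using inj_transition x unfolding S_def by blast
qed

lemma real_function_of:
  fixes F :: "real \<Rightarrow> real" and X :: "real^4 \<Rightarrow> real"
  assumes "open S" "smooth_on T F" "smooth_on S X" "X ` S \<subseteq> T"
  shows "smooth_on S (\<lambda>x. F (X x))"
    "x \<in> S \<Longrightarrow> ddir (\<lambda>x. F (X x)) x v = frechet_derivative F (at (X x)) 1 * ddir X x v"
proof -
  show "smooth_on S (\<lambda>x. F (X x))" by (rule smooth_on_compose[OF assms])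
  assume x: "x \<in> S"
  have F: "(F has_derivative frechet_derivative F (at (X x))) (at (X x))"
    using smooth_onD_has_derivative[OF assms(2)] x assms(4) by blast
  have "ddir (\<lambda>x. F (X x)) x v = frechet_derivative F (at (X x)) (ddir X x v)"
    using ddir_eqI[OF has_derivative_compose[OF smooth_on_has_derivative[OF assms(3) x] F]] by simp
  then show "ddir (\<lambda>x. F (X x)) x v = frechet_derivative F (at (X x)) 1 * ddir X x v"
    using linear_scale[OF has_derivative_linear[OF F], of "ddir X x v" 1] by simp
qed

lemma ortho_toric_chart_of_form:
  assumes M: "smooth_manifold M A" and cA: "c \<in> A"
    and form: "ortho_toric_form M A g J \<omega> W \<xi> \<eta> t z F G" and pos: "positive_definite A g"
  shows "ortho_toric_chart g c (overlap c (W, \<lambda>p. vector [\<xi> p, \<eta> p, t p, z p])) J \<omega>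
    (\<xi> \<circ> chart_inv c) (\<eta> \<circ> chart_inv c) (t \<circ> chart_inv c) (z \<circ> chart_inv c)
    (\<lambda>x. F ((\<xi> \<circ> chart_inv c) x)) (\<lambda>x. G ((\<eta> \<circ> chart_inv c) x))"
    (is "ortho_toric_chart g c ?S J \<omega> ?X ?Y ?t ?z ?P ?Q")
proof -
  have h: "smooth_chart M A (W, \<lambda>p. vector [\<xi> p, \<eta> p, t p, z p])"
    and F: "smooth_on (\<xi> ` W) F" and G: "smooth_on (\<eta> ` W) G"
    and nz: "\<And>p. p \<in> W \<Longrightarrow> \<xi> p \<noteq> \<eta> p \<and> F (\<xi> p) \<noteq> 0 \<and> G (\<eta> p) \<noteq> 0"
    and at: "\<And>p. p \<in> fst c \<inter> W \<Longrightarrow> ortho_toric_at (g c (snd c p)) (J c (snd c p)) (\<omega> c (snd c p)) (\<xi> p) (\<eta> p) (F (\<xi> p)) (G (\<eta> p))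
          (differential c \<xi> (snd c p)) (differential c \<eta> (snd c p))
          (differential c t (snd c p)) (differential c z (snd c p))"
    using form cA unfolding ortho_toric_form_iff by blast+
  note co = coordinate_functions[OF M cA h]
  have c: "chart_on M c" using M cA by (simp add: smooth_manifold_def)
  have W: "x \<in> chart_range c" "chart_inv c x \<in> W" if "x \<in> ?S" for x
    using that overlap_iff[OF c] by auto
  have XS: "?X ` ?S \<subseteq> \<xi> ` W" "?Y ` ?S \<subseteq> \<eta> ` W" using W(2) by auto
  note PP = real_function_of[OF co(1) F co(2) XS(1)] real_function_of[OF co(1) G co(3) XS(2)]
  show ?thesis
  proof (intro ortho_toric_chart.intro)
    show "open ?S" by (rule co(1))
    show "smooth_on ?S ?X" "smooth_on ?S ?Y" "smooth_on ?S ?t" "smooth_on ?S ?z"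
      by (rule co)+
    show "smooth_on ?S ?P" "smooth_on ?S ?Q" by (rule PP)+
    fix x assume x: "x \<in> ?S"
    show "\<exists>p. ddir ?P x = (\<lambda>v. p * ddir ?X x v)" "\<exists>q. ddir ?Q x = (\<lambda>v. q * ddir ?Y x v)"
      using PP(2)[OF x] PP(4)[OF x] by blast+
    show "?X x \<noteq> ?Y x" "?P x \<noteq> 0" "?Q x \<noteq> 0" using nz[OF W(2)[OF x]] by auto
    show "v = 0" if "ddir ?X x v = 0" "ddir ?Y x v = 0" "ddir ?t x v = 0" "ddir ?z x v = 0" for v
      using co(6)[OF x, of v] that by (simp add: differential_eq)
    have "chart_inv c x \<in> fst c \<inter> W" "snd c (chart_inv c x) = x"
      using chart_range_imp[OF W(1)[OF x]] W(2)[OF x] by auto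
    then show "ortho_toric_at (g c x) (J c x) (\<omega> c x) (?X x) (?Y x) (?P x) (?Q x) (ddir ?X x) (ddir ?Y x) (ddir ?t x) (ddir ?z x)"
      using at[of "chart_inv c x"] by (simp add: differential_eq)
    show "g c x v v > 0" if "v \<noteq> 0" for v
      using pos cA W(1)[OF x] that by (auto simp: positive_definite_def)
  qed
qed

text \<open>
  A pair of vectors \<open>u\<close>, \<open>v\<close> and two functionals \<open>\<alpha>\<close>, \<open>\<beta>\<close> give a complex \<open>2 \<times> 2\<close> matrix, with
  entries \<open>\<alpha> + i J\<alpha>\<close> and \<open>\<beta> + i J\<beta>\<close> on \<open>u\<close> and \<open>v\<close>. The real \<open>4 \<times> 4\<close> determinant is the square of
  the modulus of its determinant.
\<close>

lemma det_complex_nonneg: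
  fixes A :: "real^4^4"
  assumes "A$1$2 = - A$2$1" "A$2$2 = A$1$1" "A$3$2 = - A$4$1" "A$4$2 = A$3$1"
    "A$1$4 = - A$2$3" "A$2$4 = A$1$3" "A$3$4 = - A$4$3" "A$4$4 = A$3$3"
  shows "det A \<ge> 0"
proof -
  have "det A = (A$1$1 * A$3$3 - A$2$1 * A$4$3 - A$1$3 * A$3$1 + A$2$3 * A$4$1)^2
      + (A$1$1 * A$4$3 + A$2$1 * A$3$3 - A$1$3 * A$4$1 - A$2$3 * A$3$1)^2"
    unfolding det_4 assms by (simp add: power2_eq_square algebra_simps)
  then show ?thesis by simp
qed

lemma (in ortho_toric_chart) is_almost_hermitian_chart: "almost_hermitian_chart g c S J"
  by (rule almost_hermitian_chart_axioms)

locale explicit_ortho_toric =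
  fixes M :: "'a topology" and A :: "'a chart set" and g :: "'a bform" and J :: "'a endo" and \<omega> :: "'a bform"
    and \<xi> \<eta> t z :: "'a \<Rightarrow> real" and F G :: "real \<Rightarrow> real"
  assumes M: "smooth_manifold M A"
    and form: "ortho_toric_form M A g J \<omega> (topspace M) \<xi> \<eta> t z F G"
    and pos_def: "positive_definite A g"
begin

lemma chart: "c \<in> A \<Longrightarrow> chart_on M c"
  using M by (simp add: smooth_manifold_def)

lemma overlap_range:
  assumes "c \<in> A"
  shows "overlap c (topspace M, h) = chart_range c"
  using openin_subset[OF openin_chart_domain[OF chart[OF assms]]] by (auto simp: overlap_def chart_range_def)

abbreviation X where "X c \<equiv> \<xi> \<circ> chart_inv c"
abbreviation Y where "Y c \<equiv> \<eta> \<circ> chart_inv c"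
abbreviation t' where "t' c \<equiv> t \<circ> chart_inv c"
abbreviation z' where "z' c \<equiv> z \<circ> chart_inv c"

lemma ortho_toric_chart:
  "c \<in> A \<Longrightarrow> ortho_toric_chart g c (chart_range c) J \<omega> (X c) (Y c) (t' c) (z' c)
    (\<lambda>x. F (X c x)) (\<lambda>x. G (Y c x))"
  using ortho_toric_chart_of_form[OF M _ form pos_def] by (simp only: overlap_range)

context
  fixes c d assumes cA: "c \<in> A" and dA: "d \<in> A"
begin

interpretation cd: chart_pair M c d by (rule smooth_manifold_pair[OF M cA dA])
interpretation c: ortho_toric_chart g c "chart_range c" J \<omega> "X c" "Y c" "t' c" "z' c" "\<lambda>x. F (X c x)" "\<lambda>x. G (Y c x)"
  by (rule ortho_toric_chart[OF cA])
interpretation d: ortho_toric_chart g d "chart_range d" J \<omega> "X d" "Y d" "t' d" "z' d" "\<lambda>x. F (X d x)" "\<lambda>x. G (Y d x)"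
  by (rule ortho_toric_chart[OF dA])

lemma overlap_ranges:
  "x \<in> overlap c d \<Longrightarrow> x \<in> chart_range c" "x \<in> overlap c d \<Longrightarrow> transition c d x \<in> chart_range d"
  using cd.transition_mem[of x] overlap_iff[OF cd.c] overlap_iff[OF cd.d] by auto

lemma differentials_change_chart:
  assumes "x \<in> overlap c d"
  shows "ddir (X d) (transition c d x) (ddir (transition c d) x v) = ddir (X c) x v"
    "ddir (Y d) (transition c d x) (ddir (transition c d) x v) = ddir (Y c) x v"
    "ddir (t' d) (transition c d x) (ddir (transition c d) x v) = ddir (t' c) x v"
    "ddir (z' d) (transition c d x) (ddir (transition c d) x v) = ddir (z' c) x v"
  using cd.differential_change_chart[OF assms d.sX overlap_ranges(2)[OF assms]]
    cd.differential_change_chart[OF assms d.sY overlap_ranges(2)[OF assms]]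
    cd.differential_change_chart[OF assms d.st overlap_ranges(2)[OF assms]]
    cd.differential_change_chart[OF assms d.sz overlap_ranges(2)[OF assms]]
  by (simp_all add: differential_eq)

lemma values_change_chart:
  assumes "x \<in> overlap c d"
  shows "X d (transition c d x) = X c x" "Y d (transition c d x) = Y c x"
  by (rule cd.chart_fun_transition[OF assms])+

lemma g_change_chart:
  assumes "x \<in> overlap c d"
  shows "g d (transition c d x) (ddir (transition c d) x v) (ddir (transition c d) x w) = g c x v w"
  unfolding d.form_g[OF overlap_ranges(2)[OF assms]] c.form_g[OF overlap_ranges(1)[OF assms]]
    differentials_change_chart[OF assms] values_change_chart[OF assms] by (rule refl)

lemma J_change_chart:
  assumes "x \<in> overlap c d"
  shows "J d (transition c d x) (ddir (transition c d) x v) = ddir (transition c d) x (J c x v)"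
  by (rule d.vector_eqI[OF overlap_ranges(2)[OF assms]])
    (simp_all only: d.form_J[OF overlap_ranges(2)[OF assms]] c.form_J[OF overlap_ranges(1)[OF assms]]
      differentials_change_chart[OF assms] values_change_chart[OF assms])

lemma field_change_chart:
  assumes "x \<in> overlap c d"
    and "ddir (X c) x u = ddir (X d) (transition c d x) v" "ddir (Y c) x u = ddir (Y d) (transition c d x) v"
    "ddir (t' c) x u = ddir (t' d) (transition c d x) v" "ddir (z' c) x u = ddir (z' d) (transition c d x) v"
  shows "v = ddir (transition c d) x u"
  by (rule d.vector_eqI[OF overlap_ranges(2)[OF assms(1)]])
    (simp_all only: differentials_change_chart[OF assms(1)] assms(2-))

end

lemma almost_hermitian: "c \<in> A \<Longrightarrow> almost_hermitian_chart g c (chart_range c) J"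
  by (rule ortho_toric_chart.is_almost_hermitian_chart[OF ortho_toric_chart])

lemma riemannian: "c \<in> A \<Longrightarrow> riemannian_chart g c (chart_range c)"
  using almost_hermitian by (rule almost_hermitian_chart.axioms(1))

lemma riemannian_metric: "riemannian_metric A g"
  unfolding riemannian_metric_def bform_field_def
  by (intro conjI ballI allI riemannian_chart.g_bilinear[OF riemannian] riemannian_chart.g_smooth[OF riemannian]
      riemannian_chart.g_sym[OF riemannian] g_change_chart pos_def)

lemma endo_field: "endo_field A J"
  unfolding endo_field_def
  by (intro conjI ballI allI almost_hermitian_chart.J_linear[OF almost_hermitian]
      almost_hermitian_chart.J_smooth[OF almost_hermitian] J_change_chart)

lemma smooth_functions: "smooth_fun A \<xi>" "smooth_fun A \<eta>"
  unfolding smooth_fun_def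
  using ortho_toric_chart.sX[OF ortho_toric_chart] ortho_toric_chart.sY[OF ortho_toric_chart] by blast+

text \<open>
  The functions \<open>z\<close>, \<open>t\<close> and local primitives of \<open>J dz\<close>, \<open>J dt\<close> are the real and imaginary parts of
  holomorphic coordinates.
\<close>

lemma holomorphic_coordinates:
  assumes p: "p \<in> topspace M"
  obtains h where "smooth_chart M A h" "p \<in> fst h"
    "\<And>c x. c \<in> A \<Longrightarrow> x \<in> overlap c h \<Longrightarrow>
      J_form J c x (differential c (\<lambda>q. snd h q $ 1) x) = differential c (\<lambda>q. snd h q $ 2) x \<and>
      J_form J c x (differential c (\<lambda>q. snd h q $ 3) x) = differential c (\<lambda>q. snd h q $ 4) x"
proof -
  obtain c where cA: "c \<in> A" and pc: "p \<in> fst c"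
    using M p unfolding smooth_manifold_def by blast
  interpret c: ortho_toric_chart g c "chart_range c" J \<omega> "X c" "Y c" "t' c" "z' c" "\<lambda>x. F (X c x)" "\<lambda>x. G (Y c x)"
    by (rule ortho_toric_chart[OF cA])
  have x0: "snd c p \<in> chart_range c" using pc by (auto simp: chart_range_def)
  obtain e where e: "e > 0" "ball (snd c p) e \<subseteq> chart_range c"
    using c.open_S' x0 open_contains_ball by blast
  define B where "B = ball (snd c p) e"
  have B: "open B" "convex B" "snd c p \<in> B" "B \<subseteq> chart_range c" using e by (auto simp: B_def)
  have BS: "x \<in> B \<Longrightarrow> x \<in> chart_range c" for x using B(4) by blast
  obtain a where a: "smooth_on B a" "\<And>x. x \<in> B \<Longrightarrow> ddir a x = c.\<sigma>z x"
    by (rule poincare_lemma[OF B(1,2), of c.\<sigma>z])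
      (use c.linear_\<sigma>(1) c.closed_\<sigma>(1) BS smooth_on_subset[OF c.smooth_\<sigma>(1) B(4)] in blast)+
  obtain b where b: "smooth_on B b" "\<And>x. x \<in> B \<Longrightarrow> ddir b x = c.\<sigma>t x"
    by (rule poincare_lemma[OF B(1,2), of c.\<sigma>t])
      (use c.linear_\<sigma>(2) c.closed_\<sigma>(2) BS smooth_on_subset[OF c.smooth_\<sigma>(2) B(4)] in blast)+
  define k where "k = (\<lambda>q. vector [z q, a (snd c q), t q, b (snd c q)] :: real^4)"
  have kc: "(k \<circ> chart_inv c) x = vector [z' c x, a x, t' c x, b x]" if "x \<in> B" for x
    using chart_range_imp[OF BS[OF that]] by (simp add: k_def)
  have sB: "smooth_on B (z' c)" "smooth_on B (t' c)"
    using smooth_on_subset[OF _ B(4)] c.sz c.st by blast+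
  have smk: "smooth_on B (k \<circ> chart_inv c)"
    by (rule smooth_on_cong[OF B(1) smooth_on_vector_4[OF B(1) sB(1) a(1) sB(2) b(1)] kc[symmetric]])
  have dk: "ddir (k \<circ> chart_inv c) x v = vector [ddir (z' c) x v, c.\<sigma>z x v, ddir (t' c) x v, c.\<sigma>t x v]" if "x \<in> B" for x v
  proof -
    have "ddir (k \<circ> chart_inv c) x = ddir (\<lambda>x. vector [z' c x, a x, t' c x, b x] :: real^4) x"
      by (rule ddir_cong[OF B(1) that kc])
    then show ?thesis
      by (simp only: ddir_vector_4[OF sB(1) a(1) sB(2) b(1) that] a(2)[OF that] b(2)[OF that])
  qed
  obtain W where W: "p \<in> W" "W \<subseteq> fst c" "snd c ` W \<subseteq> B" "smooth_chart M A (W, k)"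
  proof (rule smooth_chart_from_functions[OF M cA pc B(3,1,4) smk])
    fix v assume "ddir (k \<circ> chart_inv c) (snd c p) v = 0"
    then have "c.\<sigma>z (snd c p) v = 0" "c.\<sigma>t (snd c p) v = 0" "ddir (t' c) (snd c p) v = 0" "ddir (z' c) (snd c p) v = 0"
      unfolding dk[OF B(3)] by (simp_all add: vec_eq_iff forall_4)
    then show "v = 0"
      using c.separating[OF x0 c.\<sigma>_separating[OF x0]] by blast
  qed
  show ?thesis
  proof (rule that[OF W(4)])
    show "p \<in> fst (W, k)" using W(1) by simp
    fix d x assume dA: "d \<in> A" and x: "x \<in> overlap d (W, k)"
    interpret dc: chart_pair M d c by (rule smooth_manifold_pair[OF M dA cA])
    obtain q where q: "q \<in> W" "q \<in> fst d" "x = snd d q" using x by (auto simp: overlap_def)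
    have xo: "x \<in> overlap d c" using q W(2) by (auto simp: overlap_def)
    define y where "y = transition d c x"
    have yB: "y \<in> B" using q W(3) dc.d transition_chart[OF dc.c q(2), of c] by (auto simp: y_def)
    have dt: "differential d f x v = ddir (f \<circ> chart_inv c) y (ddir (transition d c) x v)"
      if "smooth_on B (f \<circ> chart_inv c)" for f v
      using dc.differential_change_chart[OF xo that, of v] yB by (simp add: y_def differential_eq)
    have kn: "smooth_on B ((\<lambda>q. k q $ i) \<circ> chart_inv c)" for i
      using smooth_on_nth[OF B(1) smk, of i] by (simp add: comp_def)
    have kn': "ddir ((\<lambda>q. k q $ i) \<circ> chart_inv c) y v = ddir (k \<circ> chart_inv c) y v $ i" for i v
      using ddir_eqI[OF bounded_linear.has_derivative[OF bounded_linear_vec_nth smooth_on_has_derivative[OF smk yB]], of i]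
      by (simp add: comp_def)
    have Jc: "ddir (transition d c) x (J d x v) = J c y (ddir (transition d c) x v)" for v
      using J_change_chart[OF dA cA xo, of v] by (simp add: y_def)
    show "J_form J d x (differential d (\<lambda>q. snd (W, k) q $ 1) x) = differential d (\<lambda>q. snd (W, k) q $ 2) x \<and>
      J_form J d x (differential d (\<lambda>q. snd (W, k) q $ 3) x) = differential d (\<lambda>q. snd (W, k) q $ 4) x"
      by (simp add: fun_eq_iff J_form_def dt[OF kn] kn' dk[OF yB] Jc c.J_dz[OF BS[OF yB]] c.J_dt[OF BS[OF yB]])
  qed
qed

lemma complex_structure: "complex_structure M A J"
  unfolding complex_structure_def
proof (intro conjI ballI allI endo_field)
  show "J c x (J c x v) = - v" if "c \<in> A" "x \<in> chart_range c" for c x v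
    using almost_hermitian_chart.J_J[OF almost_hermitian] that by blast
  fix p assume p: "p \<in> topspace M"
  show "\<exists>h. smooth_chart M A h \<and> p \<in> fst h \<and>
      (\<forall>c\<in>A. \<forall>x\<in>overlap c h.
        J_form J c x (differential c (\<lambda>q. snd h q $ 1) x) = differential c (\<lambda>q. snd h q $ 2) x \<and>
        J_form J c x (differential c (\<lambda>q. snd h q $ 3) x) = differential c (\<lambda>q. snd h q $ 4) x)"
    using holomorphic_coordinates[OF p] by metis
qed

text \<open>The coframe \<open>d\<xi>\<close>, \<open>J d\<xi>\<close>, \<open>d\<eta>\<close>, \<open>J d\<eta>\<close>, which is positive for the orientation induced by \<open>J\<close>.\<close>

definition coframe :: "'a chart \<Rightarrow> real^4 \<Rightarrow> real^4 \<Rightarrow> real^4" where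
  "coframe c x v = vector [ddir (X c) x v, - ddir (X c) x (J c x v), ddir (Y c) x v, - ddir (Y c) x (J c x v)]"

context
  fixes c assumes cA: "c \<in> A"
begin

interpretation c: ortho_toric_chart g c "chart_range c" J \<omega> "X c" "Y c" "t' c" "z' c" "\<lambda>x. F (X c x)" "\<lambda>x. G (Y c x)"
  by (rule ortho_toric_chart[OF cA])

lemma linear_coframe: "x \<in> chart_range c \<Longrightarrow> linear (coframe c x)"
  by (rule linearI) (simp_all add: coframe_def vec_eq_iff forall_4 c.J_simps c.lin_simps)

lemma det_coframe:
  assumes x: "x \<in> chart_range c"
  shows "det (matrix (coframe c x)) \<noteq> 0"
proof -
  have "v = 0" if "coframe c x v = 0" for v
  proof -
    have 1: "ddir (X c) x v = 0" "ddir (Y c) x v = 0" "ddir (X c) x (J c x v) = 0" "ddir (Y c) x (J c x v) = 0"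
      using that by (simp_all add: coframe_def vec_eq_iff forall_4)
    then have e: "ddir (t' c) x v + Y c x * ddir (z' c) x v = 0" "ddir (t' c) x v + X c x * ddir (z' c) x v = 0"
      using c.XY[OF x] c.P0[OF x] c.Q0[OF x] unfolding c.form_J(1,2)[OF x] by simp_all
    have "(X c x - Y c x) * ddir (z' c) x v = 0" and 2: "ddir (t' c) x v = - Y c x * ddir (z' c) x v"
      using e by algebra+
    then have "ddir (z' c) x v = 0" using c.XY[OF x] by simp
    then show ?thesis using c.separating[OF x 1(1,2)] 2 by simp
  qed
  then show ?thesis
    using det_nz_iff_inj[OF linear_coframe[OF x]] linear_injective_0[OF linear_coframe[OF x]] by blast
qed

lemma continuous_det_coframe: "continuous_on (chart_range c) (\<lambda>x. det (matrix (coframe c x)))"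
proof (rule smooth_on_continuous_on, rule smooth_on_det[OF c.open_S'])
  have sJ: "smooth_on (chart_range c) (\<lambda>x. ddir f x (J c x v))" if "smooth_on (chart_range c) f" for f :: "real^4 \<Rightarrow> real" and v
    by (rule smooth_on_linear_field[OF c.open_S' linear_ddir[OF that] smooth_on_ddir[OF that] c.J_smooth])
  have "smooth_on (chart_range c) (\<lambda>x. coframe c x v)" for v
    unfolding coframe_def
    by (intro smooth_on_vector_4 smooth_on_minus smooth_on_ddir c.open_S' c.sX c.sY sJ)
  then show "smooth_on (chart_range c) (\<lambda>x. matrix (coframe c x) $ i $ j)" for i j
    unfolding matrix_def by simp (rule smooth_on_nth[OF c.open_S'])
qed

lemma det_complex_frame:
  assumes x: "x \<in> chart_range c" and D: "det (vector [u, J c x u, v, J c x v] :: real^4^4) \<noteq> 0"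
  shows "sgn (det (vector [u, J c x u, v, J c x v] :: real^4^4)) = sgn (det (matrix (coframe c x)))"
proof -
  define V where "V = (vector [u, J c x u, v, J c x v] :: real^4^4)"
  have N: "(matrix (coframe c x) ** transpose V) $ i $ j = coframe c x (V $ j) $ i" for i j
  proof -
    have "(matrix (coframe c x) ** transpose V) $ i $ j = (matrix (coframe c x) *v (V $ j)) $ i"
      by (simp add: matrix_matrix_mult_def matrix_vector_mult_def transpose_def)
    then show ?thesis using linear_coframe[OF x] by (simp add: matrix_works)
  qed
  have "det (matrix (coframe c x) ** transpose V) \<ge> 0"
    by (rule det_complex_nonneg; unfold N) (simp_all add: V_def coframe_def c.J_simps[OF x] c.lin_simps x)
  then have "det (matrix (coframe c x)) * det V \<ge> 0"
    by (simp add: det_mul)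
  then show ?thesis
    using D det_coframe[OF x] unfolding V_def[symmetric] by (auto simp: zero_le_mult_iff sgn_if)
qed

lemma chart_coordinate_field:
  "\<exists>E. smooth_on (chart_range c) E \<and> (\<forall>x\<in>chart_range c. ddir (X c) x (E x) = 0 \<and> ddir (Y c) x (E x) = 0 \<and>
    ddir (t' c) x (E x) = k \<and> ddir (z' c) x (E x) = l)"
  by (rule c.coordinate_field)

lemma chart_killing:
  assumes "smooth_on (chart_range c) E" "\<forall>x\<in>chart_range c. ddir (X c) x (E x) = 0 \<and> ddir (Y c) x (E x) = 0 \<and>
    ddir (t' c) x (E x) = k \<and> ddir (z' c) x (E x) = l" "x \<in> chart_range c"
  shows "ddir (\<lambda>x. g c x v w) x (E x) + g c x (ddir E x v) w + g c x v (ddir E x w) = 0"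
  by (rule c.killing[OF assms])

lemma differential_sum_prod:
  assumes x: "x \<in> chart_range c"
  shows "differential c (\<lambda>p. \<xi> p * \<eta> p) x v = X c x * ddir (Y c) x v + Y c x * ddir (X c) x v"
    "differential c (\<lambda>p. \<xi> p + \<eta> p) x v = ddir (X c) x v + ddir (Y c) x v"
  using differential_mult[OF c.sX c.sY x] differential_add[OF c.sX c.sY x] by (simp_all add: differential_eq)

lemma smooth_sum_prod:
  "smooth_on (chart_range c) ((\<lambda>p. \<xi> p * \<eta> p) \<circ> chart_inv c)" "smooth_on (chart_range c) ((\<lambda>p. \<xi> p + \<eta> p) \<circ> chart_inv c)"
  using smooth_on_mult[OF c.open_S' c.sX c.sY] smooth_on_add[OF c.open_S' c.sX c.sY] by (simp_all add: comp_def)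

lemma J_grad:
  assumes x: "x \<in> chart_range c"
  shows "\<lbrakk>ddir (X c) x E = 0; ddir (Y c) x E = 0; ddir (t' c) x E = 0; ddir (z' c) x E = 1\<rbrakk> \<Longrightarrow>
      J c x (grad g c (\<lambda>p. \<xi> p * \<eta> p) x) = E"
    "\<lbrakk>ddir (X c) x E = 0; ddir (Y c) x E = 0; ddir (t' c) x E = 1; ddir (z' c) x E = 0\<rbrakk> \<Longrightarrow>
      J c x (grad g c (\<lambda>p. \<xi> p + \<eta> p) x) = E"
proof -
  assume E: "ddir (X c) x E = 0" "ddir (Y c) x E = 0" "ddir (t' c) x E = 0" "ddir (z' c) x E = 1"
  have "grad g c (\<lambda>p. \<xi> p * \<eta> p) x = - J c x E"
    by (rule c.grad_eqI[OF x]) (simp add: c.momentum[OF x E] differential_sum_prod[OF x])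
  then show "J c x (grad g c (\<lambda>p. \<xi> p * \<eta> p) x) = E" by (simp add: c.J_simps[OF x])
next
  assume E: "ddir (X c) x E = 0" "ddir (Y c) x E = 0" "ddir (t' c) x E = 1" "ddir (z' c) x E = 0"
  have "grad g c (\<lambda>p. \<xi> p + \<eta> p) x = - J c x E"
    by (rule c.grad_eqI[OF x]) (simp add: c.momentum[OF x E] differential_sum_prod[OF x])
  then show "J c x (grad g c (\<lambda>p. \<xi> p + \<eta> p) x) = E" by (simp add: c.J_simps[OF x])
qed

lemma grad_orthogonal:
  assumes x: "x \<in> chart_range c"
  shows "g c x (grad g c \<xi> x) (grad g c \<eta> x) = 0"
proof -
  obtain E where "\<forall>x\<in>chart_range c. ddir (X c) x (E x) = 0 \<and> ddir (Y c) x (E x) = 1 \<and> ddir (t' c) x (E x) = 0 \<and> ddir (z' c) x (E x) = 0"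
    using c.coordinate_field[of 0 1 0 0] by blast
  then have E: "ddir (X c) x (E x) = 0" "ddir (Y c) x (E x) = 1" "ddir (t' c) x (E x) = 0" "ddir (z' c) x (E x) = 0"
    using x by auto
  \<comment> \<open>The field dual to \<open>d\<eta>\<close> is a multiple of \<open>grad \<eta>\<close>, and \<open>d\<xi>\<close> vanishes on it.\<close>
  have gE: "g c x (E x) v = - ((X c x - Y c x) / G (Y c x) * ddir (Y c) x v)" for v
    unfolding c.form_g[OF x] E by simp
  have "grad g c \<eta> x = (- (G (Y c x) / (X c x - Y c x))) *\<^sub>R E x"
  proof (rule c.grad_eqI[OF x])
    show "g c x ((- (G (Y c x) / (X c x - Y c x))) *\<^sub>R E x) v = differential c \<eta> x v" for v
      unfolding c.g_simps(5)[OF x] gE differential_eq using c.XY[OF x] c.Q0[OF x] by simp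
  qed
  then show ?thesis
    using c.grad[OF x c.sX, of "grad g c \<eta> x"] by (simp add: differential_eq c.lin_simps x E)
qed

lemma kaehler_conditions:
  assumes x: "x \<in> chart_range c"
  shows "g c x (J c x v) (J c x w) = g c x v w" "nabla_endo g J c x u v = 0" "\<omega> c x v w = g c x (J c x v) w"
  using c.J_orthogonal[OF x] c.nabla_J[OF x] c.\<omega>_eq[OF x] by auto

lemma \<omega>_vertical:
  assumes x: "x \<in> chart_range c" and "ddir (X c) x v = 0" "ddir (Y c) x v = 0" "ddir (X c) x w = 0" "ddir (Y c) x w = 0"
  shows "\<omega> c x v w = 0"
  unfolding c.form_\<omega>[OF x] using assms by simp

end

text \<open>
  These fields include \<open>\<partial>/\<partial>z\<close> and \<open>\<partial>/\<partial>t\<close>. The local fields fit together because the differentials are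
  defined on all of the manifold.
\<close>

lemma coordinate_vector_field:
  "\<exists>E. killing_field A g E \<and> (\<forall>c\<in>A. \<forall>x\<in>chart_range c. ddir (X c) x (E c x) = 0 \<and> ddir (Y c) x (E c x) = 0 \<and>
    ddir (t' c) x (E c x) = k \<and> ddir (z' c) x (E c x) = l)"
proof -
  have "\<forall>c\<in>A. \<exists>E. smooth_on (chart_range c) E \<and> (\<forall>x\<in>chart_range c. ddir (X c) x (E x) = 0 \<and> ddir (Y c) x (E x) = 0 \<and>
    ddir (t' c) x (E x) = k \<and> ddir (z' c) x (E x) = l)"
    using chart_coordinate_field by blast
  then obtain E where E: "\<And>c. c \<in> A \<Longrightarrow> smooth_on (chart_range c) (E c)"
    "\<And>c. c \<in> A \<Longrightarrow> \<forall>x\<in>chart_range c. ddir (X c) x (E c x) = 0 \<and> ddir (Y c) x (E c x) = 0 \<and>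
    ddir (t' c) x (E c x) = k \<and> ddir (z' c) x (E c x) = l"
    by metis
  have "vector_field A E"
    unfolding vector_field_def
  proof (intro ballI conjI E(1))
    fix c d x assume cd: "c \<in> A" "d \<in> A" and x: "x \<in> overlap c d"
    show "E d (transition c d x) = ddir (transition c d) x (E c x)"
      by (rule field_change_chart[OF cd x])
        (use E(2)[OF cd(1)] E(2)[OF cd(2)] overlap_ranges[OF cd x] in auto)
  qed
  moreover have "ddir (\<lambda>x. g c x v w) x (E c x) + g c x (ddir (E c) x v) w + g c x v (ddir (E c) x w) = 0"
    if "c \<in> A" "x \<in> chart_range c" for c x v w
    by (rule chart_killing[OF that(1) E(1)[OF that(1)] E(2)[OF that(1)] that(2)])
  ultimately have "killing_field A g E"
    by (simp add: killing_field_def)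
  then show ?thesis using E(2) by blast
qed

lemma ortho_toric_kaehler: "\<exists>ori. ortho_toric_kaehler M A ori g J \<omega> \<xi> \<eta>"
proof -
  define ori where "ori = (\<lambda>c x. sgn (det (matrix (coframe c x))))"
  have "orientation A ori"
    unfolding orientation_def
  proof (intro ballI conjI)
    fix c assume cA: "c \<in> A"
    show "continuous_on (chart_range c) (ori c)"
      unfolding ori_def by (intro continuous_on_sgn continuous_det_coframe[OF cA] ballI det_coframe[OF cA])
    show "ori c ` chart_range c \<subseteq> {1, -1}"
      using det_coframe[OF cA] by (auto simp: ori_def sgn_if)
    fix d x assume dA: "d \<in> A" and x: "x \<in> overlap c d"
    interpret cd: chart_pair M c d by (rule smooth_manifold_pair[OF M cA dA])
    have "coframe c x = coframe d (transition c d x) \<circ> ddir (transition c d) x"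
      by (rule ext) (simp add: coframe_def differentials_change_chart[OF cA dA x] J_change_chart[OF cA dA x])
    then have "matrix (coframe c x) = matrix (coframe d (transition c d x)) ** matrix (ddir (transition c d) x)"
      using matrix_compose[OF cd.linear_transition[OF x] linear_coframe[OF dA overlap_ranges(2)[OF cA dA x]]] by simp
    then show "ori c x = sgn (det (matrix (ddir (transition c d) x))) * ori d (transition c d x)"
      by (simp add: ori_def det_mul sgn_mult mult.commute)
  qed
  moreover have "induces_orientation A J ori"
    unfolding induces_orientation_def Let_def ori_def using det_complex_frame by blast
  ultimately have kaehler: "kaehler_surface M A ori g J \<omega>"
    unfolding kaehler_surface_def
    by (intro conjI M riemannian_metric complex_structure ballI allI kaehler_conditions)
  obtain K where K: "killing_field A g K"
    "\<And>c x. c \<in> A \<Longrightarrow> x \<in> chart_range c \<Longrightarrow> ddir (X c) x (K c x) = 0 \<and> ddir (Y c) x (K c x) = 0 \<and>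
    ddir (t' c) x (K c x) = 0 \<and> ddir (z' c) x (K c x) = 1"
    using coordinate_vector_field[of 0 1] by blast
  obtain L where L: "killing_field A g L"
    "\<And>c x. c \<in> A \<Longrightarrow> x \<in> chart_range c \<Longrightarrow> ddir (X c) x (L c x) = 0 \<and> ddir (Y c) x (L c x) = 0 \<and>
    ddir (t' c) x (L c x) = 1 \<and> ddir (z' c) x (L c x) = 0"
    using coordinate_vector_field[of 1 0] by blast
  have JK: "J c x (grad g c (\<lambda>p. \<xi> p * \<eta> p) x) = K c x" and JL: "J c x (grad g c (\<lambda>p. \<xi> p + \<eta> p) x) = L c x"
    if "c \<in> A" "x \<in> chart_range c" for c x
    using J_grad[OF that, of "K c x"] K(2)[OF that] J_grad[OF that, of "L c x"] L(2)[OF that] by auto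
  have "momentum_map A g J K (\<lambda>p. \<xi> p * \<eta> p)" "momentum_map A g J L (\<lambda>p. \<xi> p + \<eta> p)"
    using JK JL smooth_sum_prod by (simp_all add: momentum_map_def smooth_fun_def)
  moreover have "independent_fields A K L"
    unfolding independent_fields_def
  proof (intro ballI allI impI)
    fix c x a b assume cx: "c \<in> A" "x \<in> chart_range c" and ab: "a *\<^sub>R K c x + b *\<^sub>R L c x = 0"
    have "ddir (t' c) x (a *\<^sub>R K c x + b *\<^sub>R L c x) = b" "ddir (z' c) x (a *\<^sub>R K c x + b *\<^sub>R L c x) = a"
      using K(2)[OF cx] L(2)[OF cx] ortho_toric_chart.lin_simps[OF ortho_toric_chart[OF cx(1)] cx(2)] by simp_all
    moreover have "ddir (t' c) x 0 = 0" "ddir (z' c) x 0 = 0"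
      using ortho_toric_chart.lin_simps(19,20)[OF ortho_toric_chart[OF cx(1)] cx(2)] .
    ultimately show "a = 0 \<and> b = 0"
      unfolding ab by simp
  qed
  moreover have "poisson_bracket g J \<omega> c (\<lambda>p. \<xi> p * \<eta> p) (\<lambda>p. \<xi> p + \<eta> p) x = 0"
    if "c \<in> A" "x \<in> chart_range c" for c x
    unfolding poisson_bracket_def JK[OF that] JL[OF that]
    by (rule \<omega>_vertical[OF that]) (use K(2)[OF that] L(2)[OF that] in auto)
  ultimately have "ortho_toric_kaehler M A ori g J \<omega> \<xi> \<eta>"
    unfolding ortho_toric_kaehler_def using kaehler smooth_functions K(1) L(1) grad_orthogonal by blast
  then show ?thesis by blast
qed

end

section \<open>Ortho-toric Kaehler structures in a chart\<close>

locale kaehler_chart = almost_hermitian_chart +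
  assumes nabla_J: "x \<in> S \<Longrightarrow> nabla_endo g J c x u v = 0"
begin

definition cov :: "(real^4 \<Rightarrow> real^4) \<Rightarrow> real^4 \<Rightarrow> real^4 \<Rightarrow> real^4" where
  "cov V x u = ddir V x u + christoffel g c x u (V x)"

definition lie :: "(real^4 \<Rightarrow> real^4) \<Rightarrow> (real^4 \<Rightarrow> real^4) \<Rightarrow> real^4 \<Rightarrow> real^4" where
  "lie V W x = ddir W x (V x) - ddir V x (W x)"

lemma lie_cov: "x \<in> S \<Longrightarrow> lie V W x = cov W x (V x) - cov V x (W x)"
  using christoffel_sym[of x "V x" "W x"] by (simp add: lie_def cov_def)

lemma cov_J: "x \<in> S \<Longrightarrow> smooth_on S V \<Longrightarrow> cov (\<lambda>y. J c y (V y)) x u = J c x (cov V x u)"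
  using nabla_J[of x u "V x"] ddir_J[of x V u] by (simp add: nabla_endo_def cov_def J_simps algebra_simps)

lemma ddir_g_cov:
  "x \<in> S \<Longrightarrow> smooth_on S V \<Longrightarrow> smooth_on S W \<Longrightarrow>
    ddir (\<lambda>y. g c y (V y) (W y)) x u = g c x (cov V x u) (W x) + g c x (V x) (cov W x u)"
  using ddir_g[of x V W u] christoffel_metric[of x "V x" "W x" u] by (simp add: cov_def g_simps)

text \<open>
  Up to a term in the symmetric Christoffel symbol, this is the matrix of second derivatives of \<open>f\<close>.
\<close>

lemma cov_gradient:
  assumes x: "x \<in> S" and V: "smooth_on S V" and f: "smooth_on S f"
    and grad: "\<And>y w. y \<in> S \<Longrightarrow> g c y (V y) w = ddir f y w"
  shows "g c x (cov V x u) w = g c x (cov V x w) u"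
proof -
  have e: "g c x (cov V x u) w + g c x (V x) (christoffel g c x u w) = hess f x u w" for u w
  proof -
    have "ddir (\<lambda>y. g c y (V y) w) x u = hess f x u w"
      using ddir_cong[OF open_S x grad] by simp
    then show ?thesis
      using ddir_g_cov[OF x V smooth_on_const[OF open_S], of w u] by (simp add: cov_def)
  qed
  show ?thesis
    using e[of u w] e[of w u] christoffel_sym[OF x, of u w] ddir_ddir_commute[OF open_S f x, of u w] by simp
qed

lemma cov_killing:
  assumes x: "x \<in> S" and "Dg x (V x) v w + g c x (ddir V x v) w + g c x v (ddir V x w) = 0"
  shows "g c x (cov V x v) w = - g c x v (cov V x w)"
  using assms(2) christoffel_metric[OF x, of v w "V x"] christoffel_sym[OF x, of "V x"]
  by (simp add: cov_def g_simps[OF x])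

end

text \<open>
  The fields are given by their defining properties in the chart: \<open>K\<close> and \<open>L\<close> are Killing, and
  \<open>- J K\<close> and \<open>- J L\<close> are the gradients of \<open>\<xi> \<eta>\<close> and \<open>\<xi> + \<eta>\<close>.
\<close>

locale ortho_toric_kaehler_chart = kaehler_chart +
  fixes X Y :: "real^4 \<Rightarrow> real" and K L :: "real^4 \<Rightarrow> real^4"
  assumes sX: "smooth_on S X" and sY: "smooth_on S Y" and sK: "smooth_on S K" and sL: "smooth_on S L"
    and killing_K: "x \<in> S \<Longrightarrow> Dg x (K x) v w + g c x (ddir K x v) w + g c x v (ddir K x w) = 0"
    and killing_L: "x \<in> S \<Longrightarrow> Dg x (L x) v w + g c x (ddir L x v) w + g c x v (ddir L x w) = 0"
    and momentum_K: "x \<in> S \<Longrightarrow> g c x (J c x (K x)) v = - (X x * ddir Y x v + Y x * ddir X x v)"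
    and momentum_L: "x \<in> S \<Longrightarrow> g c x (J c x (L x)) v = - (ddir X x v + ddir Y x v)"
    and independent: "x \<in> S \<Longrightarrow> a *\<^sub>R K x + b *\<^sub>R L x = 0 \<Longrightarrow> a = 0 \<and> b = 0"
    and commuting: "x \<in> S \<Longrightarrow> g c x (J c x (K x)) (L x) = 0"
    and orthogonal: "x \<in> S \<Longrightarrow> (\<And>w. g c x u w = ddir X x w) \<Longrightarrow> (\<And>w. g c x v w = ddir Y x w) \<Longrightarrow> g c x u v = 0"
begin

abbreviation dX where "dX \<equiv> ddir X"
abbreviation dY where "dY \<equiv> ddir Y"
abbreviation JK where "JK x \<equiv> J c x (K x)"
abbreviation JL where "JL x \<equiv> J c x (L x)"

lemmas sJK = smooth_J[OF sK] and sJL = smooth_J[OF sL]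

subsection \<open>The commuting frame\<close>

lemma cov_K: "x \<in> S \<Longrightarrow> g c x (cov K x v) w = - g c x v (cov K x w)"
  by (rule cov_killing[OF _ killing_K])

lemma cov_L: "x \<in> S \<Longrightarrow> g c x (cov L x v) w = - g c x v (cov L x w)"
  by (rule cov_killing[OF _ killing_L])

lemma J_cov_sym:
  assumes x: "x \<in> S"
  shows "g c x (J c x (cov K x u)) w = g c x (J c x (cov K x w)) u"
    "g c x (J c x (cov L x u)) w = g c x (J c x (cov L x w)) u"
proof -
  note dX = smooth_on_has_derivative[OF sX] and dY = smooth_on_has_derivative[OF sY]
  have "g c y (JK y) w = ddir (\<lambda>y. - (X y * Y y)) y w" if "y \<in> S" for y w
    unfolding ddir_eqI[OF has_derivative_minus[OF has_derivative_mult[OF dX[OF that] dY[OF that]]]]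
    using momentum_K[OF that] by (simp add: algebra_simps)
  then have "g c x (cov JK x u) w = g c x (cov JK x w) u"
    by (intro cov_gradient[OF x sJK smooth_on_minus[OF open_S smooth_on_mult[OF open_S sX sY]]])
  then show "g c x (J c x (cov K x u)) w = g c x (J c x (cov K x w)) u"
    by (simp add: cov_J[OF x sK])
  have "g c y (JL y) w = ddir (\<lambda>y. - (X y + Y y)) y w" if "y \<in> S" for y w
    unfolding ddir_eqI[OF has_derivative_minus[OF has_derivative_add[OF dX[OF that] dY[OF that]]]]
    using momentum_L[OF that] by simp
  then have "g c x (cov JL x u) w = g c x (cov JL x w) u"
    by (intro cov_gradient[OF x sJL smooth_on_minus[OF open_S smooth_on_add[OF open_S sX sY]]])
  then show "g c x (J c x (cov L x u)) w = g c x (J c x (cov L x w)) u"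
    by (simp add: cov_J[OF x sL])
qed

text \<open>
  \<open>\<nabla>K\<close> is skew and \<open>J \<nabla>K = \<nabla>(J K)\<close> is symmetric, hence \<open>\<nabla>K\<close> commutes with \<open>J\<close>. This means that \<open>K\<close> is
  holomorphic.
\<close>

lemma cov_holomorphic:
  assumes x: "x \<in> S"
  shows "cov K x (J c x v) = J c x (cov K x v)" "cov L x (J c x v) = J c x (cov L x v)"
proof -
  show "cov K x (J c x v) = J c x (cov K x v)"
  proof (rule g_cancel[OF x])
    fix w show "g c x (cov K x (J c x v)) w = g c x (J c x (cov K x v)) w"
      using cov_K[OF x, of "J c x v" w] J_skew[OF x, of v "cov K x w"] J_cov_sym(1)[OF x, of v w]
        g_sym[OF x, of v "J c x (cov K x w)"] by linarith
  qed
  show "cov L x (J c x v) = J c x (cov L x v)"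
  proof (rule g_cancel[OF x])
    fix w show "g c x (cov L x (J c x v)) w = g c x (J c x (cov L x v)) w"
      using cov_L[OF x, of "J c x v" w] J_skew[OF x, of v "cov L x w"] J_cov_sym(2)[OF x, of v w]
        g_sym[OF x, of v "J c x (cov L x w)"] by linarith
  qed
qed

text \<open>
  The differential of \<open>\<omega>(K, L) = 0\<close> in the direction \<open>u\<close> is \<open>g(J [L, K], u)\<close>.
\<close>

lemma cov_commute:
  assumes x: "x \<in> S"
  shows "cov K x (L x) = cov L x (K x)"
proof -
  have "J c x (cov K x (L x)) = J c x (cov L x (K x))"
  proof (rule g_cancel[OF x])
    fix u
    have "ddir (\<lambda>y. g c y (JK y) (L y)) x u = 0"
      using ddir_cong[OF open_S x, of "\<lambda>y. g c y (JK y) (L y)" "\<lambda>y. 0"] commuting by simp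
    then have "g c x (J c x (cov K x u)) (L x) + g c x (JK x) (cov L x u) = 0"
      using ddir_g_cov[OF x sJK sL, of u] by (simp add: cov_J[OF x sK])
    then show "g c x (J c x (cov K x (L x))) u = g c x (J c x (cov L x (K x))) u"
      using J_cov_sym(1)[OF x, of u "L x"] cov_L[OF x, of "JK x" u] cov_holomorphic(2)[OF x, of "K x"] by simp
  qed
  then have "J c x (J c x (cov K x (L x))) = J c x (J c x (cov L x (K x)))" by simp
  then show ?thesis by (simp add: J_J[OF x])
qed

text \<open>
  As \<open>K\<close> and \<open>L\<close> are holomorphic, \<open>[K, J L] = J [K, L]\<close>, and similarly for the other brackets.
\<close>

lemma lie_frame:
  assumes "x \<in> S"
  shows "lie K L x = 0" "lie K JK x = 0" "lie K JL x = 0" "lie L JK x = 0" "lie L JL x = 0" "lie JK JL x = 0"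
  by (simp_all add: lie_cov[OF assms] cov_J[OF assms] sK sL cov_holomorphic[OF assms] cov_commute[OF assms])

lemma lie_self: "lie V V x = 0"
  by (simp add: lie_def)

subsection \<open>The gradients of \<open>\<xi>\<close> and \<open>\<eta>\<close>\<close>

lemmas lin_simps = linear_ddir[OF sX, THEN linear_add] linear_ddir[OF sX, THEN linear_diff]
  linear_ddir[OF sX, THEN linear_scale] linear_ddir[OF sX, THEN linear_neg] linear_ddir[OF sX, THEN linear_0]
  linear_ddir[OF sY, THEN linear_add] linear_ddir[OF sY, THEN linear_diff]
  linear_ddir[OF sY, THEN linear_scale] linear_ddir[OF sY, THEN linear_neg] linear_ddir[OF sY, THEN linear_0]

lemma XY:
  assumes x: "x \<in> S"
  shows "X x \<noteq> Y x"
proof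
  assume eq: "X x = Y x"
  \<comment> \<open>Then \<open>d(\<xi> \<eta>) = \<xi> d(\<xi> + \<eta>)\<close>, so \<open>K\<close> is a multiple of \<open>L\<close>.\<close>
  have "J c x (K x - X x *\<^sub>R L x) = 0"
  proof (rule g_cancel[OF x])
    show "g c x (J c x (K x - X x *\<^sub>R L x)) w = g c x 0 w" for w
      by (simp add: J_simps[OF x] g_simps[OF x] momentum_K[OF x] momentum_L[OF x] eq algebra_simps)
  qed
  then have "J c x (J c x (K x - X x *\<^sub>R L x)) = J c x 0" by simp
  then have "1 *\<^sub>R K x + (- X x) *\<^sub>R L x = 0" by (simp add: J_J[OF x] J_simps(5)[OF x])
  then show False using independent[OF x] one_neq_zero by blast
qed

definition gX :: "real^4 \<Rightarrow> real^4" where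
  "gX x = (1 / (X x - Y x)) *\<^sub>R (JK x - X x *\<^sub>R JL x)"

definition gY :: "real^4 \<Rightarrow> real^4" where
  "gY x = (1 / (Y x - X x)) *\<^sub>R (JK x - Y x *\<^sub>R JL x)"

lemma grad_X: "x \<in> S \<Longrightarrow> g c x (gX x) v = dX x v"
  using XY[of x] by (simp add: gX_def g_simps momentum_K momentum_L divide_simps) (simp add: algebra_simps)

lemma grad_Y: "x \<in> S \<Longrightarrow> g c x (gY x) v = dY x v"
  using XY[of x] by (simp add: gY_def g_simps momentum_K momentum_L divide_simps) (simp add: algebra_simps)

lemma smooth_grad: "smooth_on S gX" "smooth_on S gY"
proof -
  have d: "smooth_on S (\<lambda>x. 1 / (X x - Y x))" "smooth_on S (\<lambda>x. 1 / (Y x - X x))"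
    by (intro smooth_on_divide smooth_on_diff smooth_on_const open_S sX sY; simp add: XY XY[symmetric])+
  show "smooth_on S gX" "smooth_on S gY"
    unfolding gX_def[abs_def] gY_def[abs_def]
    by (intro smooth_on_scaleR d smooth_on_diff open_S sX sY sJK sJL)+
qed

lemma JK_grad: "x \<in> S \<Longrightarrow> JK x = - (X x *\<^sub>R gY x + Y x *\<^sub>R gX x)"
  by (rule g_cancel[of x]) (simp_all add: g_simps grad_X grad_Y momentum_K)

lemma JL_grad: "x \<in> S \<Longrightarrow> JL x = - (gX x + gY x)"
  by (rule g_cancel[of x]) (simp_all add: g_simps grad_X grad_Y momentum_L)

lemma K_grad: "x \<in> S \<Longrightarrow> K x = X x *\<^sub>R J c x (gY x) + Y x *\<^sub>R J c x (gX x)"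
  using J_J[of x "K x"] JK_grad[of x] by (simp add: J_simps algebra_simps)

lemma L_grad: "x \<in> S \<Longrightarrow> L x = J c x (gX x) + J c x (gY x)"
  using J_J[of x "L x"] JL_grad[of x] by (simp add: J_simps algebra_simps)

definition nX :: "real^4 \<Rightarrow> real" where "nX x = dX x (gX x)"
definition nY :: "real^4 \<Rightarrow> real" where "nY x = dY x (gY x)"

lemma smooth_n: "smooth_on S nX" "smooth_on S nY"
  unfolding nX_def[abs_def] nY_def[abs_def]
  using smooth_on_linear_field[OF open_S linear_ddir[OF sX] smooth_on_ddir[OF sX] smooth_grad(1)]
    smooth_on_linear_field[OF open_S linear_ddir[OF sY] smooth_on_ddir[OF sY] smooth_grad(2)] by simp_all

lemma n_pos: "x \<in> S \<Longrightarrow> nX x > 0" "x \<in> S \<Longrightarrow> nY x > 0"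
proof -
  assume x: "x \<in> S"
  have "gX x \<noteq> 0"
  proof
    assume "gX x = 0"
    then have "1 *\<^sub>R K x + (- X x) *\<^sub>R L x = 0"
      using K_grad[OF x] L_grad[OF x] by (simp add: J_simps[OF x])
    then show False using independent[OF x] one_neq_zero by blast
  qed
  then have "g c x (gX x) (gX x) > 0" by (rule g_pos[OF x])
  then show "nX x > 0" by (simp add: nX_def grad_X[OF x])
  have "gY x \<noteq> 0"
  proof
    assume "gY x = 0"
    then have "1 *\<^sub>R K x + (- Y x) *\<^sub>R L x = 0"
      using K_grad[OF x] L_grad[OF x] by (simp add: J_simps[OF x])
    then show False using independent[OF x] one_neq_zero by blast
  qed
  then have "g c x (gY x) (gY x) > 0" by (rule g_pos[OF x])
  then show "nY x > 0" by (simp add: nY_def grad_Y[OF x])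
qed

lemma differentials_grad:
  assumes x: "x \<in> S"
  shows "dX x (gX x) = nX x" "dY x (gY x) = nY x" "dX x (gY x) = 0" "dY x (gX x) = 0"
    "dX x (J c x (gX x)) = 0" "dY x (J c x (gY x)) = 0"
    "dX x (J c x (gY x)) = 0" "dY x (J c x (gX x)) = 0"
proof -
  show "dX x (gX x) = nX x" "dY x (gY x) = nY x" by (simp_all add: nX_def nY_def)
  have "g c x (gX x) (gY x) = 0" by (rule orthogonal[OF x grad_X[OF x] grad_Y[OF x]])
  then show "dX x (gY x) = 0" "dY x (gX x) = 0"
    using grad_X[OF x] grad_Y[OF x] g_sym[OF x, of "gX x" "gY x"] by simp_all
  show "dX x (J c x (gX x)) = 0" "dY x (J c x (gY x)) = 0"
    by (simp_all add: grad_X[OF x, symmetric] grad_Y[OF x, symmetric] g_J_self[OF x])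
  have s: "g c x (gY x) (J c x (gX x)) = - g c x (gX x) (J c x (gY x))"
    using J_skew[OF x, of "gX x" "gY x"] g_sym[OF x] by metis
  have "(X x - Y x) * g c x (gX x) (J c x (gY x)) = g c x (JK x) (L x)"
    unfolding JK_grad[OF x] L_grad[OF x]
    by (simp add: g_simps[OF x] g_J_self[OF x] s algebra_simps)
  then have "g c x (gX x) (J c x (gY x)) = 0"
    using commuting[OF x] XY[OF x] by simp
  then show "dX x (J c x (gY x)) = 0" "dY x (J c x (gX x)) = 0"
    using s by (simp_all add: grad_X[OF x] grad_Y[OF x])
qed

subsection \<open>The dual coframe\<close>

text \<open>
  The forms \<open>\<tau>z\<close>, \<open>\<tau>t\<close>, \<open>\<sigma>z\<close>, \<open>\<sigma>t\<close> are dual to \<open>K\<close>, \<open>L\<close>, \<open>J K\<close>, \<open>J L\<close>. They turn into \<open>dz\<close>, \<open>dt\<close>, \<open>J dz\<close>,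
  \<open>J dt\<close>, with \<open>P = F(\<xi>)\<close> and \<open>Q = G(\<eta>)\<close>, once the coordinates are constructed.
\<close>

definition P :: "real^4 \<Rightarrow> real" where "P x = nX x * (X x - Y x)"
definition Q :: "real^4 \<Rightarrow> real" where "Q x = nY x * (Y x - X x)"

definition \<sigma>z :: "real^4 \<Rightarrow> real^4 \<Rightarrow> real" where "\<sigma>z x v = dX x v / P x + dY x v / Q x"
definition \<sigma>t :: "real^4 \<Rightarrow> real^4 \<Rightarrow> real" where "\<sigma>t x v = - (X x * dX x v / P x) - Y x * dY x v / Q x"
definition \<tau>z :: "real^4 \<Rightarrow> real^4 \<Rightarrow> real" where "\<tau>z x v = \<sigma>z x (J c x v)"
definition \<tau>t :: "real^4 \<Rightarrow> real^4 \<Rightarrow> real" where "\<tau>t x v = \<sigma>t x (J c x v)"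

lemma PQ: "x \<in> S \<Longrightarrow> P x \<noteq> 0" "x \<in> S \<Longrightarrow> Q x \<noteq> 0"
  using n_pos[of x] XY[of x] by (auto simp: P_def Q_def)

lemma smooth_PQ: "smooth_on S P" "smooth_on S Q"
  unfolding P_def[abs_def] Q_def[abs_def]
  by (intro smooth_on_mult smooth_on_diff open_S smooth_n sX sY)+

lemma linear_\<sigma>: "x \<in> S \<Longrightarrow> linear (\<sigma>z x)" "x \<in> S \<Longrightarrow> linear (\<sigma>t x)"
  by (rule linearI; simp add: \<sigma>z_def \<sigma>t_def lin_simps algebra_simps add_divide_distrib)+

lemma linear_\<tau>: "x \<in> S \<Longrightarrow> linear (\<tau>z x)" "x \<in> S \<Longrightarrow> linear (\<tau>t x)"
  by (rule linearI; simp add: \<tau>z_def \<tau>t_def J_simps linear_\<sigma>[THEN linear_add] linear_\<sigma>[THEN linear_scale])+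

lemma smooth_\<sigma>: "smooth_on S (\<lambda>x. \<sigma>z x v)" "smooth_on S (\<lambda>x. \<sigma>t x v)"
  unfolding \<sigma>z_def \<sigma>t_def
  by (intro smooth_on_add smooth_on_diff smooth_on_minus smooth_on_divide smooth_on_mult smooth_on_ddir open_S sX sY smooth_PQ PQ; assumption)+

lemma smooth_\<tau>: "smooth_on S (\<lambda>x. \<tau>z x v)" "smooth_on S (\<lambda>x. \<tau>t x v)"
  unfolding \<tau>z_def \<tau>t_def
  using smooth_on_linear_field[OF open_S linear_\<sigma>(1) smooth_\<sigma>(1) J_smooth]
    smooth_on_linear_field[OF open_S linear_\<sigma>(2) smooth_\<sigma>(2) J_smooth] by simp_all

lemma dual_frame:
  assumes x: "x \<in> S"
  shows "\<tau>z x (K x) = 1" "\<tau>z x (L x) = 0" "\<tau>z x (JK x) = 0" "\<tau>z x (JL x) = 0"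
    "\<tau>t x (K x) = 0" "\<tau>t x (L x) = 1" "\<tau>t x (JK x) = 0" "\<tau>t x (JL x) = 0"
    "\<sigma>z x (K x) = 0" "\<sigma>z x (L x) = 0" "\<sigma>z x (JK x) = 1" "\<sigma>z x (JL x) = 0"
    "\<sigma>t x (K x) = 0" "\<sigma>t x (L x) = 0" "\<sigma>t x (JK x) = 0" "\<sigma>t x (JL x) = 1"
proof -
  note n = n_pos[OF x] and D = differentials_grad[OF x]
  have d: "dX x (K x) = 0" "dY x (K x) = 0" "dX x (L x) = 0" "dY x (L x) = 0"
    "dX x (JK x) = - (Y x * nX x)" "dY x (JK x) = - (X x * nY x)" "dX x (JL x) = - nX x" "dY x (JL x) = - nY x"
    unfolding JK_grad[OF x] JL_grad[OF x] unfolding K_grad[OF x] L_grad[OF x]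
    by (simp_all add: lin_simps[OF x] D)
  show 1: "\<sigma>z x (K x) = 0" "\<sigma>z x (L x) = 0" "\<sigma>t x (K x) = 0" "\<sigma>t x (L x) = 0"
    by (simp_all add: \<sigma>z_def \<sigma>t_def d)
  have r: "nX x / P x = 1 / (X x - Y x)" "nY x / Q x = - (1 / (X x - Y x))"
    using n XY[OF x] by (simp_all add: P_def Q_def divide_simps)
  have e: "\<sigma>z x v = m * (nX x / P x) + n * (nY x / Q x)" "\<sigma>t x v = - (X x * m * (nX x / P x)) - Y x * n * (nY x / Q x)"
    if "dX x v = m * nX x" "dY x v = n * nY x" for v m n
    by (simp_all add: \<sigma>z_def \<sigma>t_def that)
  have eK: "\<sigma>z x (JK x) = - Y x * (nX x / P x) + - X x * (nY x / Q x)"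
    "\<sigma>t x (JK x) = - (X x * (- Y x) * (nX x / P x)) - Y x * (- X x) * (nY x / Q x)"
    by (rule e; simp add: d)+
  have eL: "\<sigma>z x (JL x) = - 1 * (nX x / P x) + - 1 * (nY x / Q x)"
    "\<sigma>t x (JL x) = - (X x * (- 1) * (nX x / P x)) - Y x * (- 1) * (nY x / Q x)"
    by (rule e; simp add: d)+
  show 2: "\<sigma>z x (JK x) = 1" "\<sigma>z x (JL x) = 0" "\<sigma>t x (JK x) = 0" "\<sigma>t x (JL x) = 1"
    unfolding eK eL r using XY[OF x] by (simp_all add: divide_simps)
  show "\<tau>z x (K x) = 1" "\<tau>z x (L x) = 0" "\<tau>z x (JK x) = 0" "\<tau>z x (JL x) = 0"
    "\<tau>t x (K x) = 0" "\<tau>t x (L x) = 1" "\<tau>t x (JK x) = 0" "\<tau>t x (JL x) = 0"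
    using 1 2 by (simp_all add: \<tau>z_def \<tau>t_def J_J[OF x] linear_\<sigma>[OF x, THEN linear_neg])
qed

text \<open>
  Four functionals which are dual to four vectors form an isomorphism with \<open>\<real>\<^sup>4\<close>, and hence separate
  vectors.
\<close>

lemma coframe_separating:
  assumes x: "x \<in> S" and v: "\<tau>z x v = 0" "\<tau>t x v = 0" "\<sigma>z x v = 0" "\<sigma>t x v = 0"
  shows "v = 0"
proof -
  define \<Phi> where "\<Phi> v = (vector [\<tau>z x v, \<tau>t x v, \<sigma>z x v, \<sigma>t x v] :: real^4)" for v
  note l = linear_\<sigma>[OF x, THEN linear_add] linear_\<sigma>[OF x, THEN linear_scale]
    linear_\<tau>[OF x, THEN linear_add] linear_\<tau>[OF x, THEN linear_scale]
  have lin: "linear \<Phi>"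
    by (rule linearI) (simp_all add: \<Phi>_def vec_eq_iff forall_4 l)
  have "\<Phi> (a $ 1 *\<^sub>R K x + a $ 2 *\<^sub>R L x + a $ 3 *\<^sub>R JK x + a $ 4 *\<^sub>R JL x) = a" for a
    by (simp add: \<Phi>_def vec_eq_iff forall_4 l dual_frame[OF x])
  then have "surj \<Phi>" by (rule surjI)
  then have "inj \<Phi>" using linear_surj_imp_inj[OF lin] by blast
  moreover have "\<Phi> v = 0" using v by (simp add: \<Phi>_def vec_eq_iff forall_4)
  ultimately show ?thesis using linear_injective_0[OF lin] by blast
qed

lemma frame_expansion:
  assumes x: "x \<in> S"
  shows "v = \<tau>z x v *\<^sub>R K x + \<tau>t x v *\<^sub>R L x + \<sigma>z x v *\<^sub>R JK x + \<sigma>t x v *\<^sub>R JL x" (is "v = ?R")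
proof -
  note l = linear_\<sigma>[OF x, THEN linear_add] linear_\<sigma>[OF x, THEN linear_scale] linear_\<sigma>[OF x, THEN linear_diff]
    linear_\<tau>[OF x, THEN linear_add] linear_\<tau>[OF x, THEN linear_scale] linear_\<tau>[OF x, THEN linear_diff]
  have "v - ?R = 0"
    by (rule coframe_separating[OF x]) (simp_all add: l dual_frame[OF x])
  then show ?thesis by simp
qed

lemma frame_zero:
  fixes f :: "real^4 \<Rightarrow> real"
  assumes x: "x \<in> S" and f: "linear f" "f (K x) = 0" "f (L x) = 0" "f (JK x) = 0" "f (JL x) = 0"
  shows "f v = 0"
  by (subst frame_expansion[OF x, of v])
    (simp add: linear_add[OF f(1)] linear_scale[OF f(1)] f(2-))

text \<open>
  On two fields \<open>V\<close>, \<open>W\<close> of the frame all three terms of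
  \<open>d\<tau>(V, W) = V \<tau>(W) - W \<tau>(V) - \<tau>([V, W])\<close> vanish.
\<close>

lemma closed_of_constant:
  assumes x: "x \<in> S" and \<tau>: "\<And>y. y \<in> S \<Longrightarrow> linear (\<tau> y)" "\<And>v. smooth_on S (\<lambda>y. \<tau> y v)"
    and const: "\<And>y. y \<in> S \<Longrightarrow> \<tau> y (K y) = k1" "\<And>y. y \<in> S \<Longrightarrow> \<tau> y (L y) = k2"
      "\<And>y. y \<in> S \<Longrightarrow> \<tau> y (JK y) = k3" "\<And>y. y \<in> S \<Longrightarrow> \<tau> y (JL y) = (k4::real)"
  shows "ddir (\<lambda>y. \<tau> y v) x u = ddir (\<lambda>y. \<tau> y u) x v"
proof -
  define B where "B u v = ddir (\<lambda>y. \<tau> y v) x u - ddir (\<lambda>y. \<tau> y u) x v" for u v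
  have lin: "linear (\<lambda>u. ddir (\<lambda>y. \<tau> y v) x u)" "linear (\<lambda>v. ddir (\<lambda>y. \<tau> y v) x u)" for u v
    using linear_ddir[OF \<tau>(2) x] linear_ddir_field[OF open_S x \<tau>] by auto
  have linB: "linear (B u)" "linear (\<lambda>u. B u v)" for u v
    unfolding B_def by (intro linear_compose_sub lin)+
  have B: "B (V x) (W x) = - \<tau> x (lie V W x)"
    if V: "smooth_on S V" "\<And>y. y \<in> S \<Longrightarrow> \<tau> y (V y) = m" and W: "smooth_on S W" "\<And>y. y \<in> S \<Longrightarrow> \<tau> y (W y) = n" for V W m n
  proof -
    have "ddir (\<lambda>y. \<tau> y (V y)) x u = 0" "ddir (\<lambda>y. \<tau> y (W y)) x u = 0" for u
      using ddir_cong[OF open_S x V(2)] ddir_cong[OF open_S x W(2)] by simp_all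
    then show ?thesis
      using ddir_linear_field[OF open_S x \<tau> V(1), of "W x"] ddir_linear_field[OF open_S x \<tau> W(1), of "V x"]
      by (simp add: B_def lie_def linear_diff[OF \<tau>(1)[OF x]])
  qed
  note l0 = lie_frame[OF x] lie_self linear_0[OF \<tau>(1)[OF x]]
  note B' = B[OF sK const(1) sK const(1)] B[OF sK const(1) sL const(2)] B[OF sK const(1) sJK const(3)] B[OF sK const(1) sJL const(4)]
    B[OF sL const(2) sL const(2)] B[OF sL const(2) sJK const(3)] B[OF sL const(2) sJL const(4)]
    B[OF sJK const(3) sJK const(3)] B[OF sJK const(3) sJL const(4)] B[OF sJL const(4) sJL const(4)]
  have B0: "B (K x) (K x) = 0" "B (K x) (L x) = 0" "B (K x) (JK x) = 0" "B (K x) (JL x) = 0"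
    "B (L x) (L x) = 0" "B (L x) (JK x) = 0" "B (L x) (JL x) = 0"
    "B (JK x) (JK x) = 0" "B (JK x) (JL x) = 0" "B (JL x) (JL x) = 0"
    by (simp_all add: B' l0)
  have skew: "B u v = - B v u" for u v by (simp add: B_def)
  have Bu: "B u (K x) = 0" "B u (L x) = 0" "B u (JK x) = 0" "B u (JL x) = 0" for u
    by (rule frame_zero[OF x linB(2)]; simp add: B0 skew[of "L x" "K x"] skew[of "JK x" "K x"] skew[of "JL x" "K x"]
        skew[of "JK x" "L x"] skew[of "JL x" "L x"] skew[of "JL x" "JK x"])+
  have "B u v = 0" by (rule frame_zero[OF x linB(1) Bu])
  then show ?thesis by (simp add: B_def)
qed

lemma closed_coframe:
  assumes x: "x \<in> S"
  shows "ddir (\<lambda>y. \<tau>z y v) x u = ddir (\<lambda>y. \<tau>z y u) x v" "ddir (\<lambda>y. \<tau>t y v) x u = ddir (\<lambda>y. \<tau>t y u) x v"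
    "ddir (\<lambda>y. \<sigma>z y v) x u = ddir (\<lambda>y. \<sigma>z y u) x v" "ddir (\<lambda>y. \<sigma>t y v) x u = ddir (\<lambda>y. \<sigma>t y u) x v"
  using closed_of_constant[OF x linear_\<tau>(1) smooth_\<tau>(1) dual_frame(1,2,3,4), of v u]
    closed_of_constant[OF x linear_\<tau>(2) smooth_\<tau>(2) dual_frame(5,6,7,8), of v u]
    closed_of_constant[OF x linear_\<sigma>(1) smooth_\<sigma>(1) dual_frame(9,10,11,12), of v u]
    closed_of_constant[OF x linear_\<sigma>(2) smooth_\<sigma>(2) dual_frame(13,14,15,16), of v u] by simp_all

text \<open>
  Closedness of \<open>J dz\<close> and \<open>J dt\<close> means \<open>d(1/P) \<and> d\<xi> + d(1/Q) \<and> d\<eta> = 0\<close> and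
  \<open>\<xi> d(1/P) \<and> d\<xi> + \<eta> d(1/Q) \<and> d\<eta> = 0\<close>. As \<open>\<xi> \<noteq> \<eta>\<close>, both summands vanish.
\<close>

lemma PQ_one_variable:
  assumes x: "x \<in> S"
  shows "dX x v = 0 \<Longrightarrow> ddir P x v = 0" "dY x v = 0 \<Longrightarrow> ddir Q x v = 0"
proof -
  note dd = smooth_on_has_derivative[OF sX x] smooth_on_has_derivative[OF sY x]
    smooth_on_has_derivative[OF smooth_on_ddir[OF sX] x] smooth_on_has_derivative[OF smooth_on_ddir[OF sY] x]
  note hess = ddir_ddir_commute[OF open_S sX x] ddir_ddir_commute[OF open_S sY x]
  define p where "p = ddir (\<lambda>y. 1 / P y) x"
  define q where "q = ddir (\<lambda>y. 1 / Q y) x"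
  have sp: "smooth_on S (\<lambda>y. 1 / P y)" "smooth_on S (\<lambda>y. 1 / Q y)"
    by (intro smooth_on_divide smooth_on_const open_S smooth_PQ PQ; assumption)+
  have dp: "((\<lambda>y. 1 / P y) has_derivative p) (at x)" "((\<lambda>y. 1 / Q y) has_derivative q) (at x)"
    unfolding p_def q_def using smooth_on_has_derivative[OF _ x] sp by blast+
  have z: "ddir (\<lambda>y. \<sigma>z y v) x u = (1 / P x * hess X x u v + p u * dX x v)
      + (1 / Q x * hess Y x u v + q u * dY x v)" for u v
  proof -
    have "(\<lambda>y. \<sigma>z y v) = (\<lambda>y. 1 / P y * dX y v + 1 / Q y * dY y v)"
      by (simp add: \<sigma>z_def)
    then show ?thesis
      using ddir_eqI[OF has_derivative_add[OF has_derivative_mult[OF dp(1) dd(3)[of v]] has_derivative_mult[OF dp(2) dd(4)[of v]]]]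
      by simp
  qed
  have t: "ddir (\<lambda>y. \<sigma>t y v) x u = - (X x * (1 / P x * hess X x u v + p u * dX x v)
        + dX x u * (1 / P x * dX x v))
      - (Y x * (1 / Q x * hess Y x u v + q u * dY x v) + dY x u * (1 / Q x * dY x v))" for u v
  proof -
    have "(\<lambda>y. \<sigma>t y v) = (\<lambda>y. - (X y * (1 / P y * dX y v)) - Y y * (1 / Q y * dY y v))"
      by (simp add: \<sigma>t_def)
    then show ?thesis
      using ddir_eqI[OF has_derivative_diff[OF has_derivative_minus[OF has_derivative_mult[OF dd(1) has_derivative_mult[OF dp(1) dd(3)[of v]]]]
          has_derivative_mult[OF dd(2) has_derivative_mult[OF dp(2) dd(4)[of v]]]]]
      by simp
  qed
  have 1: "p u * dX x v + q u * dY x v = p v * dX x u + q v * dY x u" for u v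
    using closed_coframe(3)[OF x, of v u] hess(1)[of u v] hess(2)[of u v] unfolding z by simp
  have 2: "X x * (p u * dX x v) + Y x * (q u * dY x v) = X x * (p v * dX x u) + Y x * (q v * dY x u)" for u v
    using closed_coframe(4)[OF x, of v u] hess(1)[of u v] hess(2)[of u v] unfolding t by (simp add: algebra_simps)
  have "(X x - Y x) * (p u * dX x v - p v * dX x u) = 0" "(X x - Y x) * (q u * dY x v - q v * dY x u) = 0" for u v
    using 1[of u v] 2[of u v] by algebra+
  then have pq: "p u * dX x v = p v * dX x u" "q u * dY x v = q v * dY x u" for u v
    using XY[OF x] by auto
  have P: "ddir P x v = - (P x * P x) * p v" "ddir Q x v = - (Q x * Q x) * q v" for v
  proof -
    have "((\<lambda>y. 1 / P y) has_derivative (\<lambda>v. - ddir P x v / (P x * P x))) (at x)"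
      "((\<lambda>y. 1 / Q y) has_derivative (\<lambda>v. - ddir Q x v / (Q x * Q x))) (at x)"
      using PQ[OF x] smooth_on_has_derivative[OF smooth_PQ(1) x] smooth_on_has_derivative[OF smooth_PQ(2) x]
      by (auto intro!: derivative_eq_intros simp: fun_eq_iff field_simps)
    then have "p = (\<lambda>v. - ddir P x v / (P x * P x))" "q = (\<lambda>v. - ddir Q x v / (Q x * Q x))"
      using dp has_derivative_unique by blast+
    then show "ddir P x v = - (P x * P x) * p v" "ddir Q x v = - (Q x * Q x) * q v"
      using PQ[OF x] by simp_all
  qed
  show "ddir P x v = 0" if "dX x v = 0"
    using pq(1)[of v "gX x"] that n_pos(1)[OF x] differentials_grad(1)[OF x] by (simp add: P)
  show "ddir Q x v = 0" if "dY x v = 0"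
    using pq(2)[of v "gY x"] that n_pos(2)[OF x] differentials_grad(2)[OF x] by (simp add: P)
qed

text \<open>The fields \<open>gX\<close>, \<open>gY\<close>, \<open>J gX\<close>, \<open>J gY\<close> are orthogonal, of square lengths \<open>nX\<close> and \<open>nY\<close>.\<close>

lemma g_expansion:
  assumes x: "x \<in> S"
  shows "g c x v w = (dX x v * dX x w + dX x (J c x v) * dX x (J c x w)) / nX x
    + (dY x v * dY x w + dY x (J c x v) * dY x (J c x w)) / nY x"
proof -
  note n = n_pos[OF x] and D = differentials_grad[OF x]
  define R where "R = (dX x w / nX x) *\<^sub>R gX x + (dY x w / nY x) *\<^sub>R gY x
    - (dX x (J c x w) / nX x) *\<^sub>R J c x (gX x) - (dY x (J c x w) / nY x) *\<^sub>R J c x (gY x)"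
  have 0: "dX x (w - R) = 0" "dY x (w - R) = 0" "dX x (J c x (w - R)) = 0" "dY x (J c x (w - R)) = 0"
    using n by (simp_all add: R_def lin_simps[OF x] J_simps[OF x] D)
  have "w - R = 0"
    by (rule coframe_separating[OF x]) (simp_all add: \<tau>z_def \<tau>t_def \<sigma>z_def \<sigma>t_def 0)
  then have "g c x v w = g c x v R" by simp
  moreover have "g c x v (gX x) = dX x v" "g c x v (gY x) = dY x v"
    "g c x v (J c x (gX x)) = - dX x (J c x v)" "g c x v (J c x (gY x)) = - dY x (J c x v)"
    using grad_X[OF x] grad_Y[OF x] g_sym[OF x] J_skew[OF x] by (metis minus_minus)+
  ultimately show ?thesis
    by (simp add: R_def g_simps[OF x] add_divide_distrib mult.commute)
qed

lemma ortho_toric_formulas: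
  assumes x: "x \<in> S"
  shows "ortho_toric_at (g c x) (J c x) (\<lambda>v w. g c x (J c x v) w) (X x) (Y x) (P x) (Q x)
    (dX x) (dY x) (\<tau>t x) (\<tau>z x)"
proof -
  note n = n_pos[OF x]
  have D: "X x - Y x \<noteq> 0" "Y x - X x \<noteq> 0" using XY[OF x] by auto
  have r: "P x / (X x - Y x) = nX x" "Q x / (Y x - X x) = nY x" "(X x - Y x) / P x = 1 / nX x" "(X x - Y x) / Q x = - 1 / nY x"
    using D n by (simp_all add: P_def Q_def divide_simps right_diff_distrib left_diff_distrib)
  have r': "Q x / (X x - Y x) = - nY x" using D n by (simp add: Q_def divide_simps right_diff_distrib left_diff_distrib)
  have \<theta>: "\<tau>t x v + Y x * \<tau>z x v = - dX x (J c x v) / nX x" for v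
  proof -
    have "\<tau>t x v + Y x * \<tau>z x v = - ((X x - Y x) / P x * dX x (J c x v))"
      by (simp add: \<tau>t_def \<tau>z_def \<sigma>t_def \<sigma>z_def algebra_simps diff_divide_distrib)
    then show ?thesis by (simp add: r)
  qed
  have \<phi>: "\<tau>t x v + X x * \<tau>z x v = - dY x (J c x v) / nY x" for v
  proof -
    have "\<tau>t x v + X x * \<tau>z x v = (X x - Y x) / Q x * dY x (J c x v)"
      by (simp add: \<tau>t_def \<tau>z_def \<sigma>t_def \<sigma>z_def algebra_simps diff_divide_distrib)
    then show ?thesis by (simp add: r)
  qed
  have g: "g c x v w = (X x - Y x) * (dX x v * dX x w / P x - dY x v * dY x w / Q x)
      + 1 / (X x - Y x) * (P x * ((\<tau>t x v + Y x * \<tau>z x v) * (\<tau>t x w + Y x * \<tau>z x w))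
        - Q x * ((\<tau>t x v + X x * \<tau>z x v) * (\<tau>t x w + X x * \<tau>z x w)))" for v w
  proof -
    have e1: "(X x - Y x) * (dX x v * dX x w / P x - dY x v * dY x w / Q x) =
        (X x - Y x) / P x * (dX x v * dX x w) - (X x - Y x) / Q x * (dY x v * dY x w)"
      by (simp add: right_diff_distrib)
    have e2: "1 / (X x - Y x) * (P x * a - Q x * b) = P x / (X x - Y x) * a - Q x / (X x - Y x) * b" for a b
      by (simp add: diff_divide_distrib)
    show ?thesis
      unfolding g_expansion[OF x, of v w] e1 e2 r r' \<theta> \<phi> using n by (simp add: add_divide_distrib)
  qed
  show ?thesis
    unfolding ortho_toric_at_def
  proof (intro conjI allI g)
    fix v w
    show "- dX x (J c x v) = P x / (X x - Y x) * (\<tau>t x v + Y x * \<tau>z x v)"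
      "- dY x (J c x v) = Q x / (Y x - X x) * (\<tau>t x v + X x * \<tau>z x v)"
      unfolding \<theta> \<phi> r using n by simp_all
    show "- \<tau>t x (J c x v) = - (X x * dX x v / P x) - Y x * dY x v / Q x"
      "- \<tau>z x (J c x v) = dX x v / P x + dY x v / Q x"
      unfolding \<tau>t_def \<tau>z_def J_J[OF x] linear_neg[OF linear_\<sigma>(1)[OF x]] linear_neg[OF linear_\<sigma>(2)[OF x]]
      by (simp_all add: \<sigma>t_def \<sigma>z_def)
    show "g c x (J c x v) w = dX x v * (\<tau>t x w + Y x * \<tau>z x w) - dX x w * (\<tau>t x v + Y x * \<tau>z x v)
        + (dY x v * (\<tau>t x w + X x * \<tau>z x w) - dY x w * (\<tau>t x v + X x * \<tau>z x v))"
      unfolding \<theta> \<phi> g_expansion[OF x, of "J c x v" w] using n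
      by (simp add: J_J[OF x] lin_simps[OF x] add_divide_distrib diff_divide_distrib algebra_simps)
  qed
qed

end

section \<open>Charts in which a Kaehler structure takes the explicit form\<close>

lemma ortho_toric_at_transfer:
  assumes at: "ortho_toric_at b j om X Y P Q a1 a2 a3 a4" and surj: "\<And>v. \<exists>u. T u = v"
    and b: "\<And>u v. b' (T u) (T v) = b u v" and j: "\<And>v. j' (T v) = T (j v)" and om: "\<And>u v. om' (T u) (T v) = om u v"
    and a: "\<And>v. a1' (T v) = a1 v" "\<And>v. a2' (T v) = a2 v" "\<And>v. a3' (T v) = a3 v" "\<And>v. a4' (T v) = a4 v"
  shows "ortho_toric_at b' j' om' X Y P Q a1' a2' a3' a4'"
proof -
  obtain U where U: "\<And>v. T (U v) = v" using surj by metis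
  have b': "b' v w = b (U v) (U w)" for v w using b[of "U v" "U w"] by (simp add: U)
  have om': "om' v w = om (U v) (U w)" for v w using om[of "U v" "U w"] by (simp add: U)
  have j': "j' v = T (j (U v))" for v using j[of "U v"] by (simp add: U)
  have a': "a1' v = a1 (U v)" "a2' v = a2 (U v)" "a3' v = a3 (U v)" "a4' v = a4 (U v)" for v
    using a[of "U v"] by (simp_all add: U)
  show ?thesis
    unfolding ortho_toric_at_def
    unfolding j' a unfolding b' om' a'
    using at unfolding ortho_toric_at_def by blast
qed

text \<open>
  The segment between the two points lies in the box, and the \<open>i\<close>-th coordinate is constant on it.
\<close>

lemma box_one_variable:
  fixes R :: "real^4 \<Rightarrow> real"
  assumes R: "smooth_on (box a b) R" and zero: "\<And>y v. y \<in> box a b \<Longrightarrow> v $ i = 0 \<Longrightarrow> ddir R y v = 0"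
    and y: "y \<in> box a b" "y' \<in> box a b" "y $ i = y' $ i"
  shows "R y = R y'"
proof -
  define f where "f s = R (y' + s *\<^sub>R (y - y'))" for s
  have "(f has_derivative (\<lambda>r. 0)) (at s within {0..1})" if s: "s \<in> {0..1}" for s
  proof -
    have "(1 - s) *\<^sub>R y' + s *\<^sub>R y \<in> box a b"
      using convexD[OF convex_box(2) y(2,1), of "1 - s" s] s by auto
    then have m: "y' + s *\<^sub>R (y - y') \<in> box a b" by (simp add: algebra_simps)
    have d: "((\<lambda>s. y' + s *\<^sub>R (y - y')) has_derivative (\<lambda>r. r *\<^sub>R (y - y'))) (at s)"
      by (auto intro!: derivative_eq_intros)
    have "(f has_derivative (\<lambda>r. ddir R (y' + s *\<^sub>R (y - y')) (r *\<^sub>R (y - y')))) (at s)"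
      unfolding f_def[abs_def] by (rule has_derivative_compose[OF d smooth_on_has_derivative[OF R m]])
    moreover have "ddir R (y' + s *\<^sub>R (y - y')) (r *\<^sub>R (y - y')) = 0" for r
      by (rule zero[OF m]) (simp add: y(3))
    ultimately show ?thesis using has_derivative_at_withinI by simp
  qed
  then obtain k where "\<And>s. s \<in> {0..1} \<Longrightarrow> f s = k"
    using has_derivative_zero_constant[of "{0..1}" f] by auto
  then have "f 0 = f 1" by simp
  then show ?thesis by (simp add: f_def)
qed

lemma box_around:
  fixes y :: "real^4"
  assumes "open U" "y \<in> U"
  obtains e where "e > 0" "box (\<chi> i. y $ i - e) (\<chi> i. y $ i + e) \<subseteq> U"
proof -
  obtain r where r: "r > 0" "ball y r \<subseteq> U" using assms open_contains_ball by blast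
  \<comment> \<open>The Euclidean norm is at most the sum of the absolute values of the four components.\<close>
  have "x \<in> ball y r" if "x \<in> box (\<chi> i. y $ i - r / 4) (\<chi> i. y $ i + r / 4)" for x
  proof -
    have "\<bar>(y - x) $ i\<bar> < r / 4" for i
    proof -
      have "y $ i - r / 4 < x $ i" "x $ i < y $ i + r / 4"
        using that by (simp_all add: mem_box_cart)
      then show ?thesis by (simp only: vector_minus_component)
    qed
    from this[of 1] this[of 2] this[of 3] this[of 4] have "(\<Sum>i\<in>UNIV. \<bar>(y - x) $ i\<bar>) < r"
      by (simp add: sum_4)
    then show ?thesis using norm_le_l1_cart[of "y - x"] by (simp add: dist_norm)
  qed
  then have "box (\<chi> i. y $ i - r / 4) (\<chi> i. y $ i + r / 4) \<subseteq> U" using r(2) by blast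
  then show ?thesis using that[of "r / 4"] r(1) by simp
qed

locale ortho_toric_kaehler_manifold =
  fixes M :: "'a topology" and A :: "'a chart set" and ori and g :: "'a bform" and J :: "'a endo" and \<omega> :: "'a bform"
    and \<xi> \<eta> :: "'a \<Rightarrow> real"
  assumes otk: "ortho_toric_kaehler M A ori g J \<omega> \<xi> \<eta>"
begin

lemma kaehler: "kaehler_surface M A ori g J \<omega>"
  using otk by (simp add: ortho_toric_kaehler_def)

lemma M: "smooth_manifold M A"
  using kaehler by (simp add: kaehler_surface_def)

lemma pos_def: "positive_definite A g"
  using kaehler by (simp add: kaehler_surface_def riemannian_metric_def)

lemma chart: "c \<in> A \<Longrightarrow> chart_on M c"
  using M by (simp add: smooth_manifold_def)

lemma kaehler_chart:
  assumes cA: "c \<in> A"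
  shows "kaehler_chart g c (chart_range c) J"
proof (intro kaehler_chart.intro almost_hermitian_chart.intro riemannian_chart.intro
    almost_hermitian_chart_axioms.intro kaehler_chart_axioms.intro)
  have R: "riemannian_metric A g" and C: "complex_structure M A J"
    and K: "\<And>x v w. x \<in> chart_range c \<Longrightarrow> g c x (J c x v) (J c x w) = g c x v w"
      "\<And>x u v. x \<in> chart_range c \<Longrightarrow> nabla_endo g J c x u v = 0"
    using kaehler cA by (auto simp: kaehler_surface_def)
  show "open (chart_range c)" by (rule open_chart_range[OF chart[OF cA]])
  show "smooth_on (chart_range c) (\<lambda>x. g c x v w)" for v w
    using R cA by (simp add: riemannian_metric_def bform_field_def)
  show "smooth_on (chart_range c) (\<lambda>x. J c x v)" for v
    using C cA by (simp add: complex_structure_def endo_field_def)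
  fix x assume x: "x \<in> chart_range c"
  show "bilinear (g c x)" using R cA x by (simp add: riemannian_metric_def bform_field_def)
  show "g c x v w = g c x w v" for v w using R cA x by (simp add: riemannian_metric_def)
  show "g c x v v > 0" if "v \<noteq> 0" for v using pos_def cA x that by (simp add: positive_definite_def)
  show "linear (J c x)" using C cA x by (simp add: complex_structure_def endo_field_def)
  show "J c x (J c x v) = - v" for v using C cA x by (simp add: complex_structure_def)
  show "g c x (J c x v) (J c x w) = g c x v w" for v w by (rule K(1)[OF x])
  show "nabla_endo g J c x u v = 0" for u v by (rule K(2)[OF x])
qed

lemma \<omega>_eq: "c \<in> A \<Longrightarrow> x \<in> chart_range c \<Longrightarrow> \<omega> c x = (\<lambda>v w. g c x (J c x v) w)"
  using kaehler by (auto simp: kaehler_surface_def fun_eq_iff)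

lemma ortho_toric_kaehler_chart:
  assumes cA: "c \<in> A"
  shows "\<exists>K L. ortho_toric_kaehler_chart g c (chart_range c) J (\<xi> \<circ> chart_inv c) (\<eta> \<circ> chart_inv c) K L"
proof -
  interpret c: kaehler_chart g c "chart_range c" J by (rule kaehler_chart[OF cA])
  let ?X = "\<xi> \<circ> chart_inv c" and ?Y = "\<eta> \<circ> chart_inv c"
  obtain K L where KL: "killing_field A g K" "killing_field A g L" "independent_fields A K L"
    "momentum_map A g J K (\<lambda>p. \<xi> p * \<eta> p)" "momentum_map A g J L (\<lambda>p. \<xi> p + \<eta> p)"
    using otk unfolding ortho_toric_kaehler_def by blast
  have sX: "smooth_on (chart_range c) ?X" and sY: "smooth_on (chart_range c) ?Y"
    using otk cA by (auto simp: ortho_toric_kaehler_def smooth_fun_def)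
  have sf: "smooth_on (chart_range c) ((\<lambda>p. \<xi> p * \<eta> p) \<circ> chart_inv c)" "smooth_on (chart_range c) ((\<lambda>p. \<xi> p + \<eta> p) \<circ> chart_inv c)"
    using KL(4,5) cA by (auto simp: momentum_map_def smooth_fun_def)
  have K: "K c x = J c x (grad g c (\<lambda>p. \<xi> p * \<eta> p) x)" and L: "L c x = J c x (grad g c (\<lambda>p. \<xi> p + \<eta> p) x)"
    if "x \<in> chart_range c" for x
    using KL(4,5) cA that by (auto simp: momentum_map_def)
  have df: "differential c (\<lambda>p. \<xi> p * \<eta> p) x v = ?X x * ddir ?Y x v + ?Y x * ddir ?X x v"
    "differential c (\<lambda>p. \<xi> p + \<eta> p) x v = ddir ?X x v + ddir ?Y x v" if x: "x \<in> chart_range c" for x v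
    using differential_mult[OF sX sY x] differential_add[OF sX sY x] by (simp_all add: differential_eq)
  have "ortho_toric_kaehler_chart g c (chart_range c) J ?X ?Y (K c) (L c)"
  proof (intro ortho_toric_kaehler_chart.intro ortho_toric_kaehler_chart_axioms.intro kaehler_chart[OF cA] sX sY)
    show "smooth_on (chart_range c) (K c)" "smooth_on (chart_range c) (L c)"
      using KL(1,2) cA by (auto simp: killing_field_def vector_field_def)
    fix x assume x: "x \<in> chart_range c"
    show "ddir (\<lambda>x. g c x v w) x (K c x) + g c x (ddir (K c) x v) w + g c x v (ddir (K c) x w) = 0"
      "ddir (\<lambda>x. g c x v w) x (L c x) + g c x (ddir (L c) x v) w + g c x v (ddir (L c) x w) = 0" for v w
      using KL(1,2) cA x by (auto simp: killing_field_def)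
    show "g c x (J c x (K c x)) v = - (?X x * ddir ?Y x v + ?Y x * ddir ?X x v)" for v
      by (simp add: K[OF x] c.J_J[OF x] c.g_simps[OF x] c.grad[OF x sf(1)] df[OF x])
    show "g c x (J c x (L c x)) v = - (ddir ?X x v + ddir ?Y x v)" for v
      by (simp add: L[OF x] c.J_J[OF x] c.g_simps[OF x] c.grad[OF x sf(2)] df[OF x])
    show "a = 0 \<and> b = 0" if "a *\<^sub>R K c x + b *\<^sub>R L c x = 0" for a b
      using KL(3) cA x that unfolding independent_fields_def by blast
    have "poisson_bracket g J \<omega> c (\<lambda>p. \<xi> p * \<eta> p) (\<lambda>p. \<xi> p + \<eta> p) x = 0" and o: "g c x (grad g c \<xi> x) (grad g c \<eta> x) = 0"
      using otk cA x by (auto simp: ortho_toric_kaehler_def)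
    then show "g c x (J c x (K c x)) (L c x) = 0"
      by (simp add: poisson_bracket_def \<omega>_eq[OF cA x] K[OF x, symmetric] L[OF x, symmetric])
    show "g c x u v = 0" if "\<And>w. g c x u w = ddir ?X x w" "\<And>w. g c x v w = ddir ?Y x w" for u v
      using o c.grad_eqI[OF x, of u \<xi>] c.grad_eqI[OF x, of v \<eta>] that by (simp add: differential_eq)
  qed
  then show ?thesis by blast
qed

lemma tensors_change_chart:
  assumes cd: "c \<in> A" "d \<in> A" and x: "x \<in> overlap c d"
  shows "g d (transition c d x) (ddir (transition c d) x v) (ddir (transition c d) x w) = g c x v w"
    "J d (transition c d x) (ddir (transition c d) x v) = ddir (transition c d) x (J c x v)"
    "\<omega> d (transition c d x) (ddir (transition c d) x v) (ddir (transition c d) x w) = \<omega> c x v w"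
proof -
  interpret cd: chart_pair M c d by (rule smooth_manifold_pair[OF M cd])
  have r: "x \<in> chart_range c" "transition c d x \<in> chart_range d"
    using x cd.transition_mem[OF x] overlap_iff[OF cd.c] overlap_iff[OF cd.d] by auto
  show g: "g d (transition c d x) (ddir (transition c d) x v) (ddir (transition c d) x w) = g c x v w" for v w
    using kaehler cd x by (auto simp: kaehler_surface_def riemannian_metric_def bform_field_def)
  show j: "J d (transition c d x) (ddir (transition c d) x v) = ddir (transition c d) x (J c x v)" for v
    using kaehler cd x by (auto simp: kaehler_surface_def complex_structure_def endo_field_def)
  show "\<omega> d (transition c d x) (ddir (transition c d) x v) (ddir (transition c d) x w) = \<omega> c x v w"
    unfolding \<omega>_eq[OF cd(1) r(1)] \<omega>_eq[OF cd(2) r(2)] j g ..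
qed

text \<open>
  The domain \<open>W\<close> is a box in the coordinates \<open>(\<xi>, \<eta>, t, z)\<close>. There the functions \<open>P\<close> and \<open>Q\<close>, whose
  derivatives vanish on the kernels of \<open>d\<xi>\<close> and \<open>d\<eta>\<close>, are functions of \<open>\<xi>\<close> and of \<open>\<eta>\<close>, and their
  restrictions to the coordinate lines through \<open>p\<close> are \<open>F\<close> and \<open>G\<close>.
\<close>

lemma local_form:
  assumes p: "p \<in> topspace M"
  shows "\<exists>W t z F G. p \<in> W \<and> ortho_toric_form M A g J \<omega> W \<xi> \<eta> t z F G"
proof -
  obtain c where cA: "c \<in> A" and pc: "p \<in> fst c"
    using M p unfolding smooth_manifold_def by blast
  have c: "chart_on M c" by (rule chart[OF cA])
  let ?X = "\<xi> \<circ> chart_inv c" and ?Y = "\<eta> \<circ> chart_inv c"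
  obtain K L where "ortho_toric_kaehler_chart g c (chart_range c) J ?X ?Y K L"
    using ortho_toric_kaehler_chart[OF cA] by blast
  then interpret c: ortho_toric_kaehler_chart g c "chart_range c" J ?X ?Y K L .
  have x0: "snd c p \<in> chart_range c" using pc by (auto simp: chart_range_def)
  obtain r where r: "r > 0" "ball (snd c p) r \<subseteq> chart_range c"
    using c.open_S x0 open_contains_ball by blast
  define B where "B = ball (snd c p) r"
  have B: "open B" "convex B" "snd c p \<in> B" "B \<subseteq> chart_range c" using r by (auto simp: B_def)
  have BS: "x \<in> B \<Longrightarrow> x \<in> chart_range c" for x using B(4) by blast
  obtain t0 where t0: "smooth_on B t0" "\<And>x. x \<in> B \<Longrightarrow> ddir t0 x = c.\<tau>t x"
    by (rule poincare_lemma[OF B(1,2), of c.\<tau>t])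
      (use c.linear_\<tau>(2) c.closed_coframe(2) BS smooth_on_subset[OF c.smooth_\<tau>(2) B(4)] in blast)+
  obtain z0 where z0: "smooth_on B z0" "\<And>x. x \<in> B \<Longrightarrow> ddir z0 x = c.\<tau>z x"
    by (rule poincare_lemma[OF B(1,2), of c.\<tau>z])
      (use c.linear_\<tau>(1) c.closed_coframe(1) BS smooth_on_subset[OF c.smooth_\<tau>(1) B(4)] in blast)+
  define t where "t q = t0 (snd c q)" for q
  define z where "z q = z0 (snd c q)" for q
  define k where "k q = (vector [\<xi> q, \<eta> q, t q, z q] :: real^4)" for q
  have tc: "(t \<circ> chart_inv c) x = t0 x" and zc: "(z \<circ> chart_inv c) x = z0 x" if "x \<in> B" for x
    using chart_range_imp[OF BS[OF that]] by (simp_all add: t_def z_def)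
  have kc: "(k \<circ> chart_inv c) x = vector [?X x, ?Y x, t0 x, z0 x]" if "x \<in> B" for x
    using tc[OF that] zc[OF that] by (simp add: k_def)
  have sB: "smooth_on B ?X" "smooth_on B ?Y"
    using smooth_on_subset[OF _ B(4)] c.sX c.sY by blast+
  have smk: "smooth_on B (k \<circ> chart_inv c)"
    by (rule smooth_on_cong[OF B(1) smooth_on_vector_4[OF B(1) sB(1) sB(2) t0(1) z0(1)] kc[symmetric]])
  have dk: "ddir (k \<circ> chart_inv c) x v = vector [ddir ?X x v, ddir ?Y x v, c.\<tau>t x v, c.\<tau>z x v]" if "x \<in> B" for x v
  proof -
    have "ddir (k \<circ> chart_inv c) x = ddir (\<lambda>x. vector [?X x, ?Y x, t0 x, z0 x] :: real^4) x"
      by (rule ddir_cong[OF B(1) that kc])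
    then show ?thesis
      by (simp only: ddir_vector_4[OF sB(1) sB(2) t0(1) z0(1) that] t0(2)[OF that] z0(2)[OF that])
  qed
  obtain W0 where W0: "p \<in> W0" "W0 \<subseteq> fst c" "snd c ` W0 \<subseteq> B" "smooth_chart M A (W0, k)"
  proof (rule smooth_chart_from_functions[OF M cA pc B(3,1,4) smk])
    fix v assume "ddir (k \<circ> chart_inv c) (snd c p) v = 0"
    then have "ddir ?X (snd c p) v = 0" "ddir ?Y (snd c p) v = 0" and \<tau>: "c.\<tau>t (snd c p) v = 0" "c.\<tau>z (snd c p) v = 0"
      unfolding dk[OF B(3)] by (simp_all add: vec_eq_iff forall_4)
    then have "c.\<sigma>z (snd c p) v = 0" "c.\<sigma>t (snd c p) v = 0" by (simp_all add: c.\<sigma>z_def c.\<sigma>t_def)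
    then show "v = 0" using c.coframe_separating[OF x0 \<tau>(2,1)] by blast
  qed
  have h0: "chart_on M (W0, k)" using W0(4) by (simp add: smooth_chart_def)
  have kp: "k p \<in> k ` W0" using W0(1) by blast
  have "open (k ` W0)" using open_chart_range[OF h0] by (simp add: chart_range_def)
  then obtain e where e: "e > 0" "box (\<chi> i. k p $ i - e) (\<chi> i. k p $ i + e) \<subseteq> k ` W0"
    using box_around[OF _ kp] by blast
  let ?lo = "(\<chi> i. k p $ i - e) :: real^4" and ?hi = "(\<chi> i. k p $ i + e) :: real^4"
  define C where "C = box ?lo ?hi"
  have C: "y \<in> C \<longleftrightarrow> (\<forall>i. k p $ i - e < y $ i \<and> y $ i < k p $ i + e)" for y
    by (simp add: C_def mem_box_cart)
  have oC: "open C" by (simp add: C_def open_box)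
  define W where "W = {q \<in> W0. k q \<in> C}"
  have W: "openin M W" "W \<subseteq> W0"
    using openin_chart_vimage[OF h0 oC] by (auto simp: W_def)
  have pW: "p \<in> W" using W0(1) e(1) by (simp add: W_def C)
  have kW: "k ` W = C" using e(2) by (force simp: W_def C_def)
  have hW: "smooth_chart M A (W, k)"
    using smooth_chart_restrict[OF chart W0(4) W(1)] W(2) by simp
  have chW: "chart_on M (W, k)" using hW by (simp add: smooth_chart_def)
  interpret ch: chart_pair M c "(W, k)" by (rule smooth_chart_pair[OF M cA hW])
  interpret hc: chart_pair M "(W, k)" c by (rule chart_pair_sym) unfold_locales
  have Wc: "q \<in> fst c" "snd c q \<in> B" if "q \<in> W" for q using that W(2) W0(2,3) by auto
  have ov: "overlap (W, k) c = C" using Wc kW by (auto simp: overlap_def)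
  let ?\<psi> = "transition (W, k) c"
  have s\<psi>: "smooth_on C ?\<psi>" using hc.comp by (simp add: compatible_def ov)
  have \<psi>k: "?\<psi> (k q) = snd c q" if "q \<in> W" for q
    using transition_chart[OF chW, of q c] that by simp
  have \<psi>B: "?\<psi> y \<in> B" and \<psi>X: "?X (?\<psi> y) = y $ 1" "?Y (?\<psi> y) = y $ 2" if yC: "y \<in> C" for y
  proof -
    obtain q where q: "q \<in> W" "y = k q" using yC kW by blast
    show "?\<psi> y \<in> B" using \<psi>k[OF q(1)] Wc[OF q(1)] q(2) by simp
    show "?X (?\<psi> y) = y $ 1" "?Y (?\<psi> y) = y $ 2"
      using \<psi>k[OF q(1)] Wc[OF q(1)] q(2) c by (simp_all add: k_def)
  qed
  have d\<psi>: "ddir (\<lambda>y. f (?\<psi> y)) y v = ddir f (?\<psi> y) (ddir ?\<psi> y v)" if "y \<in> C" "smooth_on (chart_range c) f" for f :: "real^4 \<Rightarrow> real" and y v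
    using ddir_eqI[OF has_derivative_compose[OF smooth_on_has_derivative[OF s\<psi> that(1)]
          smooth_on_has_derivative[OF that(2) BS[OF \<psi>B[OF that(1)]]]]] by simp
  have nth: "ddir (\<lambda>y. y $ i) y v = v $ i" for y v :: "real^4" and i
    using ddir_eqI[OF bounded_linear.has_derivative[OF bounded_linear_vec_nth has_derivative_ident]] by simp
  have dX\<psi>: "ddir ?X (?\<psi> y) (ddir ?\<psi> y v) = v $ 1" "ddir ?Y (?\<psi> y) (ddir ?\<psi> y v) = v $ 2" if y: "y \<in> C" for y v
    unfolding d\<psi>[OF y c.sX, symmetric] d\<psi>[OF y c.sY, symmetric]
    using ddir_cong[OF oC y \<psi>X(1)] ddir_cong[OF oC y \<psi>X(2)] nth by simp_all
  define RP where "RP y = c.P (?\<psi> y)" for y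
  define RQ where "RQ y = c.Q (?\<psi> y)" for y
  have imB: "?\<psi> ` C \<subseteq> chart_range c" using \<psi>B BS by blast
  have sR: "smooth_on C RP" "smooth_on C RQ"
    unfolding RP_def[abs_def] RQ_def[abs_def]
    using smooth_on_compose[OF oC c.smooth_PQ(1) s\<psi> imB] smooth_on_compose[OF oC c.smooth_PQ(2) s\<psi> imB] by simp_all
  have RP: "RP y = RP y'" if "y \<in> C" "y' \<in> C" "y $ 1 = y' $ 1" for y y'
  proof (rule box_one_variable[of ?lo ?hi RP 1])
    show "ddir RP y v = 0" if "y \<in> box ?lo ?hi" "v $ 1 = 0" for y v
      using that c.PQ_one_variable(1)[OF BS[OF \<psi>B], of y] dX\<psi>(1)[of y v] d\<psi>[OF _ c.smooth_PQ(1), of y v]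
      unfolding RP_def[abs_def] C_def[symmetric] by simp
  qed (use that sR in \<open>simp_all add: C_def\<close>)
  have RQ: "RQ y = RQ y'" if "y \<in> C" "y' \<in> C" "y $ 2 = y' $ 2" for y y'
  proof (rule box_one_variable[of ?lo ?hi RQ 2])
    show "ddir RQ y v = 0" if "y \<in> box ?lo ?hi" "v $ 2 = 0" for y v
      using that c.PQ_one_variable(2)[OF BS[OF \<psi>B], of y] dX\<psi>(2)[of y v] d\<psi>[OF _ c.smooth_PQ(2), of y v]
      unfolding RQ_def[abs_def] C_def[symmetric] by simp
  qed (use that sR in \<open>simp_all add: C_def\<close>)
  define F where "F s = RP (vector [s, \<eta> p, t p, z p])" for s
  define G where "G s = RQ (vector [\<xi> p, s, t p, z p])" for s
  have kp': "k p $ 1 = \<xi> p" "k p $ 2 = \<eta> p" "k p $ 3 = t p" "k p $ 4 = z p" by (simp_all add: k_def)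
  have line: "vector [s, \<eta> p, t p, z p] \<in> C \<longleftrightarrow> s \<in> {\<xi> p - e<..<\<xi> p + e}"
    "vector [\<xi> p, s, t p, z p] \<in> C \<longleftrightarrow> s \<in> {\<eta> p - e<..<\<eta> p + e}" for s
    using e(1) by (auto simp: C forall_4 kp')
  have rng: "\<xi> ` W \<subseteq> {\<xi> p - e<..<\<xi> p + e}" "\<eta> ` W \<subseteq> {\<eta> p - e<..<\<eta> p + e}"
    by (auto simp: W_def C forall_4 k_def)
  have FG: "F (\<xi> q) = c.P (snd c q)" "G (\<eta> q) = c.Q (snd c q)" if q: "q \<in> W" for q
  proof -
    have kq: "k q \<in> C" using q by (simp add: W_def)
    have "F (\<xi> q) = RP (k q)"
      unfolding F_def by (rule RP[OF _ kq]) (use line(1) rng(1) q in \<open>auto simp: k_def\<close>)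
    then show "F (\<xi> q) = c.P (snd c q)" by (simp add: RP_def \<psi>k[OF q])
    have "G (\<eta> q) = RQ (k q)"
      unfolding G_def by (rule RQ[OF _ kq]) (use line(2) rng(2) q in \<open>auto simp: k_def\<close>)
    then show "G (\<eta> q) = c.Q (snd c q)" by (simp add: RQ_def \<psi>k[OF q])
  qed
  have "(\<lambda>s. vector [s, \<eta> p, t p, z p] :: real^4) ` {\<xi> p - e<..<\<xi> p + e} \<subseteq> C"
    using line(1) by (simp add: image_subset_iff)
  then have "smooth_on {\<xi> p - e<..<\<xi> p + e} F"
    unfolding F_def[abs_def]
    by (rule smooth_on_compose[OF open_greaterThanLessThan sR(1), rotated])
      (intro smooth_on_vector_4 smooth_on_ident smooth_on_const open_greaterThanLessThan)
  then have sF: "smooth_on (\<xi> ` W) F" using rng(1) by (rule smooth_on_subset)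
  have "(\<lambda>s. vector [\<xi> p, s, t p, z p] :: real^4) ` {\<eta> p - e<..<\<eta> p + e} \<subseteq> C"
    using line(2) by (simp add: image_subset_iff)
  then have "smooth_on {\<eta> p - e<..<\<eta> p + e} G"
    unfolding G_def[abs_def]
    by (rule smooth_on_compose[OF open_greaterThanLessThan sR(2), rotated])
      (intro smooth_on_vector_4 smooth_on_ident smooth_on_const open_greaterThanLessThan)
  then have sG: "smooth_on (\<eta> ` W) G" using rng(2) by (rule smooth_on_subset)
  have "ortho_toric_form M A g J \<omega> W \<xi> \<eta> t z F G"
    unfolding ortho_toric_form_iff
  proof (intro conjI ballI sF sG)
    show "smooth_chart M A (W, \<lambda>p. vector [\<xi> p, \<eta> p, t p, z p])"
      using hW by (simp add: k_def[abs_def])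
    show "\<xi> q \<noteq> \<eta> q" "F (\<xi> q) \<noteq> 0" "G (\<eta> q) \<noteq> 0" if q: "q \<in> W" for q
      using c.XY[OF BS[OF Wc(2)[OF q]]] c.PQ[OF BS[OF Wc(2)[OF q]]] FG[OF q] Wc(1)[OF q] c by simp_all
    fix d q assume dA: "d \<in> A" and q: "q \<in> fst d \<inter> W"
    then have qW: "q \<in> W" and qd: "q \<in> fst d" by auto
    define x where "x = snd c q"
    interpret cd: chart_pair M c d by (rule smooth_manifold_pair[OF M cA dA])
    interpret dc: chart_pair M d c by (rule smooth_manifold_pair[OF M dA cA])
    have xB: "x \<in> B" using Wc(2)[OF qW] by (simp add: x_def)
    have xo: "x \<in> overlap c d" using Wc(1)[OF qW] qd by (auto simp: x_def overlap_def)
    have tr: "transition c d x = snd d q" using c Wc(1)[OF qW] by (simp add: x_def)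
    have tr': "transition d c (snd d q) = x" using transition_chart[OF cd.d qd, of c] by (simp add: x_def)
    have qo: "snd d q \<in> overlap d c" using Wc(1)[OF qW] qd by (auto simp: overlap_def)
    let ?T = "ddir (transition c d) x"
    have surj: "\<exists>u. ?T u = v" for v
      using dc.ddir_transition_inverse[OF qo, of v] unfolding tr' by blast
    have dif: "differential d f (snd d q) (?T v) = ddir (f \<circ> chart_inv c) x v"
      if f: "smooth_on B (f \<circ> chart_inv c)" for f v
    proof -
      have "(f \<circ> chart_inv d has_derivative (\<lambda>v. ddir (f \<circ> chart_inv c) x (ddir (transition d c) (snd d q) v))) (at (snd d q))"
        using dc.has_derivative_change_chart[OF qo] smooth_on_has_derivative[OF f xB] unfolding tr' by blast
      then show ?thesis
        using cd.ddir_transition_inverse[OF xo, of v] unfolding tr by (simp add: differential_eq ddir_eqI)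
    qed
    have "ddir (t \<circ> chart_inv c) x = ddir t0 x" "ddir (z \<circ> chart_inv c) x = ddir z0 x"
      by (intro ddir_cong[OF B(1) xB] tc zc; assumption)+
    then have "ddir (t \<circ> chart_inv c) x = c.\<tau>t x" "ddir (z \<circ> chart_inv c) x = c.\<tau>z x"
      by (simp_all add: t0(2)[OF xB] z0(2)[OF xB])
    moreover have "smooth_on B (t \<circ> chart_inv c)"
      by (rule smooth_on_cong[OF B(1) t0(1)]) (simp only: tc)
    moreover have "smooth_on B (z \<circ> chart_inv c)"
      by (rule smooth_on_cong[OF B(1) z0(1)]) (simp only: zc)
    ultimately have dd: "differential d \<xi> (snd d q) (?T v) = ddir ?X x v" "differential d \<eta> (snd d q) (?T v) = ddir ?Y x v"
      "differential d t (snd d q) (?T v) = c.\<tau>t x v" "differential d z (snd d q) (?T v) = c.\<tau>z x v" for v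
      using dif[OF sB(1)] dif[OF sB(2)] dif[of t] dif[of z] by simp_all
    have v: "\<xi> q = ?X x" "\<eta> q = ?Y x" "F (\<xi> q) = c.P x" "G (\<eta> q) = c.Q x"
      using FG[OF qW] Wc(1)[OF qW] c by (simp_all add: x_def)
    note tensors = tensors_change_chart[OF cA dA xo, unfolded tr]
    show "ortho_toric_at (g d (snd d q)) (J d (snd d q)) (\<omega> d (snd d q)) (\<xi> q) (\<eta> q) (F (\<xi> q)) (G (\<eta> q))
        (differential d \<xi> (snd d q)) (differential d \<eta> (snd d q)) (differential d t (snd d q)) (differential d z (snd d q))"
      unfolding v(3,4) unfolding v(1,2)
      by (rule ortho_toric_at_transfer[OF c.ortho_toric_formulas[OF BS[OF xB]] surj tensors(1,2) _ dd])
        (simp only: tensors(3), simp only: \<omega>_eq[OF cA BS[OF xB]])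
  qed
  then show ?thesis using pW by blast
qed

subsection \<open>Uniqueness of the coordinates\<close>

lemma form_translate:
  assumes form: "ortho_toric_form M A g J \<omega> W \<xi> \<eta> t z F G"
    and t': "\<And>q. q \<in> W \<Longrightarrow> t' q = t q + a" and z': "\<And>q. q \<in> W \<Longrightarrow> z' q = z q + b"
  shows "ortho_toric_form M A g J \<omega> W \<xi> \<eta> t' z' F G"
proof -
  note form' = form[unfolded ortho_toric_form_iff]
  have h: "smooth_chart M A (W, \<lambda>p. vector [\<xi> p, \<eta> p, t p, z p])" using form' by blast
  have h': "smooth_chart M A (W, \<lambda>p. vector [\<xi> p, \<eta> p, t' p, z' p])"
    by (rule smooth_chart_translate[OF chart h, where a = "vector [0, 0, a, b]"])
      (simp_all add: vec_eq_iff forall_4 t' z')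
  have dif: "differential c f' (snd c q) = differential c f (snd c q)"
    if cA: "c \<in> A" and q: "q \<in> fst c \<inter> W" and f': "\<And>q. q \<in> W \<Longrightarrow> f' q = f q + m"
      and sf: "smooth_on (overlap c (W, \<lambda>p. vector [\<xi> p, \<eta> p, t p, z p])) (f \<circ> chart_inv c)" for c f f' q and m :: real
  proof -
    have o: "open (overlap c (W, \<lambda>p. vector [\<xi> p, \<eta> p, t p, z p]))"
      by (rule coordinate_functions(1)[OF M cA h])
    have qo: "snd c q \<in> overlap c (W, \<lambda>p. vector [\<xi> p, \<eta> p, t p, z p])"
      using q by (auto simp: overlap_def)
    have "ddir (f' \<circ> chart_inv c) (snd c q) = ddir (\<lambda>x. (f \<circ> chart_inv c) x + m) (snd c q)"
      by (rule ddir_cong[OF o qo]) (use overlap_iff[OF chart[OF cA]] f' in auto)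
    then show ?thesis
      using ddir_eqI[OF has_derivative_add[OF smooth_on_has_derivative[OF sf qo] has_derivative_const[of m]]]
      by (simp add: differential_eq)
  qed
  show ?thesis
    unfolding ortho_toric_form_iff
  proof (intro conjI ballI h')
    fix c q assume cA: "c \<in> A" and q: "q \<in> fst c \<inter> W"
    note co = coordinate_functions[OF M cA h]
    have "differential c t' (snd c q) = differential c t (snd c q)" "differential c z' (snd c q) = differential c z (snd c q)"
      using dif[OF cA q _ co(4), of t' a] dif[OF cA q _ co(5), of z' b] t' z' by auto
    then show "ortho_toric_at (g c (snd c q)) (J c (snd c q)) (\<omega> c (snd c q)) (\<xi> q) (\<eta> q) (F (\<xi> q)) (G (\<eta> q))
        (differential c \<xi> (snd c q)) (differential c \<eta> (snd c q)) (differential c t' (snd c q)) (differential c z' (snd c q))"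
      using form' cA q by simp
  qed (use form' in blast)+
qed

text \<open>
  By the formulas for \<open>J d\<xi>\<close> and \<open>J d\<eta>\<close> the forms \<open>dt + \<eta> dz\<close> and \<open>dt + \<xi> dz\<close> have the same kernels in both
  coordinate systems, hence the coordinate fields \<open>\<partial>/\<partial>\<xi>\<close> and \<open>\<partial>/\<partial>\<eta>\<close> are the same. Their square lengths
  \<open>(\<xi> - \<eta>) / F\<close> and \<open>(\<eta> - \<xi>) / G\<close> determine \<open>F\<close> and \<open>G\<close>, after which \<open>J d\<xi>\<close> and \<open>J d\<eta>\<close> determine the
  two forms themselves.
\<close>

lemma differentials_unique:
  assumes form: "ortho_toric_form M A g J \<omega> W \<xi> \<eta> t z F G" and form': "ortho_toric_form M A g J \<omega> W \<xi> \<eta> t' z' F' G'"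
    and cA: "c \<in> A" and x: "x \<in> snd c ` (fst c \<inter> W)"
  shows "ddir (t \<circ> chart_inv c) x = ddir (t' \<circ> chart_inv c) x" "ddir (z \<circ> chart_inv c) x = ddir (z' \<circ> chart_inv c) x"
proof -
  let ?S = "snd c ` (fst c \<inter> W)"
  let ?X = "\<xi> \<circ> chart_inv c" and ?Y = "\<eta> \<circ> chart_inv c"
  have S: "overlap c (W, k) = ?S" for k by (simp add: overlap_def)
  interpret o1: ortho_toric_chart g c ?S J \<omega> ?X ?Y "t \<circ> chart_inv c" "z \<circ> chart_inv c" "\<lambda>x. F (?X x)" "\<lambda>x. G (?Y x)"
    using ortho_toric_chart_of_form[OF M cA form pos_def] by (simp only: S)
  interpret o2: ortho_toric_chart g c ?S J \<omega> ?X ?Y "t' \<circ> chart_inv c" "z' \<circ> chart_inv c" "\<lambda>x. F' (?X x)" "\<lambda>x. G' (?Y x)"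
    using ortho_toric_chart_of_form[OF M cA form' pos_def] by (simp only: S)
  have D: "?X x - ?Y x \<noteq> 0" using o1.XY[OF x] by simp
  note nz = o1.P0[OF x] o1.Q0[OF x] o2.P0[OF x] o2.Q0[OF x]
  let ?\<theta> = "\<lambda>v. ddir (t \<circ> chart_inv c) x v + ?Y x * ddir (z \<circ> chart_inv c) x v"
  let ?\<phi> = "\<lambda>v. ddir (t \<circ> chart_inv c) x v + ?X x * ddir (z \<circ> chart_inv c) x v"
  let ?\<theta>' = "\<lambda>v. ddir (t' \<circ> chart_inv c) x v + ?Y x * ddir (z' \<circ> chart_inv c) x v"
  let ?\<phi>' = "\<lambda>v. ddir (t' \<circ> chart_inv c) x v + ?X x * ddir (z' \<circ> chart_inv c) x v"
  have J1: "F (?X x) / (?X x - ?Y x) * ?\<theta> v = F' (?X x) / (?X x - ?Y x) * ?\<theta>' v"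
    "G (?Y x) / (?X x - ?Y x) * ?\<phi> v = G' (?Y x) / (?X x - ?Y x) * ?\<phi>' v" for v
    using o1.form_J(1,2)[OF x, of v] o2.form_J(1,2)[OF x, of v] by linarith+
  have vertical: "?\<theta> v = 0 \<longleftrightarrow> ?\<theta>' v = 0" "?\<phi> v = 0 \<longleftrightarrow> ?\<phi>' v = 0" for v
    using J1[of v] D nz by (metis divide_eq_0_iff mult_eq_0_iff)+
  obtain E1 where "\<forall>x\<in>?S. ddir ?X x (E1 x) = 1 \<and> ddir ?Y x (E1 x) = 0 \<and> ddir (t \<circ> chart_inv c) x (E1 x) = 0 \<and> ddir (z \<circ> chart_inv c) x (E1 x) = 0"
    using o1.coordinate_field[of 1 0 0 0] by blast
  from bspec[OF this x] have E1: "ddir ?X x (E1 x) = 1" "ddir ?Y x (E1 x) = 0" "?\<theta> (E1 x) = 0" "?\<phi> (E1 x) = 0"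
    by simp_all
  obtain E2 where "\<forall>x\<in>?S. ddir ?X x (E2 x) = 0 \<and> ddir ?Y x (E2 x) = 1 \<and> ddir (t \<circ> chart_inv c) x (E2 x) = 0 \<and> ddir (z \<circ> chart_inv c) x (E2 x) = 0"
    using o1.coordinate_field[of 0 1 0 0] by blast
  from bspec[OF this x] have E2: "ddir ?X x (E2 x) = 0" "ddir ?Y x (E2 x) = 1" "?\<theta> (E2 x) = 0" "?\<phi> (E2 x) = 0"
    by simp_all
  have E': "?\<theta>' (E1 x) = 0" "?\<phi>' (E1 x) = 0" "?\<theta>' (E2 x) = 0" "?\<phi>' (E2 x) = 0"
    using vertical E1(3,4) E2(3,4) by blast+
  have "(?X x - ?Y x) * (1 / F (?X x)) = (?X x - ?Y x) * (1 / F' (?X x))"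
    using o1.form_g[OF x, of "E1 x" "E1 x"] o2.form_g[OF x, of "E1 x" "E1 x"]
    unfolding E1(3,4) E'(1,2) unfolding E1(1,2) by auto
  then have F: "F (?X x) = F' (?X x)" using D nz by simp
  have "(?X x - ?Y x) * (1 / G (?Y x)) = (?X x - ?Y x) * (1 / G' (?Y x))"
    using o1.form_g[OF x, of "E2 x" "E2 x"] o2.form_g[OF x, of "E2 x" "E2 x"]
    unfolding E2(3,4) E'(3,4) unfolding E2(1,2) by auto
  then have G: "G (?Y x) = G' (?Y x)" using D nz by simp
  have e: "?\<theta> v = ?\<theta>' v" "?\<phi> v = ?\<phi>' v" for v
    using J1[of v] D nz unfolding F G by simp_all
  have "(?X x - ?Y x) * (ddir (z \<circ> chart_inv c) x v - ddir (z' \<circ> chart_inv c) x v) = 0" for v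
    using e[of v] by algebra
  then have z: "ddir (z \<circ> chart_inv c) x v = ddir (z' \<circ> chart_inv c) x v" for v using D by simp
  then show "ddir (z \<circ> chart_inv c) x = ddir (z' \<circ> chart_inv c) x" by blast
  show "ddir (t \<circ> chart_inv c) x = ddir (t' \<circ> chart_inv c) x" using e(1) z by (simp add: fun_eq_iff)
qed

text \<open>
  The difference has derivative zero in every chart, so that its level sets are open.
\<close>

lemma constant_difference:
  fixes f f' :: "'a \<Rightarrow> real"
  assumes conn: "connectedin M W" and W: "openin M W"
    and s: "\<And>c. c \<in> A \<Longrightarrow> smooth_on (snd c ` (fst c \<inter> W)) (f \<circ> chart_inv c)" "\<And>c. c \<in> A \<Longrightarrow> smooth_on (snd c ` (fst c \<inter> W)) (f' \<circ> chart_inv c)"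
    and d: "\<And>c x. c \<in> A \<Longrightarrow> x \<in> snd c ` (fst c \<inter> W) \<Longrightarrow> ddir (f \<circ> chart_inv c) x = ddir (f' \<circ> chart_inv c) x"
  shows "\<exists>a. \<forall>q\<in>W. f' q = f q + a"
proof (cases "W = {}")
  case True
  then show ?thesis by blast
next
  case False
  then obtain p where p: "p \<in> W" by blast
  define h where "h q = f' q - f q" for q
  have loc: "\<exists>U. openin M U \<and> q \<in> U \<and> U \<subseteq> W \<and> (\<forall>r\<in>U. h r = h q)" if q: "q \<in> W" for q
  proof -
    have "q \<in> topspace M" using q openin_subset[OF W] by blast
    then obtain c where cA: "c \<in> A" and qc: "q \<in> fst c"
      using M unfolding smooth_manifold_def by blast
    have c: "chart_on M c" by (rule chart[OF cA])
    have "open (snd c ` (fst c \<inter> W))"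
      by (rule open_chart_image[OF c openin_Int[OF openin_chart_domain[OF c] W]]) simp
    moreover have "snd c q \<in> snd c ` (fst c \<inter> W)" using q qc by blast
    ultimately obtain e where e: "e > 0" "ball (snd c q) e \<subseteq> snd c ` (fst c \<inter> W)"
      using open_contains_ball by blast
    let ?B = "ball (snd c q) e"
    have "((\<lambda>x. (f' \<circ> chart_inv c) x - (f \<circ> chart_inv c) x) has_derivative (\<lambda>v. 0)) (at x within ?B)" if "x \<in> ?B" for x
    proof -
      have x: "x \<in> snd c ` (fst c \<inter> W)" using that e(2) by blast
      have "((\<lambda>x. (f' \<circ> chart_inv c) x - (f \<circ> chart_inv c) x) has_derivative
          (\<lambda>v. ddir (f' \<circ> chart_inv c) x v - ddir (f \<circ> chart_inv c) x v)) (at x)"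
        by (intro has_derivative_diff smooth_on_has_derivative[OF s(1)[OF cA] x] smooth_on_has_derivative[OF s(2)[OF cA] x])
      then show ?thesis using d[OF cA x] has_derivative_at_withinI by simp
    qed
    then obtain m where m: "\<And>x. x \<in> ?B \<Longrightarrow> (f' \<circ> chart_inv c) x - (f \<circ> chart_inv c) x = m"
      using has_derivative_zero_constant[OF convex_ball, of "snd c q" e "\<lambda>x. (f' \<circ> chart_inv c) x - (f \<circ> chart_inv c) x"] by blast
    have m': "h r = m" if "r \<in> fst c" "snd c r \<in> ?B" for r
      using m[OF that(2)] that(1) c by (simp add: h_def)
    define U where "U = {r \<in> fst c. snd c r \<in> ?B}"
    have "openin M U" unfolding U_def by (rule openin_chart_vimage[OF c]) simp
    moreover have "q \<in> U" using qc e(1) by (simp add: U_def)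
    moreover have "U \<subseteq> W"
    proof
      fix r assume "r \<in> U"
      then obtain r' where "r \<in> fst c" "r' \<in> fst c \<inter> W" "snd c r = snd c r'" using e(2) by (auto simp: U_def)
      then show "r \<in> W" using inj_onD[OF inj_on_chart[OF c]] by blast
    qed
    moreover have "\<forall>r\<in>U. h r = h q" using m' \<open>q \<in> U\<close> by (auto simp: U_def)
    ultimately show ?thesis by blast
  qed
  have o1: "openin M {q \<in> W. h q = h p}"
    unfolding openin_subopen[of M "{q \<in> W. h q = h p}"]
  proof
    fix q assume q: "q \<in> {q \<in> W. h q = h p}"
    then obtain U where U: "openin M U" "q \<in> U" "U \<subseteq> W" "\<And>r. r \<in> U \<Longrightarrow> h r = h q" using loc[of q] by blast
    have "U \<subseteq> {q \<in> W. h q = h p}"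
      using q U(3,4) by (simp add: subset_iff)
    then show "\<exists>T. openin M T \<and> q \<in> T \<and> T \<subseteq> {q \<in> W. h q = h p}"
      using U(1,2) by blast
  qed
  have o2: "openin M {q \<in> W. h q \<noteq> h p}"
    unfolding openin_subopen[of M "{q \<in> W. h q \<noteq> h p}"]
  proof
    fix q assume q: "q \<in> {q \<in> W. h q \<noteq> h p}"
    then obtain U where U: "openin M U" "q \<in> U" "U \<subseteq> W" "\<And>r. r \<in> U \<Longrightarrow> h r = h q" using loc[of q] by blast
    have "U \<subseteq> {q \<in> W. h q \<noteq> h p}"
      using q U(3,4) by (simp add: subset_iff)
    then show "\<exists>T. openin M T \<and> q \<in> T \<and> T \<subseteq> {q \<in> W. h q \<noteq> h p}"
      using U(1,2) by blast
  qed
  have "{q \<in> W. h q \<noteq> h p} \<inter> W = {}"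
  proof (rule ccontr)
    assume n: "{q \<in> W. h q \<noteq> h p} \<inter> W \<noteq> {}"
    have "W \<subseteq> {q \<in> W. h q = h p} \<union> {q \<in> W. h q \<noteq> h p}" "{q \<in> W. h q = h p} \<inter> {q \<in> W. h q \<noteq> h p} \<inter> W = {}"
      "{q \<in> W. h q = h p} \<inter> W \<noteq> {}" using p by auto
    then show False using conn o1 o2 n unfolding connectedin by meson
  qed
  then have "h q = h p" if "q \<in> W" for q using that by blast
  then have "f' q = f q + h p" if "q \<in> W" for q
    using that by (simp add: h_def algebra_simps)
  then show ?thesis by blast
qed

lemma coordinates_unique:
  assumes conn: "connectedin M W" and form: "ortho_toric_form M A g J \<omega> W \<xi> \<eta> t z F G"
    and form': "ortho_toric_form M A g J \<omega> W \<xi> \<eta> t' z' F' G'"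
  shows "\<exists>a b. \<forall>q\<in>W. t' q = t q + a \<and> z' q = z q + b"
proof -
  have h: "smooth_chart M A (W, \<lambda>p. vector [\<xi> p, \<eta> p, t p, z p])" "smooth_chart M A (W, \<lambda>p. vector [\<xi> p, \<eta> p, t' p, z' p])"
    using form form' unfolding ortho_toric_form_iff by blast+
  have W: "openin M W" using h(1) openin_chart_domain by (fastforce simp: smooth_chart_def)
  have S: "overlap c (W, k) = snd c ` (fst c \<inter> W)" for c :: "'a chart" and k by (simp add: overlap_def)
  note s = coordinate_functions(4,5)[OF M _ h(1), unfolded S] coordinate_functions(4,5)[OF M _ h(2), unfolded S]
  note d = differentials_unique[OF form form']
  have "\<exists>a. \<forall>q\<in>W. t' q = t q + a"
    by (rule constant_difference[OF conn W s(1) s(3) d(1)])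
  moreover have "\<exists>b. \<forall>q\<in>W. z' q = z q + b"
    by (rule constant_difference[OF conn W s(2) s(4) d(2)])
  ultimately show ?thesis by blast
qed

end

theorem proposition8:
  fixes M :: "'a topology" and A :: "'a chart set"
  assumes "smooth_manifold M A"
  shows
    "(\<forall>g J \<omega> \<xi> \<eta> t z F G.
        ortho_toric_form M A g J \<omega> (topspace M) \<xi> \<eta> t z F G \<and> positive_definite A g \<longrightarrow>
        (\<exists>ori. ortho_toric_kaehler M A ori g J \<omega> \<xi> \<eta>)) \<and>
     (\<forall>ori g J \<omega> \<xi> \<eta>.
        ortho_toric_kaehler M A ori g J \<omega> \<xi> \<eta> \<longrightarrow>
        (\<forall>p\<in>topspace M. \<exists>W t z F G. p \<in> W \<and>
           ortho_toric_form M A g J \<omega> W \<xi> \<eta> t z F G) \<and>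
        (\<forall>W t z F G. connectedin M W \<and> ortho_toric_form M A g J \<omega> W \<xi> \<eta> t z F G \<longrightarrow>
           (\<forall>t' z'. (\<exists>F' G'. ortho_toric_form M A g J \<omega> W \<xi> \<eta> t' z' F' G') \<longleftrightarrow>
              (\<exists>a b. \<forall>q\<in>W. t' q = t q + a \<and> z' q = z q + b))))"
proof (intro conjI allI impI)
  fix g J \<omega> \<xi> \<eta> t z F G
  assume "ortho_toric_form M A g J \<omega> (topspace M) \<xi> \<eta> t z F G \<and> positive_definite A g"
  then interpret explicit_ortho_toric M A g J \<omega> \<xi> \<eta> t z F G
    using assms by unfold_locales blast+
  show "\<exists>ori. ortho_toric_kaehler M A ori g J \<omega> \<xi> \<eta>" by (rule ortho_toric_kaehler)
next
  fix ori g J \<omega> \<xi> \<eta>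
  assume "ortho_toric_kaehler M A ori g J \<omega> \<xi> \<eta>"
  then interpret ortho_toric_kaehler_manifold M A ori g J \<omega> \<xi> \<eta>
    by unfold_locales
  show "\<forall>p\<in>topspace M. \<exists>W t z F G. p \<in> W \<and> ortho_toric_form M A g J \<omega> W \<xi> \<eta> t z F G"
    using local_form by blast
  fix W t z F G t' z'
  assume W: "connectedin M W \<and> ortho_toric_form M A g J \<omega> W \<xi> \<eta> t z F G"
  show "(\<exists>F' G'. ortho_toric_form M A g J \<omega> W \<xi> \<eta> t' z' F' G') \<longleftrightarrow>
      (\<exists>a b. \<forall>q\<in>W. t' q = t q + a \<and> z' q = z q + b)"
  proof
    assume "\<exists>F' G'. ortho_toric_form M A g J \<omega> W \<xi> \<eta> t' z' F' G'"
    then show "\<exists>a b. \<forall>q\<in>W. t' q = t q + a \<and> z' q = z q + b"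
      using coordinates_unique W by blast
  next
    assume "\<exists>a b. \<forall>q\<in>W. t' q = t q + a \<and> z' q = z q + b"
    then obtain a b where "\<And>q. q \<in> W \<Longrightarrow> t' q = t q + a" "\<And>q. q \<in> W \<Longrightarrow> z' q = z q + b" by blast
    then have "ortho_toric_form M A g J \<omega> W \<xi> \<eta> t' z' F G"
      using form_translate W by blast
    then show "\<exists>F' G'. ortho_toric_form M A g J \<omega> W \<xi> \<eta> t' z' F' G'" by blast
  qed
qed

end
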